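(* Let $n=n_1+n_2$, $p\in[1,\infty)$, $\delta \in (0,1)$ and $w \in A_{1,\mathfrak{R}}$ in $\mathbb{R}^n=\mathbb{R}^{n_1}\times\mathbb{R}^{n_2}$. Let $p_{\delta,w}^*$ be defined by $$\frac{1}{p} -\frac{1}{ p_{\delta,w}^* }= \frac{\delta}{n} \, \frac{1}{1+\log [w]_{A_{1,\mathfrak{R}}} },$$ where it is understood that $0<p_{\delta,w}^*<\infty$. Then there exists a constant $c$ such that for every locally integrable function $f$ and each $R=I_1\times I_2 \in \mathfrak{R}$, $$\left( \frac1{w(R)}\int_{ R } |f -f_{R}|^{p_{\delta,w}^*}\,w\,dx\right)^{\frac{1}{p_{\delta,w}^*}} \leq c\,[w]_{A_{1,\mathfrak{R}}}^{\frac1p}\, (1-\delta)^{\frac1p}\,\big(a_1(R)+a_2(R)\big),$$ where $$a_1(R)= \left( \frac{\ell(I_1)^{p\delta} }{w(R)} \int_{I_2}\int_{I_1} \int_{ I_1} \frac{|f(x_1,x_2)- f(y_1,x_2)|^p}{|x_1-y_1|^{n_1+p\delta}}\,dy_1\, w(x_1,x_2)\, dx_1\, dx_2\right)^{\frac1p}$$ and $$a_2(R)= \left( \frac{\ell(I_2)^{p\delta} }{w(R)} \int_{I_1}\int_{I_2} \int_{ I_2} \frac{|f(y_1,x_2)- f(y_1,y_2)|^p}{|x_2-y_2|^{n_2+p\delta}}\,dx_2\, w(y_1,y_2)\, dy_2\,dy_1 \right)^{\frac1p}.$$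
   Context: $\mathfrak{R}$ is the family of rectangles $R=I_1\times I_2\subset\mathbb{R}^n$ where $I_1\subset\mathbb{R}^{n_1}$ and $I_2\subset\mathbb{R}^{n_2}$ are cubes with sides parallel to the coordinate axes, $n=n_1+n_2$; $\ell(I)$ is the sidelength of the cube $I$. Points are written $(x_1,x_2)$ with $x_i\in\mathbb{R}^{n_i}$, and $f_R=\frac1{|R|}\int_Rf\,dx$. A weight is a nonnegative locally integrable function $w$, and $w(E)=\int_Ew\,dx$. The weight $w$ belongs to $A_{1,\mathfrak{R}}$ if there is a finite constant $c$ with $\frac1{|R|}\int_R w\,dx\le c\,\operatorname{ess\,inf}_R w$ for all $R\in\mathfrak{R}$; the smallest such $c$ is $[w]_{A_{1,\mathfrak{R}}}$. *)

theory Defs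
  imports "HOL-Analysis.Analysis" "HOL-Probability.Essential_Supremum"
begin

definition cube :: "real ^ 'k \<Rightarrow> real \<Rightarrow> (real ^ 'k) set" where
  "cube a l = cbox a (a + (\<chi> i. l))"

definition cubes :: "(real ^ 'k) set set" where
  "cubes = {cube a l | a l. 0 < l}"

definition side :: "(real ^ 'k) set \<Rightarrow> real" where
  "side I = (THE l. 0 < l \<and> (\<exists>a. I = cube a l))"

lemma side_cube:
  fixes a :: "real ^ 'k"
  assumes "0 < l"
  shows "side (cube a l) = l"
proof -
  have "l' = l" if l': "0 < l'" and eq: "cube a l = cube b l'" for b :: "real ^ 'k" and l'
  proof -
    have ne: "cbox a (a + (\<chi> i. l)) \<noteq> {}" "cbox b (b + (\<chi> i. l')) \<noteq> {}"
      using assms l' by (auto simp: interval_ne_empty_cart not_less)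
    have ends: "a = b" "a + (\<chi> i. l) = b + (\<chi> i. l')"
      using eq ne unfolding cube_def by (metis eq_cbox)+
    then have "(a + (\<chi> i. l)) $ k = (a + (\<chi> i. l')) $ k" for k
      by simp
    then show ?thesis by simp
  qed
  then show ?thesis
    unfolding side_def using assms by (intro the_equality) auto
qed

definition rectangles :: "((real ^ 'n1) \<times> (real ^ 'n2)) set set" where
  "rectangles = {I1 \<times> I2 | I1 I2. I1 \<in> cubes \<and> I2 \<in> cubes}"

definition locally_integrable :: "('a::euclidean_space \<Rightarrow> real) \<Rightarrow> bool" where
  "locally_integrable f \<longleftrightarrow> (\<forall>K. compact K \<longrightarrow> f absolutely_integrable_on K)"

definition average :: "('a::euclidean_space \<Rightarrow> real) \<Rightarrow> 'a set \<Rightarrow> real" where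
  "average f R = (LINT x:R|lebesgue. f x) / measure lebesgue R"

definition weight :: "('a::euclidean_space \<Rightarrow> real) \<Rightarrow> bool" where
  "weight w \<longleftrightarrow> (\<forall>x. 0 \<le> w x) \<and> locally_integrable w"

definition wmeas :: "('a::euclidean_space \<Rightarrow> real) \<Rightarrow> 'a set \<Rightarrow> ennreal" where
  "wmeas w E = (\<integral>\<^sup>+x\<in>E. ennreal (w x) \<partial>lebesgue)"

definition essinf_on :: "'a::euclidean_space set \<Rightarrow> ('a \<Rightarrow> real) \<Rightarrow> ereal" where
  "essinf_on R w = - esssup (restrict_space lebesgue R) (\<lambda>x. - ereal (w x))"

definition A1_bound :: "((real ^ 'n1) \<times> (real ^ 'n2) \<Rightarrow> real) \<Rightarrow> real \<Rightarrow> bool" where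
  "A1_bound w c \<longleftrightarrow> (\<forall>R\<in>rectangles. ereal (average w R) \<le> ereal c * essinf_on R w)"

definition A1_weight :: "((real ^ 'n1) \<times> (real ^ 'n2) \<Rightarrow> real) \<Rightarrow> bool" where
  "A1_weight w \<longleftrightarrow> weight w \<and> (\<exists>c\<ge>0. A1_bound w c)"

text \<open>The condition \<open>0 \<le> c\<close> matters only for a weight that vanishes almost everywhere;
  for every other weight \<open>A1_bound w c\<close> forces \<open>1 \<le> c\<close>.\<close>

definition A1_const :: "((real ^ 'n1) \<times> (real ^ 'n2) \<Rightarrow> real) \<Rightarrow> real" where
  "A1_const w = Inf {c. 0 \<le> c \<and> A1_bound w c}"

text \<open>The \<open>a\<close>-th power on \<open>[0, \<infinity>]\<close>, for \<open>a > 0\<close> only.\<close>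

definition epowr :: "ennreal \<Rightarrow> real \<Rightarrow> ennreal" where
  "epowr x a = (if x = \<infinity> then \<infinity> else ennreal (enn2real x powr a))"

text \<open>The functionals \<open>a\<^sub>1\<close>, \<open>a\<^sub>2\<close> are infinite when the integral defining them diverges.\<close>

definition a1 :: "real \<Rightarrow> real \<Rightarrow> ((real ^ 'n1) \<times> (real ^ 'n2) \<Rightarrow> real) \<Rightarrow>
    ((real ^ 'n1) \<times> (real ^ 'n2) \<Rightarrow> real) \<Rightarrow> (real ^ 'n1) set \<Rightarrow> (real ^ 'n2) set \<Rightarrow> ennreal" where
  "a1 p \<delta> w f I1 I2 =
    epowr (ennreal (side I1 powr (p * \<delta>)) / wmeas w (I1 \<times> I2) *
      (\<integral>\<^sup>+x2\<in>I2. (\<integral>\<^sup>+x1\<in>I1.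
        (\<integral>\<^sup>+y1\<in>I1. ennreal (\<bar>f (x1, x2) - f (y1, x2)\<bar> powr p
            / norm (x1 - y1) powr (real CARD('n1) + p * \<delta>)) \<partial>lebesgue)
        * ennreal (w (x1, x2)) \<partial>lebesgue) \<partial>lebesgue))
     (1 / p)"

definition a2 :: "real \<Rightarrow> real \<Rightarrow> ((real ^ 'n1) \<times> (real ^ 'n2) \<Rightarrow> real) \<Rightarrow>
    ((real ^ 'n1) \<times> (real ^ 'n2) \<Rightarrow> real) \<Rightarrow> (real ^ 'n1) set \<Rightarrow> (real ^ 'n2) set \<Rightarrow> ennreal" where
  "a2 p \<delta> w f I1 I2 =
    epowr (ennreal (side I2 powr (p * \<delta>)) / wmeas w (I1 \<times> I2) *
      (\<integral>\<^sup>+y1\<in>I1. (\<integral>\<^sup>+y2\<in>I2.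
        (\<integral>\<^sup>+x2\<in>I2. ennreal (\<bar>f (y1, x2) - f (y1, y2)\<bar> powr p
            / norm (x2 - y2) powr (real CARD('n2) + p * \<delta>)) \<partial>lebesgue)
        * ennreal (w (y1, y2)) \<partial>lebesgue) \<partial>lebesgue))
     (1 / p)"

end

theory Submission
  imports Defs
begin

text \<open>
  Fix \<open>p\<close> and \<open>p\<^sup>*\<close> and put \<open>\<kappa> = 1/p - 1/p\<^sup>*\<close>. The relation defining \<open>p\<^sup>*\<close> forces \<open>\<delta> \<ge> \<kappa> n\<close> and
  \<open>[w] \<le> exp (1 / (\<kappa> n))\<close>, so only the factor \<open>(1 - \<delta>) powr (1/p)\<close> has to be tracked; every other
  constant may depend on an upper bound for \<open>[w]\<close>.

  On a convex set, iterating \<open>x, y \<mapsto> (x + y)/2\<close> bounds the double integral of \<open>|f x - f y| powr p\<close> by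
  \<open>1 - \<delta>\<close> times the Gagliardo integral. Applied in each of the two variables, and combined with the
  \<open>A\<^sub>1\<close> condition, this controls the mean oscillation of \<open>f\<close> over every dyadic subrectangle \<open>Q\<close> of
  generation \<open>j\<close> by \<open>(2 powr (- j p \<delta>) \<nu>(Q) / w(Q)) powr (1/p)\<close>, where \<open>\<nu>\<close> is the measure whose total mass
  is the right-hand side. Telescoping dyadic averages, and splitting the sum as Hedberg does between
  the dyadic maximal function of \<open>\<nu>\<close> and the trivial bound \<open>w(Q) \<ge> 2 powr (- j n) w(R) / A\<close>, gives
  the weak type \<open>(p, p\<^sup>*)\<close> estimate. Since the energy \<open>\<nu>\<close> is superadditive over the layers
  of a truncation, the weak estimate for the layers sums to the strong one.
\<close>

section \<open>Fractional Poincare inequalities\<close>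

text \<open>With \<open>D = 2 ^ n\<close>, one dyadic generation improves the oscillation by
  \<open>D powr - \<kappa>\<close>, while the A1 condition lets the upper bound for \<nu>(Q)/w(Q)
  grow by at most the factor \<open>D\<close>. Since \<open>1/p - \<kappa> = 1/pstar\<close> and
  \<kappa> are both positive, the telescoping series grows geometrically up to a crossover
  generation and decays geometrically after it; only the peak matters. The pointwise bound obtained
  in this way controls the \<open>pstar\<close>-th power of the deviation linearly by the dyadic
  maximal function of \<nu>, and that function is only of weak type at exponent 1. This is why a
  truncation is needed. It works because the weak estimate is linear in the energy of a layer, up to
  a power of a bound common to all layers. The A1 condition acts twice: on R it bounds w(Q) from
  below, and on Q it turns a Lebesgue integral of the energy density into a weighted one. The
  functions are merely Lebesgue measurable and the cubes are closed, so the argument runs on Borel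
  representatives and half-open boxes and is transferred at the end.\<close>

lemma powr_add_le_convex:
  fixes a b p :: real
  assumes "0 \<le> a" "0 \<le> b" "1 \<le> p"
  shows "(a + b) powr p \<le> 2 powr (p - 1) * (a powr p + b powr p)"
proof (cases "a = 0 \<or> b = 0")
  case True
  have "1 \<le> 2 powr (p - 1)" using assms by (simp add: ge_one_powr_ge_zero)
  then show ?thesis using True mult_right_mono[of 1 "2 powr (p - 1)" "a powr p + b powr p"] by auto
next
  case False
  then have "((1 - 1/2) *\<^sub>R a + (1/2) *\<^sub>R b) powr p \<le> (1 - 1/2) * a powr p + (1/2) * b powr p"
    using convex_onD[OF powr_convex[OF assms(3)], of "1/2" a b] assms by simp
  then have "((a + b) / 2) powr p \<le> (a powr p + b powr p) / 2"
    by (simp add: field_simps)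
  moreover have "((a + b) / 2) powr p = (a + b) powr p / 2 powr p"
    using assms by (simp add: powr_divide)
  ultimately show ?thesis
    by (simp add: powr_diff field_simps)
qed

lemma nn_integral_lborel_affine:
  fixes f :: "'a::euclidean_space \<Rightarrow> ennreal"
  assumes [measurable]: "f \<in> borel_measurable borel" and "c \<noteq> 0"
  shows "(\<integral>\<^sup>+x. f x \<partial>lborel) = ennreal (\<bar>c\<bar> ^ DIM('a)) * (\<integral>\<^sup>+x. f (t + c *\<^sub>R x) \<partial>lborel)"
proof -
  have "(\<integral>\<^sup>+x. f x \<partial>lborel)
      = (\<integral>\<^sup>+x. f x \<partial>density (distr lborel borel (\<lambda>x. t + c *\<^sub>R x)) (\<lambda>_. ennreal (\<bar>c\<bar> ^ DIM('a))))"
    using lborel_affine[OF assms(2), of t] by simp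
  also have "\<dots> = ennreal (\<bar>c\<bar> ^ DIM('a)) * (\<integral>\<^sup>+x. f (t + c *\<^sub>R x) \<partial>lborel)"
    by (simp add: nn_integral_density nn_integral_distr nn_integral_cmult)
  finally show ?thesis .
qed

text \<open>Passing through the midpoint of \<open>x\<close> and \<open>y\<close> costs exactly \<open>2 powr (p + DIM('a))\<close>; any larger
  constant would destroy the factor \<open>1 - \<delta>\<close> below.\<close>

lemma double_integral_midpoint:
  fixes \<phi> :: "'a::euclidean_space \<Rightarrow> real" and p :: real
  assumes [measurable]: "\<phi> \<in> borel_measurable borel" "J \<in> sets borel"
    and J: "convex J" and p: "1 \<le> p"
  defines "S \<equiv> \<lambda>t. \<integral>\<^sup>+x. \<integral>\<^sup>+y. ennreal (\<bar>\<phi> x - \<phi> y\<bar> powr p) *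
      indicator {(x, y). x \<in> J \<and> y \<in> J \<and> norm (x - y) \<le> t} (x, y) \<partial>lborel \<partial>lborel"
  shows "S (2 * t) \<le> ennreal (2 powr (p + DIM('a))) * S t"
proof -
  define h where "h x z = ennreal (\<bar>\<phi> x - \<phi> z\<bar> powr p) *
      indicator {(x, y). x \<in> J \<and> y \<in> J \<and> norm (x - y) \<le> t} (x, z)" for x z
  have [measurable]: "case_prod h \<in> borel_measurable (borel \<Otimes>\<^sub>M borel)"
    unfolding h_def by measurable
  have pt: "ennreal (\<bar>\<phi> x - \<phi> y\<bar> powr p) *
      indicator {(x, y). x \<in> J \<and> y \<in> J \<and> norm (x - y) \<le> 2 * t} (x, y)
    \<le> ennreal (2 powr (p - 1)) * (h x ((1/2) *\<^sub>R x + (1/2) *\<^sub>R y) + h y ((1/2) *\<^sub>R y + (1/2) *\<^sub>R x))"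
    (is "?l \<le> _") for x y
  proof (cases "x \<in> J \<and> y \<in> J \<and> norm (x - y) \<le> 2 * t")
    case True
    define m where "m = (1/2) *\<^sub>R x + (1/2) *\<^sub>R y"
    have m': "m = (1/2) *\<^sub>R y + (1/2) *\<^sub>R x" by (simp add: m_def add.commute)
    have mJ: "m \<in> J" using True J by (auto simp: m_def intro!: convexD)
    have "x - m = (1/2) *\<^sub>R (x - y)" "y - m = - ((1/2) *\<^sub>R (x - y))"
      by (simp_all add: m_def algebra_simps flip: scaleR_add_left)
    then have "norm (x - m) \<le> t" "norm (y - m) \<le> t" using True
      by (simp_all only: norm_minus_cancel norm_scaleR) simp_all
    then have hm: "h x m = ennreal (\<bar>\<phi> x - \<phi> m\<bar> powr p)" "h y m = ennreal (\<bar>\<phi> y - \<phi> m\<bar> powr p)"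
      using True mJ by (simp_all add: h_def)
    have "\<bar>\<phi> x - \<phi> y\<bar> powr p \<le> (\<bar>\<phi> x - \<phi> m\<bar> + \<bar>\<phi> y - \<phi> m\<bar>) powr p"
      using p by (intro powr_mono2) auto
    also have "\<dots> \<le> 2 powr (p - 1) * (\<bar>\<phi> x - \<phi> m\<bar> powr p + \<bar>\<phi> y - \<phi> m\<bar> powr p)"
      using p by (intro powr_add_le_convex) auto
    finally have "ennreal (\<bar>\<phi> x - \<phi> y\<bar> powr p) \<le> ennreal (2 powr (p - 1)) * (h x m + h y m)"
      unfolding hm by (simp add: ennreal_leI flip: ennreal_plus ennreal_mult)
    then show ?thesis using True unfolding m_def[symmetric] m'[symmetric] by simp
  qed simp
  have St: "S t = (\<integral>\<^sup>+x. \<integral>\<^sup>+y. h x y \<partial>lborel \<partial>lborel)"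
    unfolding S_def h_def ..
  \<comment> \<open>The map \<open>y \<mapsto> (x + y)/2\<close> has Jacobian
    \<open>2 ^ - DIM('a)\<close>. The two midpoint terms have equal integrals by symmetry, and the
    resulting factor 2 turns \<open>2 powr (p - 1)\<close> into \<open>2 powr p\<close>.\<close>
  have aff: "(\<integral>\<^sup>+y. h x ((1/2) *\<^sub>R x + (1/2) *\<^sub>R y) \<partial>lborel) = ennreal (2 ^ DIM('a)) * (\<integral>\<^sup>+y. h x y \<partial>lborel)" for x
  proof -
    have "ennreal (2 ^ DIM('a)) * (\<integral>\<^sup>+y. h x y \<partial>lborel)
        = ennreal (2 ^ DIM('a)) * (ennreal ((1/2) ^ DIM('a)) * (\<integral>\<^sup>+y. h x ((1/2) *\<^sub>R x + (1/2) *\<^sub>R y) \<partial>lborel))"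
      by (subst nn_integral_lborel_affine[where c="1/2" and t="(1/2) *\<^sub>R x"]) simp_all
    also have "\<dots> = ennreal (2 ^ DIM('a) * (1/2) ^ DIM('a)) * (\<integral>\<^sup>+y. h x ((1/2) *\<^sub>R x + (1/2) *\<^sub>R y) \<partial>lborel)"
      by (subst ennreal_mult) (simp_all add: mult.assoc)
    also have "(2::real) ^ DIM('a) * (1/2) ^ DIM('a) = 1" by (simp flip: power_mult_distrib)
    finally show ?thesis by simp
  qed
  have "S (2 * t) \<le> (\<integral>\<^sup>+x. \<integral>\<^sup>+y. ennreal (2 powr (p - 1)) *
      (h x ((1/2) *\<^sub>R x + (1/2) *\<^sub>R y) + h y ((1/2) *\<^sub>R y + (1/2) *\<^sub>R x)) \<partial>lborel \<partial>lborel)"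
    unfolding S_def by (intro nn_integral_mono pt)
  also have "\<dots> = ennreal (2 powr (p - 1)) * ((\<integral>\<^sup>+x. \<integral>\<^sup>+y. h x ((1/2) *\<^sub>R x + (1/2) *\<^sub>R y) \<partial>lborel \<partial>lborel)
      + (\<integral>\<^sup>+x. \<integral>\<^sup>+y. h y ((1/2) *\<^sub>R y + (1/2) *\<^sub>R x) \<partial>lborel \<partial>lborel))"
    by (simp add: nn_integral_cmult nn_integral_add)
  also have "(\<integral>\<^sup>+x. \<integral>\<^sup>+y. h y ((1/2) *\<^sub>R y + (1/2) *\<^sub>R x) \<partial>lborel \<partial>lborel)
     = (\<integral>\<^sup>+x. \<integral>\<^sup>+y. h x ((1/2) *\<^sub>R x + (1/2) *\<^sub>R y) \<partial>lborel \<partial>lborel)"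
    by (rule lborel_pair.Fubini') measurable
  also have "(\<integral>\<^sup>+x. \<integral>\<^sup>+y. h x ((1/2) *\<^sub>R x + (1/2) *\<^sub>R y) \<partial>lborel \<partial>lborel)
     = ennreal (2 ^ DIM('a)) * S t"
    unfolding aff by (subst nn_integral_cmult) (simp_all add: St)
  also have "ennreal (2 powr (p - 1)) * (ennreal (2 ^ DIM('a)) * S t + ennreal (2 ^ DIM('a)) * S t)
     = ennreal (2 powr (p - 1) * 2 ^ DIM('a) * 2) * S t"
    by (simp add: ennreal_mult' mult_ac flip: mult_2)
  also have "2 powr (p - 1) * 2 ^ DIM('a) * 2 = 2 powr (p + DIM('a))"
    by (simp add: powr_add powr_diff powr_realpow)
  finally show ?thesis .
qed

text \<open>A geometric sum of ratio at least 2 is at most twice its last term, and the last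
  surviving term is at most \<open>Y\<close>.\<close>

lemma sum_truncated_geometric_le:
  fixes x Y :: real
  assumes "2 \<le> x" "0 \<le> Y"
  shows "(\<Sum>m<N. if x ^ m \<le> Y then x ^ m else 0) \<le> 2 * Y"
proof (induction N)
  case 0
  then show ?case using assms by simp
next
  case (Suc N)
  have geo: "(\<Sum>m<Suc N. x ^ m) \<le> 2 * x ^ N"
  proof (induction N)
    case (Suc N)
    have "2 * x ^ N \<le> x * x ^ N" using assms by (intro mult_right_mono) auto
    then show ?case using Suc by simp
  qed simp
  show ?case
  proof (cases "x ^ N \<le> Y")
    case True
    have "(\<Sum>m<Suc N. if x ^ m \<le> Y then x ^ m else 0) \<le> (\<Sum>m<Suc N. x ^ m)"
      using assms by (intro sum_mono) auto
    then show ?thesis using geo True by linarith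
  qed (use Suc in simp)
qed

text \<open>The gain \<open>1 - \<delta>\<close>: each of the infinitely many scales \<open>D / 2 ^ m\<close> contributes to the right-hand
  side at least \<open>2 powr (- m * p * (1 - \<delta>))\<close> times the left-hand side.\<close>

lemma fractional_poincare_convex:
  fixes \<phi> :: "'a::euclidean_space \<Rightarrow> real" and p \<delta> D :: real
  assumes [measurable]: "\<phi> \<in> borel_measurable borel" "J \<in> sets borel"
    and J: "convex J" and p: "1 \<le> p" and \<delta>: "0 < \<delta>" "\<delta> < 1"
    and D: "0 < D" "\<And>x y. x \<in> J \<Longrightarrow> y \<in> J \<Longrightarrow> norm (x - y) \<le> D"
  shows "(\<integral>\<^sup>+x. \<integral>\<^sup>+y. ennreal (\<bar>\<phi> x - \<phi> y\<bar> powr p) * indicator (J \<times> J) (x, y) \<partial>lborel \<partial>lborel)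
    \<le> ennreal (2 * p * (1 - \<delta>) * D powr (real DIM('a) + p * \<delta>)) *
      (\<integral>\<^sup>+x. \<integral>\<^sup>+y. ennreal (\<bar>\<phi> x - \<phi> y\<bar> powr p / norm (x - y) powr (real DIM('a) + p * \<delta>)) *
        indicator (J \<times> J) (x, y) \<partial>lborel \<partial>lborel)" (is "?T \<le> _ * ?I")
proof -
  define s where "s = DIM('a) + p * \<delta>"
  \<comment> \<open>The ratio of \<open>2 powr s\<close>, the gain of the kernel when the distance
    is halved, to the cost \<open>2 powr (p + DIM('a))\<close> of one midpoint step.\<close>
  define q where "q = 2 powr (- p * (1 - \<delta>))"
  define E where "E t = {(x, y). x \<in> J \<and> y \<in> J \<and> norm (x - y) \<le> t}" for t
  define S where "S t = (\<integral>\<^sup>+x. \<integral>\<^sup>+y. ennreal (\<bar>\<phi> x - \<phi> y\<bar> powr p) * indicator (E t) (x, y) \<partial>lborel \<partial>lborel)" for t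
  have "1 \<le> real DIM('a)" "0 \<le> p * \<delta>" using p \<delta> DIM_positive[where 'a='a] by auto
  then have s1: "1 \<le> s" unfolding s_def by linarith
  have q: "0 < q" "q < 1" unfolding q_def using p \<delta> by (auto simp: powr_less_one)
  have [measurable]: "(indicator (E t) :: _ \<Rightarrow> ennreal) \<in> borel_measurable (borel \<Otimes>\<^sub>M borel)" for t
    unfolding E_def by measurable
  have "E D = J \<times> J" using D by (auto simp: E_def)
  then have TS: "?T = S D" by (simp add: S_def)
  have scale: "?T \<le> ennreal (2 powr ((p + DIM('a)) * m)) * S (D / 2 ^ m)" for m
  proof (induction m)
    case (Suc m)
    have "S (2 * (D / 2 ^ Suc m)) \<le> ennreal (2 powr (p + DIM('a))) * S (D / 2 ^ Suc m)"
      unfolding S_def E_def using J p by (intro double_integral_midpoint) auto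
    then have "ennreal (2 powr ((p + DIM('a)) * m)) * S (D / 2 ^ m)
        \<le> ennreal (2 powr ((p + DIM('a)) * m)) * (ennreal (2 powr (p + DIM('a))) * S (D / 2 ^ Suc m))"
      by (intro mult_left_mono) auto
    also have "\<dots> = ennreal (2 powr ((p + DIM('a)) * m) * 2 powr (p + DIM('a))) * S (D / 2 ^ Suc m)"
      by (simp add: ennreal_mult mult.assoc)
    also have "2 powr ((p + DIM('a)) * m) * 2 powr (p + DIM('a)) = 2 powr ((p + DIM('a)) * Suc m)"
      by (simp add: algebra_simps flip: powr_add)
    finally show ?case using Suc by simp
  qed (simp add: TS)
  have scale': "ennreal (q ^ m) * ?T \<le> ennreal ((2 powr s) ^ m) * S (D / 2 ^ m)" for m
  proof -
    have "ennreal (q ^ m) * ?T \<le> ennreal (q ^ m) * (ennreal (2 powr ((p + DIM('a)) * m)) * S (D / 2 ^ m))"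
      by (intro mult_left_mono scale) auto
    also have "\<dots> = ennreal (q ^ m * 2 powr ((p + DIM('a)) * m)) * S (D / 2 ^ m)"
      using q by (simp add: ennreal_mult mult.assoc)
    also have "q ^ m * 2 powr ((p + DIM('a)) * m) = (2 powr s) ^ m"
    proof -
      have "q ^ m * 2 powr ((p + DIM('a)) * m) = 2 powr (- p * (1 - \<delta>) * m + (p + DIM('a)) * m)"
        unfolding q_def powr_add by (simp add: powr_power mult_ac)
      also have "- p * (1 - \<delta>) * m + (p + DIM('a)) * m = s * m"
        by (simp add: s_def algebra_simps)
      finally show ?thesis by (simp add: powr_power mult.commute)
    qed
    finally show ?thesis .
  qed
  \<comment> \<open>For a fixed pair only the scales with
    \<open>norm (x - y) \<le> D / 2 ^ m\<close> survive. They form a truncated geometric sum in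
    \<open>2 powr s\<close> whose size is that of the kernel itself; on the diagonal the difference
    of values is 0.\<close>
  have pt: "(\<Sum>m<N. ennreal ((2 powr s) ^ m) * (ennreal (\<bar>\<phi> x - \<phi> y\<bar> powr p) * indicator (E (D / 2 ^ m)) (x, y)))
     \<le> ennreal (2 * D powr s) * (ennreal (\<bar>\<phi> x - \<phi> y\<bar> powr p / norm (x - y) powr s) *
        indicator (J \<times> J) (x, y))" for N x y
  proof (cases "x \<in> J \<and> y \<in> J \<and> x \<noteq> y")
    case True
    define r where "r = norm (x - y)"
    have r: "0 < r" using True by (simp add: r_def)
    have ind: "indicator (E (D / 2 ^ m)) (x, y) = (if (2 powr s) ^ m \<le> (D / r) powr s then 1 else 0 :: ennreal)" for m
    proof -
      have "r \<le> D / 2 ^ m \<longleftrightarrow> 2 ^ m \<le> D / r" using r by (simp add: field_simps)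
      also have "\<dots> \<longleftrightarrow> (2 ^ m) powr s \<le> (D / r) powr s"
        using s1 D r powr_mono2[of s "2 ^ m" "D / r"] powr_less_mono2[of s "D / r" "2 ^ m"]
        by (cases "2 ^ m \<le> D / r") auto
      also have "(2 ^ m) powr s = (2 powr real m) powr s"
        by (simp add: powr_realpow)
      also have "\<dots> = (2 powr s) ^ m"
        by (simp add: powr_powr powr_power)
      finally show ?thesis using True by (auto simp: E_def r_def)
    qed
    have "(\<Sum>m<N. ennreal ((2 powr s) ^ m) * (ennreal (\<bar>\<phi> x - \<phi> y\<bar> powr p) * indicator (E (D / 2 ^ m)) (x, y)))
      = (\<Sum>m<N. ennreal ((if (2 powr s) ^ m \<le> (D / r) powr s then (2 powr s) ^ m else 0) * \<bar>\<phi> x - \<phi> y\<bar> powr p))"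
      by (intro sum.cong) (auto simp: ind ennreal_mult)
    also have "\<dots> = ennreal ((\<Sum>m<N. if (2 powr s) ^ m \<le> (D / r) powr s then (2 powr s) ^ m else 0) * \<bar>\<phi> x - \<phi> y\<bar> powr p)"
      unfolding sum_distrib_right by (intro sum_ennreal) auto
    also have "\<dots> \<le> ennreal (2 * (D / r) powr s * \<bar>\<phi> x - \<phi> y\<bar> powr p)"
      using s1 powr_mono[of 1 s 2] by (intro ennreal_leI mult_right_mono sum_truncated_geometric_le) auto
    also have "2 * (D / r) powr s * \<bar>\<phi> x - \<phi> y\<bar> powr p = 2 * D powr s * (\<bar>\<phi> x - \<phi> y\<bar> powr p / r powr s)"
      using D r by (simp add: powr_divide)
    finally show ?thesis using True by (simp add: r_def flip: ennreal_mult)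
  next
    case False
    then show ?thesis by (auto simp: E_def intro!: sum_nonpos)
  qed
  have part: "(\<Sum>m<N. ennreal (q ^ m) * ?T) \<le> ennreal (2 * D powr s) * ?I" for N
  proof -
    have "(\<Sum>m<N. ennreal (q ^ m) * ?T) \<le> (\<Sum>m<N. ennreal ((2 powr s) ^ m) * S (D / 2 ^ m))"
      by (intro sum_mono scale')
    also have "\<dots> = (\<integral>\<^sup>+x. \<integral>\<^sup>+y. (\<Sum>m<N. ennreal ((2 powr s) ^ m) *
        (ennreal (\<bar>\<phi> x - \<phi> y\<bar> powr p) * indicator (E (D / 2 ^ m)) (x, y))) \<partial>lborel \<partial>lborel)"
      by (simp add: S_def nn_integral_sum nn_integral_cmult)
    also have "\<dots> \<le> (\<integral>\<^sup>+x. \<integral>\<^sup>+y. ennreal (2 * D powr s) * (ennreal (\<bar>\<phi> x - \<phi> y\<bar> powr p / norm (x - y) powr s) *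
        indicator (J \<times> J) (x, y)) \<partial>lborel \<partial>lborel)"
      by (intro nn_integral_mono pt)
    also have "\<dots> = ennreal (2 * D powr s) * ?I"
      unfolding s_def by (simp add: nn_integral_cmult)
    finally show ?thesis .
  qed
  have "(\<Sum>m. ennreal (q ^ m)) = ennreal (1 / (1 - q))"
    using q geometric_sums[of q] by (intro suminf_ennreal_eq) auto
  moreover have "(\<Sum>m. ennreal (q ^ m) * ?T) \<le> ennreal (2 * D powr s) * ?I"
    by (intro suminf_le_const part) simp
  ultimately have "ennreal (1 / (1 - q)) * ?T \<le> ennreal (2 * D powr s) * ?I"
    by simp
  then have "ennreal (1 - q) * (ennreal (1 / (1 - q)) * ?T) \<le> ennreal (1 - q) * (ennreal (2 * D powr s) * ?I)"
    by (intro mult_left_mono) auto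
  moreover have "ennreal (1 - q) * (ennreal (1 / (1 - q)) * ?T) = ?T"
    using q by (simp flip: mult.assoc ennreal_mult)
  \<comment> \<open>The origin of the factor 1 - \<delta>: \<open>q\<close> is an exponential, so
    \<open>exp t \<ge> 1 + t\<close> and \<open>ln 2 \<le> 1\<close> give
    \<open>1 - q \<le> p * (1 - \<delta>)\<close>.\<close>
  moreover have "ennreal (1 - q) * (ennreal (2 * D powr s) * ?I) \<le> ennreal (2 * p * (1 - \<delta>) * D powr s) * ?I"
  proof -
    have "1 - p * (1 - \<delta>) \<le> 1 + - p * (1 - \<delta>) * ln 2"
    proof -
      have "p * (1 - \<delta>) * ln 2 \<le> p * (1 - \<delta>) * 1"
        using p \<delta> ln_le_minus_one[of "2::real"] by (intro mult_left_mono) auto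
      then show ?thesis by simp
    qed
    also have "\<dots> \<le> q" unfolding q_def using exp_ge_add_one_self[of "- p * (1 - \<delta>) * ln 2"]
      by (simp add: powr_def)
    finally have "(1 - q) * (2 * D powr s) \<le> p * (1 - \<delta>) * (2 * D powr s)"
      by (intro mult_right_mono) auto
    then have "ennreal ((1 - q) * (2 * D powr s)) * ?I \<le> ennreal (2 * p * (1 - \<delta>) * D powr s) * ?I"
      by (intro mult_right_mono ennreal_leI) (auto simp: algebra_simps)
    then show ?thesis using q by (simp add: ennreal_mult mult.assoc)
  qed
  ultimately show ?thesis unfolding s_def by simp
qed


section \<open>The Poincare inequality in both variables\<close>

lemma nn_integral_lborel_prod:
  fixes f :: "'a::euclidean_space \<times> 'b::euclidean_space \<Rightarrow> ennreal"
  assumes "f \<in> borel_measurable borel"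
  shows "(\<integral>\<^sup>+z. f z \<partial>lborel) = (\<integral>\<^sup>+x. \<integral>\<^sup>+y. f (x, y) \<partial>lborel \<partial>lborel)"
proof -
  have "f \<in> borel_measurable (lborel \<Otimes>\<^sub>M lborel)"
    using assms by (simp add: lborel_prod)
  from lborel.nn_integral_fst[OF this] show ?thesis
    by (simp add: lborel_prod)
qed

text \<open>Only the innermost integral of \<open>a1\<close>, left as a function of the outer point:
  it is integrated against Lebesgue measure in the Poincare inequality and against \<open>w\<close>
  in the energy.\<close>

definition gagliardo1 :: "real \<Rightarrow> real \<Rightarrow> 'a set \<Rightarrow> ('a::euclidean_space \<times> 'b::euclidean_space \<Rightarrow> real) \<Rightarrow>
    'a \<times> 'b \<Rightarrow> ennreal" where
  "gagliardo1 p \<delta> J g x = (\<integral>\<^sup>+y. ennreal (\<bar>g x - g (y, snd x)\<bar> powr p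
      / norm (fst x - y) powr (real DIM('a) + p * \<delta>)) * indicator J y \<partial>lborel)"

definition gagliardo2 :: "real \<Rightarrow> real \<Rightarrow> 'b set \<Rightarrow> ('a::euclidean_space \<times> 'b::euclidean_space \<Rightarrow> real) \<Rightarrow>
    'a \<times> 'b \<Rightarrow> ennreal" where
  "gagliardo2 p \<delta> J g x = (\<integral>\<^sup>+y. ennreal (\<bar>g x - g (fst x, y)\<bar> powr p
      / norm (snd x - y) powr (real DIM('b) + p * \<delta>)) * indicator J y \<partial>lborel)"

lemma borel_measurable_gagliardo1 [measurable]:
  fixes g :: "'a::euclidean_space \<times> 'b::euclidean_space \<Rightarrow> real"
  assumes g: "g \<in> borel_measurable borel" and [measurable]: "J \<in> sets borel"
  shows "gagliardo1 p \<delta> J g \<in> borel_measurable borel"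
proof -
  have [measurable]: "g \<in> borel_measurable (borel \<Otimes>\<^sub>M borel)"
    using g by (simp add: borel_prod)
  have "gagliardo1 p \<delta> J g \<in> borel_measurable (borel \<Otimes>\<^sub>M borel)"
    unfolding gagliardo1_def by measurable
  then show ?thesis by (simp add: borel_prod)
qed

lemma borel_measurable_gagliardo2 [measurable]:
  fixes g :: "'a::euclidean_space \<times> 'b::euclidean_space \<Rightarrow> real"
  assumes g: "g \<in> borel_measurable borel" and [measurable]: "J \<in> sets borel"
  shows "gagliardo2 p \<delta> J g \<in> borel_measurable borel"
proof -
  have [measurable]: "g \<in> borel_measurable (borel \<Otimes>\<^sub>M borel)"
    using g by (simp add: borel_prod)
  have "gagliardo2 p \<delta> J g \<in> borel_measurable (borel \<Otimes>\<^sub>M borel)"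
    unfolding gagliardo2_def by measurable
  then show ?thesis by (simp add: borel_prod)
qed

text \<open>One coordinate is changed at a time, through the corner \<open>(y1, x2)\<close>. Each
  half involves three of the four variables, so the fourth integrates to the measure of a factor and
  the one-variable inequality applies on almost every line. With this corner the two halves have
  \<open>(x1, x2)\<close> and \<open>(y1, y2)\<close> as outer points, as in \<open>a1\<close> and
  \<open>a2\<close>.\<close>

lemma fractional_poincare_product:
  fixes g :: "'a::euclidean_space \<times> 'b::euclidean_space \<Rightarrow> real" and p \<delta> D1 D2 :: real
  assumes g: "g \<in> borel_measurable borel" and [measurable]: "Q1 \<in> sets borel" "Q2 \<in> sets borel"
    and cvx: "convex Q1" "convex Q2" and p: "1 \<le> p" and \<delta>: "0 < \<delta>" "\<delta> < 1"
    and D1: "0 < D1" "\<And>x y. x \<in> Q1 \<Longrightarrow> y \<in> Q1 \<Longrightarrow> norm (x - y) \<le> D1"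
    and D2: "0 < D2" "\<And>x y. x \<in> Q2 \<Longrightarrow> y \<in> Q2 \<Longrightarrow> norm (x - y) \<le> D2"
  defines "Q \<equiv> Q1 \<times> Q2"
  shows "(\<integral>\<^sup>+x. \<integral>\<^sup>+y. ennreal (\<bar>g x - g y\<bar> powr p) * indicator (Q \<times> Q) (x, y) \<partial>lborel \<partial>lborel)
    \<le> ennreal (2 powr (p - 1) * (2 * p * (1 - \<delta>))) *
      (emeasure lborel Q2 * (ennreal (D1 powr (real DIM('a) + p * \<delta>)) * (\<integral>\<^sup>+x. gagliardo1 p \<delta> Q1 g x * indicator Q x \<partial>lborel))
       + emeasure lborel Q1 * (ennreal (D2 powr (real DIM('b) + p * \<delta>)) * (\<integral>\<^sup>+x. gagliardo2 p \<delta> Q2 g x * indicator Q x \<partial>lborel)))"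
proof -
  have [measurable]: "g \<in> borel_measurable (borel \<Otimes>\<^sub>M borel)" "g \<in> borel_measurable borel"
    using g by (simp_all add: borel_prod)
  have [measurable]: "(\<lambda>x. g (x, y)) \<in> borel_measurable borel" "(\<lambda>y. g (x, y)) \<in> borel_measurable borel" for x y
    by measurable
  have Qb [measurable]: "Q \<in> sets (borel \<Otimes>\<^sub>M borel)" "Q \<in> sets borel"
    unfolding Q_def by (simp, simp flip: borel_prod)
  define a where "a = (\<lambda>(x1, x2, y1). ennreal (\<bar>g (x1, x2) - g (y1, x2)\<bar> powr p) * indicator Q1 x1 * indicator Q2 x2 * indicator Q1 y1)"
  define b where "b = (\<lambda>(y1, y2, x2). ennreal (\<bar>g (y1, y2) - g (y1, x2)\<bar> powr p) * indicator Q1 y1 * indicator Q2 y2 * indicator Q2 x2)"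
  have [measurable]: "a \<in> borel_measurable (borel \<Otimes>\<^sub>M borel \<Otimes>\<^sub>M borel)"
    "b \<in> borel_measurable (borel \<Otimes>\<^sub>M borel \<Otimes>\<^sub>M borel)"
    unfolding a_def b_def by measurable
  let ?c = "ennreal (2 powr (p - 1))"
  let ?d = "ennreal (2 * p * (1 - \<delta>))"
  have c: "?c * ?d = ennreal (2 powr (p - 1) * (2 * p * (1 - \<delta>)))"
    using p \<delta> by (simp add: ennreal_mult)
  have pt: "ennreal (\<bar>g (x1, x2) - g (y1, y2)\<bar> powr p) * indicator (Q \<times> Q) ((x1, x2), (y1, y2))
     \<le> ?c * (a (x1, x2, y1) * indicator Q2 y2 + b (y1, y2, x2) * indicator Q1 x1)" for x1 x2 y1 y2
  proof -
    have "\<bar>g (x1, x2) - g (y1, y2)\<bar> powr p \<le> (\<bar>g (x1, x2) - g (y1, x2)\<bar> + \<bar>g (y1, y2) - g (y1, x2)\<bar>) powr p"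
      using p by (intro powr_mono2) auto
    also have "\<dots> \<le> 2 powr (p - 1) * (\<bar>g (x1, x2) - g (y1, x2)\<bar> powr p + \<bar>g (y1, y2) - g (y1, x2)\<bar> powr p)"
      using p by (intro powr_add_le_convex) auto
    finally have "ennreal (\<bar>g (x1, x2) - g (y1, y2)\<bar> powr p)
      \<le> ?c * (ennreal (\<bar>g (x1, x2) - g (y1, x2)\<bar> powr p) + ennreal (\<bar>g (y1, y2) - g (y1, x2)\<bar> powr p))"
      by (simp add: ennreal_leI flip: ennreal_plus ennreal_mult)
    then show ?thesis
      by (auto simp: Q_def a_def b_def indicator_def)
  qed
  have "(\<integral>\<^sup>+x. \<integral>\<^sup>+y. ennreal (\<bar>g x - g y\<bar> powr p) * indicator (Q \<times> Q) (x, y) \<partial>lborel \<partial>lborel)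
     = (\<integral>\<^sup>+x1. \<integral>\<^sup>+x2. \<integral>\<^sup>+y1. \<integral>\<^sup>+y2. ennreal (\<bar>g (x1, x2) - g (y1, y2)\<bar> powr p) *
         indicator (Q \<times> Q) ((x1, x2), (y1, y2)) \<partial>lborel \<partial>lborel \<partial>lborel \<partial>lborel)"
    by (subst nn_integral_lborel_prod, measurable, subst nn_integral_lborel_prod, measurable)
  also have "\<dots> \<le> (\<integral>\<^sup>+x1. \<integral>\<^sup>+x2. \<integral>\<^sup>+y1. \<integral>\<^sup>+y2.
      ?c * (a (x1, x2, y1) * indicator Q2 y2 + b (y1, y2, x2) * indicator Q1 x1) \<partial>lborel \<partial>lborel \<partial>lborel \<partial>lborel)"
    by (intro nn_integral_mono pt)
  also have "\<dots> = ?c * ((\<integral>\<^sup>+x1. \<integral>\<^sup>+x2. \<integral>\<^sup>+y1. \<integral>\<^sup>+y2. a (x1, x2, y1) * indicator Q2 y2 \<partial>lborel \<partial>lborel \<partial>lborel \<partial>lborel)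
     + (\<integral>\<^sup>+x1. \<integral>\<^sup>+x2. \<integral>\<^sup>+y1. \<integral>\<^sup>+y2. b (y1, y2, x2) * indicator Q1 x1 \<partial>lborel \<partial>lborel \<partial>lborel \<partial>lborel))"
    by (simp add: nn_integral_cmult nn_integral_add)
  also have "(\<integral>\<^sup>+x1. \<integral>\<^sup>+x2. \<integral>\<^sup>+y1. \<integral>\<^sup>+y2. a (x1, x2, y1) * indicator Q2 y2 \<partial>lborel \<partial>lborel \<partial>lborel \<partial>lborel)
     = emeasure lborel Q2 * (\<integral>\<^sup>+x1. \<integral>\<^sup>+x2. \<integral>\<^sup>+y1. a (x1, x2, y1) \<partial>lborel \<partial>lborel \<partial>lborel)"
    by (simp add: nn_integral_cmult nn_integral_multc mult.commute)
  also have "(\<integral>\<^sup>+x1. \<integral>\<^sup>+x2. \<integral>\<^sup>+y1. a (x1, x2, y1) \<partial>lborel \<partial>lborel \<partial>lborel)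
     = (\<integral>\<^sup>+x2. \<integral>\<^sup>+x1. \<integral>\<^sup>+y1. a (x1, x2, y1) \<partial>lborel \<partial>lborel \<partial>lborel)"
    by (rule lborel_pair.Fubini'[symmetric]) measurable
  also have "(\<integral>\<^sup>+x1. \<integral>\<^sup>+x2. \<integral>\<^sup>+y1. \<integral>\<^sup>+y2. b (y1, y2, x2) * indicator Q1 x1 \<partial>lborel \<partial>lborel \<partial>lborel \<partial>lborel)
     = emeasure lborel Q1 * (\<integral>\<^sup>+x2. \<integral>\<^sup>+y1. \<integral>\<^sup>+y2. b (y1, y2, x2) \<partial>lborel \<partial>lborel \<partial>lborel)"
    by (simp add: nn_integral_cmult nn_integral_multc mult.commute)
  also have "(\<integral>\<^sup>+x2. \<integral>\<^sup>+y1. \<integral>\<^sup>+y2. b (y1, y2, x2) \<partial>lborel \<partial>lborel \<partial>lborel)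
      = (\<integral>\<^sup>+y1. \<integral>\<^sup>+x2. \<integral>\<^sup>+y2. b (y1, y2, x2) \<partial>lborel \<partial>lborel \<partial>lborel)"
    by (rule lborel_pair.Fubini') measurable
  also have "\<dots> = (\<integral>\<^sup>+y1. \<integral>\<^sup>+y2. \<integral>\<^sup>+x2. b (y1, y2, x2) \<partial>lborel \<partial>lborel \<partial>lborel)"
    by (intro nn_integral_cong lborel_pair.Fubini') measurable
  also have "?c * (emeasure lborel Q2 * (\<integral>\<^sup>+x2. \<integral>\<^sup>+x1. \<integral>\<^sup>+y1. a (x1, x2, y1) \<partial>lborel \<partial>lborel \<partial>lborel)
      + emeasure lborel Q1 * (\<integral>\<^sup>+y1. \<integral>\<^sup>+y2. \<integral>\<^sup>+x2. b (y1, y2, x2) \<partial>lborel \<partial>lborel \<partial>lborel))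
    \<le> ?c * (emeasure lborel Q2 * (?d * (ennreal (D1 powr (real DIM('a) + p * \<delta>)) * (\<integral>\<^sup>+x. gagliardo1 p \<delta> Q1 g x * indicator Q x \<partial>lborel)))
      + emeasure lborel Q1 * (?d * (ennreal (D2 powr (real DIM('b) + p * \<delta>)) * (\<integral>\<^sup>+x. gagliardo2 p \<delta> Q2 g x * indicator Q x \<partial>lborel))))"
  proof (intro mult_left_mono add_mono)
    have "(\<integral>\<^sup>+x1. \<integral>\<^sup>+y1. a (x1, x2, y1) \<partial>lborel \<partial>lborel) \<le> ennreal (2 * p * (1 - \<delta>) * D1 powr (real DIM('a) + p * \<delta>)) *
      (\<integral>\<^sup>+x1. gagliardo1 p \<delta> Q1 g (x1, x2) * indicator Q (x1, x2) \<partial>lborel)" for x2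
    proof (cases "x2 \<in> Q2")
      case True
      have "(\<integral>\<^sup>+x1. \<integral>\<^sup>+y1. a (x1, x2, y1) \<partial>lborel \<partial>lborel) = (\<integral>\<^sup>+x1. \<integral>\<^sup>+y1.
          ennreal (\<bar>g (x1, x2) - g (y1, x2)\<bar> powr p) * indicator (Q1 \<times> Q1) (x1, y1) \<partial>lborel \<partial>lborel)"
        using True by (intro nn_integral_cong) (auto simp: a_def indicator_def)
      also have "\<dots> \<le> ennreal (2 * p * (1 - \<delta>) * D1 powr (real DIM('a) + p * \<delta>)) *
        (\<integral>\<^sup>+x1. \<integral>\<^sup>+y1. ennreal (\<bar>g (x1, x2) - g (y1, x2)\<bar> powr p / norm (x1 - y1) powr (real DIM('a) + p * \<delta>)) *
           indicator (Q1 \<times> Q1) (x1, y1) \<partial>lborel \<partial>lborel)"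
        using p \<delta> D1 cvx by (intro fractional_poincare_convex) auto
      also have "(\<integral>\<^sup>+x1. \<integral>\<^sup>+y1. ennreal (\<bar>g (x1, x2) - g (y1, x2)\<bar> powr p / norm (x1 - y1) powr (real DIM('a) + p * \<delta>)) *
           indicator (Q1 \<times> Q1) (x1, y1) \<partial>lborel \<partial>lborel)
        = (\<integral>\<^sup>+x1. gagliardo1 p \<delta> Q1 g (x1, x2) * indicator Q (x1, x2) \<partial>lborel)"
        using True unfolding gagliardo1_def
        by (intro nn_integral_cong, subst nn_integral_multc[symmetric])
           (auto simp: Q_def indicator_def intro!: nn_integral_cong)
      finally show ?thesis .
    qed (simp add: a_def)
    then have "(\<integral>\<^sup>+x2. \<integral>\<^sup>+x1. \<integral>\<^sup>+y1. a (x1, x2, y1) \<partial>lborel \<partial>lborel \<partial>lborel)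
      \<le> (\<integral>\<^sup>+x2. ennreal (2 * p * (1 - \<delta>) * D1 powr (real DIM('a) + p * \<delta>)) *
      (\<integral>\<^sup>+x1. gagliardo1 p \<delta> Q1 g (x1, x2) * indicator Q (x1, x2) \<partial>lborel) \<partial>lborel)"
      by (intro nn_integral_mono) blast
    also have "\<dots> = ennreal (2 * p * (1 - \<delta>) * D1 powr (real DIM('a) + p * \<delta>)) *
      (\<integral>\<^sup>+x2. \<integral>\<^sup>+x1. gagliardo1 p \<delta> Q1 g (x1, x2) * indicator Q (x1, x2) \<partial>lborel \<partial>lborel)"
      by (intro nn_integral_cmult) measurable
    also have "(\<integral>\<^sup>+x2. \<integral>\<^sup>+x1. gagliardo1 p \<delta> Q1 g (x1, x2) * indicator Q (x1, x2) \<partial>lborel \<partial>lborel)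
      = (\<integral>\<^sup>+x. gagliardo1 p \<delta> Q1 g x * indicator Q x \<partial>lborel)"
      by (subst nn_integral_lborel_prod, measurable, rule lborel_pair.Fubini') measurable
    finally show "(\<integral>\<^sup>+x2. \<integral>\<^sup>+x1. \<integral>\<^sup>+y1. a (x1, x2, y1) \<partial>lborel \<partial>lborel \<partial>lborel)
      \<le> ?d * (ennreal (D1 powr (real DIM('a) + p * \<delta>)) * (\<integral>\<^sup>+x. gagliardo1 p \<delta> Q1 g x * indicator Q x \<partial>lborel))"
      using p \<delta> by (simp add: ennreal_mult mult.assoc)
    have "(\<integral>\<^sup>+y2. \<integral>\<^sup>+x2. b (y1, y2, x2) \<partial>lborel \<partial>lborel) \<le> ennreal (2 * p * (1 - \<delta>) * D2 powr (real DIM('b) + p * \<delta>)) *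
      (\<integral>\<^sup>+y2. gagliardo2 p \<delta> Q2 g (y1, y2) * indicator Q (y1, y2) \<partial>lborel)" for y1
    proof (cases "y1 \<in> Q1")
      case True
      have "(\<integral>\<^sup>+y2. \<integral>\<^sup>+x2. b (y1, y2, x2) \<partial>lborel \<partial>lborel) = (\<integral>\<^sup>+y2. \<integral>\<^sup>+x2.
          ennreal (\<bar>g (y1, y2) - g (y1, x2)\<bar> powr p) * indicator (Q2 \<times> Q2) (y2, x2) \<partial>lborel \<partial>lborel)"
        using True by (intro nn_integral_cong) (auto simp: b_def indicator_def)
      also have "\<dots> \<le> ennreal (2 * p * (1 - \<delta>) * D2 powr (real DIM('b) + p * \<delta>)) *
        (\<integral>\<^sup>+y2. \<integral>\<^sup>+x2. ennreal (\<bar>g (y1, y2) - g (y1, x2)\<bar> powr p / norm (y2 - x2) powr (real DIM('b) + p * \<delta>)) *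
           indicator (Q2 \<times> Q2) (y2, x2) \<partial>lborel \<partial>lborel)"
        using p \<delta> D2 cvx by (intro fractional_poincare_convex) auto
      also have "(\<integral>\<^sup>+y2. \<integral>\<^sup>+x2. ennreal (\<bar>g (y1, y2) - g (y1, x2)\<bar> powr p / norm (y2 - x2) powr (real DIM('b) + p * \<delta>)) *
           indicator (Q2 \<times> Q2) (y2, x2) \<partial>lborel \<partial>lborel)
        = (\<integral>\<^sup>+y2. gagliardo2 p \<delta> Q2 g (y1, y2) * indicator Q (y1, y2) \<partial>lborel)"
        using True unfolding gagliardo2_def
        by (intro nn_integral_cong, subst nn_integral_multc[symmetric])
           (auto simp: Q_def indicator_def intro!: nn_integral_cong)
      finally show ?thesis .
    qed (simp add: b_def)
    then have "(\<integral>\<^sup>+y1. \<integral>\<^sup>+y2. \<integral>\<^sup>+x2. b (y1, y2, x2) \<partial>lborel \<partial>lborel \<partial>lborel)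
      \<le> (\<integral>\<^sup>+y1. ennreal (2 * p * (1 - \<delta>) * D2 powr (real DIM('b) + p * \<delta>)) *
      (\<integral>\<^sup>+y2. gagliardo2 p \<delta> Q2 g (y1, y2) * indicator Q (y1, y2) \<partial>lborel) \<partial>lborel)"
      by (intro nn_integral_mono) blast
    also have "\<dots> = ennreal (2 * p * (1 - \<delta>) * D2 powr (real DIM('b) + p * \<delta>)) *
      (\<integral>\<^sup>+y1. \<integral>\<^sup>+y2. gagliardo2 p \<delta> Q2 g (y1, y2) * indicator Q (y1, y2) \<partial>lborel \<partial>lborel)"
      by (intro nn_integral_cmult) measurable
    also have "(\<integral>\<^sup>+y1. \<integral>\<^sup>+y2. gagliardo2 p \<delta> Q2 g (y1, y2) * indicator Q (y1, y2) \<partial>lborel \<partial>lborel)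
      = (\<integral>\<^sup>+x. gagliardo2 p \<delta> Q2 g x * indicator Q x \<partial>lborel)"
      by (subst nn_integral_lborel_prod) measurable
    finally show "(\<integral>\<^sup>+y1. \<integral>\<^sup>+y2. \<integral>\<^sup>+x2. b (y1, y2, x2) \<partial>lborel \<partial>lborel \<partial>lborel)
      \<le> ?d * (ennreal (D2 powr (real DIM('b) + p * \<delta>)) * (\<integral>\<^sup>+x. gagliardo2 p \<delta> Q2 g x * indicator Q x \<partial>lborel))"
      using p \<delta> by (simp add: ennreal_mult mult.assoc)
  qed auto
  also have "\<dots> = ?c * ?d * (emeasure lborel Q2 * (ennreal (D1 powr (real DIM('a) + p * \<delta>)) * (\<integral>\<^sup>+x. gagliardo1 p \<delta> Q1 g x * indicator Q x \<partial>lborel))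
       + emeasure lborel Q1 * (ennreal (D2 powr (real DIM('b) + p * \<delta>)) * (\<integral>\<^sup>+x. gagliardo2 p \<delta> Q2 g x * indicator Q x \<partial>lborel)))"
    by (simp add: distrib_left mult_ac)
  finally show ?thesis unfolding c .
qed

section \<open>Oscillation on nested partitions\<close>

lemma sum_power_inj_le:
  fixes r :: real
  assumes r: "0 < r" "r < 1" and "finite S" "inj_on \<phi> S"
  shows "(\<Sum>j\<in>S. r ^ \<phi> j) \<le> 1 / (1 - r)"
proof -
  have "(\<Sum>j\<in>S. r ^ \<phi> j) = (\<Sum>k\<in>\<phi> ` S. r ^ k)"
    using assms by (simp add: sum.reindex)
  also have "\<dots> \<le> (\<Sum>k. r ^ k)"
    using assms by (intro sum_le_suminf) (auto simp: summable_geometric)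
  finally show ?thesis using r by (simp add: suminf_geometric)
qed

text \<open>Two geometric series of ratio \<open>D powr - \<epsilon>\<close>, one on each side of a
  peak; the factor \<open>D powr \<epsilon>\<close> pays for rounding a real peak to an
  integer.\<close>

definition two_sided_const :: "real \<Rightarrow> real \<Rightarrow> real" where
  "two_sided_const D \<epsilon> = D powr \<epsilon> * (2 / (1 - D powr - \<epsilon>))"

lemma sum_two_sided_geometric_le:
  fixes D \<epsilon> m :: real
  assumes D: "1 < D" and \<epsilon>: "0 < \<epsilon>"
  shows "(\<Sum>j<N. D powr (- \<epsilon> * \<bar>real j - m\<bar>)) \<le> two_sided_const D \<epsilon>"
proof -
  define r where "r = D powr - \<epsilon>"
  \<comment> \<open>A negative peak is moved to 0, which only shortens the distances to it; a
    nonnegative one moves by less than 1.\<close>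
  define z where "z = nat \<lfloor>m\<rfloor>"
  have r: "0 < r" "r < 1" using D \<epsilon> unfolding r_def by (auto intro: powr_less_one)
  have pw: "r ^ k = D powr (- \<epsilon> * real k)" for k
    using D unfolding r_def by (simp add: powr_power mult.commute)
  have bd: "D powr (- \<epsilon> * \<bar>real j - m\<bar>) \<le> D powr \<epsilon> * r ^ (if j < z then z - j else j - z)" for j
  proof -
    have "real (if j < z then z - j else j - z) \<le> \<bar>real j - m\<bar> + 1"
      unfolding z_def by (cases "0 \<le> m") (auto simp: of_nat_diff, linarith+)
    then have "\<epsilon> * real (if j < z then z - j else j - z) \<le> \<epsilon> * (\<bar>real j - m\<bar> + 1)"
      using \<epsilon> by (intro mult_left_mono) auto
    then have "D powr (- \<epsilon> * \<bar>real j - m\<bar>) \<le> D powr (\<epsilon> + - \<epsilon> * real (if j < z then z - j else j - z))"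
      using D by (intro powr_mono) (auto simp: algebra_simps)
    then show ?thesis by (simp only: powr_add pw)
  qed
  have "(\<Sum>j<N. r ^ (if j < z then z - j else j - z))
      = (\<Sum>j\<in>{..<N} \<inter> {j. j < z}. r ^ (z - j)) + (\<Sum>j\<in>{..<N} \<inter> - {j. j < z}. r ^ (j - z))"
    by (subst sum.If_cases[symmetric]) (auto intro!: sum.cong)
  also have "\<dots> \<le> 1 / (1 - r) + 1 / (1 - r)"
    using r by (intro add_mono sum_power_inj_le) (auto intro!: inj_onI)
  finally have "(\<Sum>j<N. r ^ (if j < z then z - j else j - z)) \<le> 2 / (1 - r)"
    by simp
  then have "D powr \<epsilon> * (\<Sum>j<N. r ^ (if j < z then z - j else j - z)) \<le> two_sided_const D \<epsilon>"
    unfolding two_sided_const_def r_def[symmetric] by (intro mult_left_mono) auto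
  moreover have "(\<Sum>j<N. D powr (- \<epsilon> * \<bar>real j - m\<bar>)) \<le> D powr \<epsilon> * (\<Sum>j<N. r ^ (if j < z then z - j else j - z))"
    unfolding sum_distrib_left by (intro sum_mono bd)
  ultimately show ?thesis by linarith
qed

text \<open>Cells are indexed by the points that they contain, so that \<open>cell_refl\<close> and
  \<open>cell_eq\<close> already express that a generation is a partition. All cells of a generation
  have the same measure; \<open>D\<close> is the ratio between consecutive generations.\<close>

locale nested_partition = M: finite_measure M
  for M :: "'a measure" +
  fixes \<Omega> :: "'a set" and cell :: "nat \<Rightarrow> 'a \<Rightarrow> 'a set" and D :: real
  assumes D_gt_1: "1 < D"
    and measure_pos: "0 < measure M \<Omega>"
    and cell_sets [measurable]: "\<And>x j. x \<in> \<Omega> \<Longrightarrow> cell j x \<in> sets M"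
    and cell_refl: "\<And>x j. x \<in> \<Omega> \<Longrightarrow> x \<in> cell j x"
    and cell_eq: "\<And>x y j. x \<in> \<Omega> \<Longrightarrow> y \<in> cell j x \<Longrightarrow> cell j y = cell j x"
    and cell_0: "\<And>x. x \<in> \<Omega> \<Longrightarrow> cell 0 x = \<Omega>"
    and cell_Suc: "\<And>x j. x \<in> \<Omega> \<Longrightarrow> cell (Suc j) x \<subseteq> cell j x"
    and finite_cells: "\<And>j. finite (cell j ` \<Omega>)"
    and measure_cell: "\<And>x j. x \<in> \<Omega> \<Longrightarrow> measure M (cell j x) = measure M \<Omega> / D ^ j"
begin

lemma \<Omega>_nonempty: "\<Omega> \<noteq> {}"
  using measure_pos by auto

lemma \<Omega>_sets [measurable]: "\<Omega> \<in> sets M"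
  using \<Omega>_nonempty cell_sets[of _ 0] cell_0 by auto

lemma cell_antimono:
  assumes "i \<le> j" "x \<in> \<Omega>" shows "cell j x \<subseteq> cell i x"
  using assms(1)
proof (induction rule: dec_induct)
  case (step k)
  then show ?case using cell_Suc[OF assms(2), of k] by blast
qed simp

lemma cell_subset: "x \<in> \<Omega> \<Longrightarrow> cell j x \<subseteq> \<Omega>"
  using cell_antimono[of 0 j x] cell_0 by auto

lemma measure_cell_pos: "x \<in> \<Omega> \<Longrightarrow> 0 < measure M (cell j x)"
  using measure_cell measure_pos D_gt_1 by simp

lemma disjoint_cells: "disjoint_family_on (\<lambda>Q. Q) (cell j ` \<Omega>)"
  unfolding disjoint_family_on_def
proof (intro ballI impI)
  fix P Q assume "P \<in> cell j ` \<Omega>" "Q \<in> cell j ` \<Omega>" and ne: "P \<noteq> Q"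
  then obtain x y where "x \<in> \<Omega>" "y \<in> \<Omega>" "P = cell j x" "Q = cell j y" by auto
  then show "P \<inter> Q = {}" using ne cell_eq by (metis disjoint_iff)
qed

lemma Union_cells: "\<Union>(cell j ` \<Omega>) = \<Omega>"
  using cell_subset cell_refl by fastforce

lemma measure_Union_cells:
  assumes "finite_measure N" "sets N = sets M" "\<Q> \<subseteq> cell j ` \<Omega>"
  shows "measure N (\<Union>\<Q>) = (\<Sum>Q\<in>\<Q>. measure N Q)"
proof -
  have "(\<lambda>Q. Q) ` \<Q> \<subseteq> sets N" using assms cell_sets by auto
  then show ?thesis
    using finite_measure.finite_measure_finite_Union[OF assms(1), of \<Q> "\<lambda>Q. Q"]
      finite_subset[OF assms(3) finite_cells] disjoint_family_on_mono[OF assms(3) disjoint_cells]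
    by simp
qed

lemma measure_Union_cells_mono:
  assumes "finite_measure N1" "sets N1 = sets M" "finite_measure N2" "sets N2 = sets M"
    and "\<Q> \<subseteq> cell j ` \<Omega>" "\<And>Q. Q \<in> \<Q> \<Longrightarrow> c * measure N1 Q \<le> measure N2 Q"
  shows "c * measure N1 (\<Union>\<Q>) \<le> measure N2 (\<Union>\<Q>)"
proof -
  have "c * measure N1 (\<Union>\<Q>) = (\<Sum>Q\<in>\<Q>. c * measure N1 Q)"
    using measure_Union_cells[OF assms(1,2,5)] by (simp add: sum_distrib_left)
  also have "\<dots> \<le> (\<Sum>Q\<in>\<Q>. measure N2 Q)" by (intro sum_mono assms)
  also have "\<dots> = measure N2 (\<Union>\<Q>)" using measure_Union_cells[OF assms(3,4,5)] by simp
  finally show ?thesis .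
qed

lemma Union_cells_sets:
  assumes "\<Q> \<subseteq> cell j ` \<Omega>" shows "\<Union>\<Q> \<in> sets M"
  using finite_subset[OF assms finite_cells] assms cell_sets by (intro sets.finite_Union) auto

text \<open>Stopping time: every bad point is charged to the first generation in which its cell is bad.\<close>

lemma maximal_weak_type:
  assumes W: "finite_measure W" "sets W = sets M" and \<nu>: "finite_measure \<nu>" "sets \<nu> = sets M"
    and t: "0 \<le> t"
  defines "B \<equiv> {x \<in> \<Omega>. \<exists>j. t * measure W (cell j x) < measure \<nu> (cell j x)}"
  shows "B \<in> sets M" "t * measure W B \<le> measure \<nu> \<Omega>"
proof -
  define bad where "bad j x \<longleftrightarrow> t * measure W (cell j x) < measure \<nu> (cell j x)" for j x
  define T where "T j = {x \<in> \<Omega>. bad j x \<and> (\<forall>i<j. \<not> bad i x)}" for j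
  \<comment> \<open>Points of one cell of generation \<open>j\<close> have the same ancestors, hence
    stop together. So \<open>T j\<close> is a finite union of cells of generation \<open>j\<close>,
    which makes it measurable and lets the inequality for bad cells be summed.\<close>
  have T_cell: "cell j x \<subseteq> T j" if x: "x \<in> T j" for j x
  proof
    fix y assume y: "y \<in> cell j x"
    have x\<Omega>: "x \<in> \<Omega>" using x by (simp add: T_def)
    have "cell i y = cell i x" if "i \<le> j" for i
      using cell_antimono[OF that x\<Omega>] y cell_eq[OF x\<Omega>] by blast
    then have "bad i y \<longleftrightarrow> bad i x" if "i \<le> j" for i
      using that by (simp add: bad_def)
    then show "y \<in> T j" using x y cell_subset[OF x\<Omega>] by (auto simp: T_def)
  qed
  have T_Union: "T j = \<Union>(cell j ` T j)" for j
  proof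
    show "T j \<subseteq> \<Union>(cell j ` T j)" using cell_refl by (auto simp: T_def)
    show "\<Union>(cell j ` T j) \<subseteq> T j" using T_cell by auto
  qed
  have T_sub: "cell j ` T j \<subseteq> cell j ` \<Omega>" for j by (auto simp: T_def)
  have T_sets: "T j \<in> sets M" for j
    by (subst T_Union) (rule Union_cells_sets[OF T_sub])
  have T_le: "t * measure W (T j) \<le> measure \<nu> (T j)" for j
    by (subst (1 2) T_Union, rule measure_Union_cells_mono[OF W \<nu> T_sub]) (auto simp: T_def bad_def)
  have disj: "disjoint_family T"
    unfolding disjoint_family_on_def
  proof (intro ballI impI)
    fix i j :: nat assume "i \<noteq> j"
    then consider "i < j" | "j < i" by linarith
    then show "T i \<inter> T j = {}" by cases (auto simp: T_def)
  qed
  have BT: "B = (\<Union>j. T j)"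
  proof
    show "B \<subseteq> (\<Union>j. T j)"
    proof
      fix x assume "x \<in> B"
      then have x: "x \<in> \<Omega>" "\<exists>j. bad j x" by (auto simp: B_def bad_def)
      then have "x \<in> T (LEAST j. bad j x)"
        using LeastI_ex[OF x(2)] not_less_Least by (auto simp: T_def)
      then show "x \<in> (\<Union>j. T j)" by blast
    qed
  qed (auto simp: T_def B_def bad_def)
  show "B \<in> sets M" unfolding BT using T_sets by auto
  have sW: "(\<lambda>j. measure W (T j)) sums measure W B"
    unfolding BT using W T_sets disj by (intro finite_measure.finite_measure_UNION) auto
  have s\<nu>: "(\<lambda>j. measure \<nu> (T j)) sums measure \<nu> B"
    unfolding BT using \<nu> T_sets disj by (intro finite_measure.finite_measure_UNION) auto
  have "t * measure W B \<le> measure \<nu> B"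
    using sums_le[OF T_le sums_mult[OF sW] s\<nu>] .
  also have "\<dots> \<le> measure \<nu> \<Omega>"
    using \<nu> by (intro finite_measure.finite_measure_mono) (auto simp: B_def)
  finally show "t * measure W B \<le> measure \<nu> \<Omega>" .
qed

section \<open>Averages over cells\<close>

definition avg :: "('a \<Rightarrow> real) \<Rightarrow> 'a set \<Rightarrow> real" where
  "avg g Q = (LINT x:Q|M. g x) / measure M Q"

lemma set_integrable_const:
  fixes c :: real
  assumes "Q \<in> sets M" shows "set_integrable M Q (\<lambda>_. c)"
  unfolding set_integrable_def using assms
  by (intro integrable_scaleR_left integrable_real_indicator) (auto simp: less_top[symmetric])

lemma set_integral_nonneg_mono_set:
  fixes h :: "'a \<Rightarrow> real"
  assumes "set_integrable M Q h" "P \<in> sets M" "P \<subseteq> Q" "\<And>x. 0 \<le> h x"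
  shows "(LINT x:P|M. h x) \<le> (LINT x:Q|M. h x)"
proof -
  have "set_integrable M P h" using assms set_integrable_subset by blast
  then show ?thesis
    using assms unfolding set_lebesgue_integral_def set_integrable_def
    by (intro integral_mono) (auto simp: indicator_def)
qed

lemma set_integrable_subset_diff:
  assumes "set_integrable M \<Omega> g" "Q \<in> sets M" "Q \<subseteq> \<Omega>"
  shows "set_integrable M Q (\<lambda>x. \<bar>g x - (c::real)\<bar>)"
proof -
  have "set_integrable M Q g" using assms set_integrable_subset by blast
  moreover have "set_integrable M Q (\<lambda>_. c)"
    using assms by (intro set_integrable_const)
  ultimately show ?thesis by (intro set_integrable_abs set_integral_diff)
qed

text \<open>The constant is left free: in the telescoping it is the average over the parent cell, in
  the comparison with the double integral it is a value of the function.\<close>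

lemma avg_diff_le:
  assumes g: "set_integrable M \<Omega> g" and Q: "Q \<in> sets M" "Q \<subseteq> \<Omega>" "0 < measure M Q"
  shows "\<bar>avg g Q - c\<bar> \<le> (LINT x:Q|M. \<bar>g x - c\<bar>) / measure M Q"
proof -
  have 1: "set_integrable M Q g" using g Q set_integrable_subset by blast
  have 2: "set_integrable M Q (\<lambda>_. c)"
    using Q by (intro set_integrable_const)
  have "(LINT x:Q|M. g x - c) = (LINT x:Q|M. g x) - (LINT x:Q|M. c)"
    by (intro set_integral_diff 1 2)
  also have "(LINT x:Q|M. c) = measure M Q * c"
    using Q by (simp add: set_lebesgue_integral_def)
  finally have "avg g Q - c = (LINT x:Q|M. g x - c) / measure M Q"
    using Q by (simp add: avg_def diff_divide_distrib)
  then have "\<bar>avg g Q - c\<bar> = \<bar>LINT x:Q|M. g x - c\<bar> / measure M Q"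
    using Q by simp
  moreover have "\<bar>LINT x:Q|M. g x - c\<bar> \<le> (LINT x:Q|M. \<bar>g x - c\<bar>)"
    using set_integral_norm_bound[OF set_integral_diff(1)[OF 1 2]] by simp
  ultimately show ?thesis using Q by (simp add: divide_right_mono)
qed

end

text \<open>\<open>W_cell\<close> says that the weighted mass of a cell cannot shrink faster than
  its Lebesgue measure, up to \<open>A\<close>; it is what the A1 condition on the whole rectangle
  yields. \<open>ac\<close> carries the almost everywhere convergence of averages from
  \<open>M\<close> over to \<open>W\<close>.\<close>

locale weighted_nested_partition = nested_partition M \<Omega> cell D + W: finite_measure W
  for M :: "'a measure" and \<Omega> cell D and W :: "'a measure" +
  fixes A p ps \<kappa> :: real
  assumes sets_W [simp]: "sets W = sets M" and ac: "absolutely_continuous M W"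
    and A: "1 \<le> A" and W_pos: "0 < measure W \<Omega>"
    and W_cell: "\<And>x j. x \<in> \<Omega> \<Longrightarrow> measure W \<Omega> \<le> A * D ^ j * measure W (cell j x)"
    and p: "1 \<le> p" and ps: "0 < ps" and \<kappa>: "0 < \<kappa>" "\<kappa> = 1 / p - 1 / ps"
begin

text \<open>The quantifier over \<open>\<beta>\<close> replaces a \<open>p\<close>-th root: the mean oscillation of \<open>g\<close> over a cell \<open>Q\<close> of
  generation \<open>j\<close> is at most \<open>2 * D powr (- \<kappa> * j) * (\<nu>(Q) / W(Q)) powr (1 / p)\<close>.\<close>

definition poincare :: "('a \<Rightarrow> real) \<Rightarrow> 'a measure \<Rightarrow> bool" where
  "poincare g \<nu> \<longleftrightarrow> (\<forall>x\<in>\<Omega>. \<forall>j. \<forall>\<beta>>0.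
    D powr (- \<kappa> * p * j) * measure \<nu> (cell j x) \<le> \<beta> powr p * measure W (cell j x) \<longrightarrow>
    (LINT y:cell j x|M. \<bar>g y - avg g (cell j x)\<bar>) \<le> 2 * \<beta> * measure M (cell j x))"

lemma W_cell_pos: "x \<in> \<Omega> \<Longrightarrow> 0 < measure W (cell j x)"
  using W_cell[of x j] W_pos A D_gt_1 by (smt (verit) measure_nonneg mult_zero_right zero_less_mult_iff)

text \<open>The Poincare inequality bounds the L1 distance between \<open>g\<close> and its averages
  over the cells of generation \<open>j\<close> by a multiple of \<open>r ^ j\<close>. These
  distances are summable, so at almost every point the series of the differences converges and its
  terms tend to 0.\<close>

lemma AE_avg_tendsto:
  assumes g: "set_integrable M \<Omega> g" and gm [measurable]: "g \<in> borel_measurable M"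
    and \<nu>: "finite_measure \<nu>" "sets \<nu> = sets M" and P: "poincare g \<nu>"
  shows "AE x in M. x \<in> \<Omega> \<longrightarrow> (\<lambda>j. avg g (cell j x)) \<longlonglongrightarrow> g x"
proof -
  define E where "E j x = (\<Sum>Q\<in>cell j ` \<Omega>. avg g Q * indicator Q x)" for j x
  have Em [measurable]: "E j \<in> borel_measurable M" for j
    unfolding E_def using cell_sets by (intro borel_measurable_sum) auto
  have E_eq: "E j x = avg g (cell j x)" if x: "x \<in> \<Omega>" for j x
  proof -
    have "E j x = (\<Sum>Q\<in>{cell j x}. avg g Q * indicator Q x)"
      unfolding E_def
    proof (intro sum.mono_neutral_right finite_cells ballI)
      fix Q assume "Q \<in> cell j ` \<Omega> - {cell j x}"
      then have "x \<notin> Q" using cell_eq by auto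
      then show "avg g Q * indicator Q x = 0" by simp
    qed (use x in auto)
    then show ?thesis using cell_refl[OF x] by simp
  qed
  define r where "r = D powr - \<kappa>"
  have r: "0 < r" "r < 1" using D_gt_1 \<kappa> by (auto simp: r_def intro: powr_less_one)
  have rj: "r ^ j = D powr (- \<kappa> * real j)" for j
    using D_gt_1 by (simp add: r_def powr_power mult.commute)
  define a where "a = A * measure M \<Omega> / measure W \<Omega>"
  have osc: "(LINT y:cell j x|M. \<bar>g y - avg g (cell j x)\<bar>)
      \<le> 2 * r ^ j * (measure M (cell j x) + a * measure \<nu> (cell j x))" if x: "x \<in> \<Omega>" for j x
  proof -
    define v where "v = measure \<nu> (cell j x) / measure W (cell j x)"
    have v: "0 \<le> v" unfolding v_def by simp
    \<comment> \<open>The summand 1 keeps \<beta> positive and gives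
      \<open>v \<le> (1 + v) powr p\<close>. The \<open>p\<close>-th root is thereby replaced by a
      bound linear in \<nu>(Q)/W(Q), and since |Q|/W(Q) is at most \<open>a\<close>, this bound can
      be summed over the cells of a generation.\<close>
    define \<beta> where "\<beta> = r ^ j * (1 + v)"
    have \<beta>: "0 < \<beta>" using r v by (simp add: \<beta>_def)
    have "D powr (- \<kappa> * p * j) * measure \<nu> (cell j x) = D powr (- \<kappa> * p * j) * v * measure W (cell j x)"
      using W_cell_pos[OF x, of j] by (simp add: v_def)
    also have "v \<le> 1 + v" by simp
    also have "1 + v \<le> (1 + v) powr p"
      using v p powr_mono[of 1 p "1 + v"] by simp
    also have "D powr (- \<kappa> * p * j) * (1 + v) powr p = \<beta> powr p"
      using v r by (simp add: \<beta>_def rj powr_mult powr_powr mult_ac)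
    finally have "D powr (- \<kappa> * p * j) * measure \<nu> (cell j x) \<le> \<beta> powr p * measure W (cell j x)"
      by (simp add: mult_left_mono mult_right_mono)
    then have "(LINT y:cell j x|M. \<bar>g y - avg g (cell j x)\<bar>) \<le> 2 * \<beta> * measure M (cell j x)"
      using P x \<beta> unfolding poincare_def by blast
    also have "\<dots> = 2 * r ^ j * (measure M (cell j x) + measure M (cell j x) / measure W (cell j x) * measure \<nu> (cell j x))"
      by (simp add: \<beta>_def v_def algebra_simps)
    also have "measure M (cell j x) / measure W (cell j x) \<le> a"
    proof -
      have "measure M (cell j x) * measure W \<Omega> \<le> measure M \<Omega> / D ^ j * (A * D ^ j * measure W (cell j x))"
        unfolding measure_cell[OF x, of j] using D_gt_1 by (intro mult_left_mono W_cell x) auto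
      also have "\<dots> = A * measure M \<Omega> * measure W (cell j x)"
        using D_gt_1 by simp
      finally show ?thesis using W_pos W_cell_pos[OF x, of j]
        by (simp add: a_def field_simps)
    qed
    finally show ?thesis using r by (simp add: mult_left_mono mult_right_mono)
  qed
  define C where "C = 2 * (measure M \<Omega> + a * measure \<nu> \<Omega>)"
  have a0: "0 \<le> a" using A W_pos by (simp add: a_def)
  have L1: "(\<integral>\<^sup>+x. ennreal \<bar>g x - E j x\<bar> * indicator \<Omega> x \<partial>M) \<le> ennreal (C * r ^ j)" for j
  proof -
    have "(\<integral>\<^sup>+x. ennreal \<bar>g x - E j x\<bar> * indicator \<Omega> x \<partial>M)
        = (\<integral>\<^sup>+x. (\<Sum>Q\<in>cell j ` \<Omega>. ennreal \<bar>g x - avg g Q\<bar> * indicator Q x) \<partial>M)"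
    proof (intro nn_integral_cong)
      fix x
      show "ennreal \<bar>g x - E j x\<bar> * indicator \<Omega> x = (\<Sum>Q\<in>cell j ` \<Omega>. ennreal \<bar>g x - avg g Q\<bar> * indicator Q x)"
      proof (cases "x \<in> \<Omega>")
        case True
        have "(\<Sum>Q\<in>cell j ` \<Omega>. ennreal \<bar>g x - avg g Q\<bar> * indicator Q x)
           = (\<Sum>Q\<in>{cell j x}. ennreal \<bar>g x - avg g Q\<bar> * indicator Q x)"
        proof (intro sum.mono_neutral_right finite_cells ballI)
          fix Q assume "Q \<in> cell j ` \<Omega> - {cell j x}"
          then have "x \<notin> Q" using cell_eq by auto
          then show "ennreal \<bar>g x - avg g Q\<bar> * indicator Q x = 0" by simp
        qed (use True in auto)
        then show ?thesis using True cell_refl[OF True] by (simp add: E_eq)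
      next
        case False
        then have "x \<notin> Q" if "Q \<in> cell j ` \<Omega>" for Q using that cell_subset by blast
        then show ?thesis using False by simp
      qed
    qed
    also have "\<dots> = (\<Sum>Q\<in>cell j ` \<Omega>. \<integral>\<^sup>+x. ennreal \<bar>g x - avg g Q\<bar> * indicator Q x \<partial>M)"
      using cell_sets by (intro nn_integral_sum) auto
    also have "\<dots> \<le> (\<Sum>Q\<in>cell j ` \<Omega>. ennreal (2 * r ^ j * (measure M Q + a * measure \<nu> Q)))"
    proof (intro sum_mono)
      fix Q assume "Q \<in> cell j ` \<Omega>"
      then obtain x where x: "x \<in> \<Omega>" "Q = cell j x" by auto
      have "set_integrable M Q (\<lambda>y. \<bar>g y - avg g Q\<bar>)"
        using x cell_sets cell_subset g by (intro set_integrable_subset_diff) auto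
      then have "(\<integral>\<^sup>+y. ennreal \<bar>g y - avg g Q\<bar> * indicator Q y \<partial>M) = ennreal (LINT y:Q|M. \<bar>g y - avg g Q\<bar>)"
        unfolding set_integrable_def set_lebesgue_integral_def
        by (subst nn_integral_eq_integral[symmetric]) (auto intro!: nn_integral_cong simp: indicator_def)
      then show "(\<integral>\<^sup>+y. ennreal \<bar>g y - avg g Q\<bar> * indicator Q y \<partial>M) \<le> ennreal (2 * r ^ j * (measure M Q + a * measure \<nu> Q))"
        using osc[OF x(1), of j] x(2) by (simp add: ennreal_leI)
    qed
    also have "\<dots> = ennreal (\<Sum>Q\<in>cell j ` \<Omega>. 2 * r ^ j * (measure M Q + a * measure \<nu> Q))"
      using r a0 by (intro sum_ennreal) auto
    also have "(\<Sum>Q\<in>cell j ` \<Omega>. 2 * r ^ j * (measure M Q + a * measure \<nu> Q))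
       = 2 * r ^ j * ((\<Sum>Q\<in>cell j ` \<Omega>. measure M Q) + a * (\<Sum>Q\<in>cell j ` \<Omega>. measure \<nu> Q))"
      by (simp only: sum.distrib flip: sum_distrib_left)
    also have "\<dots> = C * r ^ j"
      using measure_Union_cells[OF M.finite_measure_axioms refl order_refl, of j]
        measure_Union_cells[OF \<nu> order_refl, of j] by (simp add: Union_cells C_def)
    finally show ?thesis .
  qed
  have "(\<integral>\<^sup>+x. (\<Sum>j. ennreal \<bar>g x - E j x\<bar> * indicator \<Omega> x) \<partial>M)
     = (\<Sum>j. \<integral>\<^sup>+x. ennreal \<bar>g x - E j x\<bar> * indicator \<Omega> x \<partial>M)"
    by (intro nn_integral_suminf) auto
  also have "\<dots> \<le> (\<Sum>j. ennreal (C * r ^ j))"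
    by (intro suminf_le L1) auto
  also have "\<dots> = ennreal (\<Sum>j. C * r ^ j)"
    using r a0 by (intro suminf_ennreal2) (auto simp: C_def intro!: mult_nonneg_nonneg add_nonneg_nonneg)
  finally have "(\<integral>\<^sup>+x. (\<Sum>j. ennreal \<bar>g x - E j x\<bar> * indicator \<Omega> x) \<partial>M) \<noteq> \<infinity>"
    by (metis ennreal_less_top infinity_ennreal_def not_le)
  then have "AE x in M. (\<Sum>j. ennreal \<bar>g x - E j x\<bar> * indicator \<Omega> x) \<noteq> \<infinity>"
    by (rule nn_integral_noteq_infinite[rotated]) measurable
  then show ?thesis
  proof (eventually_elim, intro impI)
    fix x assume fin: "(\<Sum>j. ennreal \<bar>g x - E j x\<bar> * indicator \<Omega> x) \<noteq> \<infinity>" and x: "x \<in> \<Omega>"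
    then have "(\<Sum>j. ennreal \<bar>g x - E j x\<bar>) \<noteq> \<infinity>" by simp
    then have "summable (\<lambda>j. \<bar>g x - E j x\<bar>)"
      by (intro summable_suminf_not_top) (simp_all only: abs_ge_zero infinity_ennreal_def not_False_eq_True)
    then have "(\<lambda>j. \<bar>g x - E j x\<bar>) \<longlonglongrightarrow> 0" by (rule summable_LIMSEQ_zero)
    then have "(\<lambda>j. g x - E j x) \<longlonglongrightarrow> 0" by (simp add: tendsto_rabs_zero_iff)
    then have "(\<lambda>j. g x - (g x - E j x)) \<longlonglongrightarrow> g x - 0" by (intro tendsto_diff tendsto_const)
    then show "(\<lambda>j. avg g (cell j x)) \<longlonglongrightarrow> g x" using x by (simp add: E_eq)
  qed
qed

text \<open>The 2 is that of \<open>poincare\<close>, \<open>D\<close> compares the measures of a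
  cell and its parent, and \<open>A powr \<kappa>\<close> is left over from the peak of the series.
  The minimum picks the slower of the two rates, 1/\<open>ps\<close> before the peak and \<kappa>
  after it.\<close>

definition hedberg_const :: real where
  "hedberg_const = 2 * D * A powr \<kappa> * two_sided_const D (min \<kappa> (1 / ps))"

lemma hedberg_const_pos: "0 < hedberg_const"
proof -
  have "D powr - min \<kappa> (1 / ps) < 1" using D_gt_1 \<kappa> ps by (intro powr_less_one) auto
  then show ?thesis
    unfolding hedberg_const_def two_sided_const_def using D_gt_1 A by simp
qed

text \<open>In generation \<open>j\<close> the ratio \<nu>(Q)/W(Q) is at most \<open>t\<close>, and
  also at most \<open>A * b * D ^ j\<close>. The second bound makes the terms of the telescoping sum
  grow like \<open>D powr (j / ps)\<close>, the first makes them decay like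
  \<open>D powr (- \<kappa> * j)\<close>. The sum is therefore comparable to its value at the
  crossover, \<open>(A * b) powr \<kappa> * t powr (1 / ps)\<close>.\<close>

lemma hedberg:
  assumes g: "set_integrable M \<Omega> g" and P: "poincare g \<nu>" and x: "x \<in> \<Omega>"
    and lim: "(\<lambda>j. avg g (cell j x)) \<longlonglongrightarrow> g x"
    and \<nu>: "finite_measure \<nu>" "sets \<nu> = sets M"
    and t: "0 < t" "\<And>j. measure \<nu> (cell j x) \<le> t * measure W (cell j x)"
    and b: "0 < b" "measure \<nu> \<Omega> \<le> b * measure W \<Omega>"
  shows "\<bar>g x - avg g \<Omega>\<bar> \<le> hedberg_const * t powr (1 / ps) * b powr \<kappa>"
proof -
  define \<epsilon> where "\<epsilon> = min \<kappa> (1 / ps)"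
  have \<epsilon>: "0 < \<epsilon>" "\<epsilon> \<le> \<kappa>" "\<epsilon> \<le> 1 / ps" using \<kappa> ps by (auto simp: \<epsilon>_def)
  define \<tau> where "\<tau> = t / (A * b)"
  have Ab: "0 < A * b" using A b by simp
  have \<tau>: "0 < \<tau>" using t Ab by (simp add: \<tau>_def)
  \<comment> \<open>The real generation at which the two bounds cross, negative when
    \<open>t < A * b\<close>; hence a two-sided sum about an arbitrary real peak.\<close>
  define m where "m = log D \<tau>"
  have Dm: "\<tau> = D powr m" using \<tau> D_gt_1 by (simp add: m_def)
  define \<beta> where "\<beta> j = D powr (- \<kappa> * real j) * (min t (A * b * D ^ j)) powr (1 / p)" for j
  have mn: "0 < min t (A * b * D ^ j)" for j using t Ab D_gt_1 by simp
  have \<beta>pos: "0 < \<beta> j" for j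
    unfolding \<beta>_def using mn[of j, THEN less_imp_neq, symmetric] D_gt_1
    by (intro mult_pos_pos powr_gt_zero[THEN iffD2]) auto
  have osc: "(LINT y:cell j x|M. \<bar>g y - avg g (cell j x)\<bar>) \<le> 2 * \<beta> j * measure M (cell j x)" for j
  proof -
    have "measure \<nu> (cell j x) \<le> measure \<nu> \<Omega>"
      using \<nu> cell_subset[OF x] by (intro finite_measure.finite_measure_mono) auto
    also have "\<dots> \<le> b * (A * D ^ j * measure W (cell j x))"
      using b W_cell[OF x, of j] by (smt (verit) mult_left_mono)
    finally have "measure \<nu> (cell j x) \<le> min t (A * b * D ^ j) * measure W (cell j x)"
      using t(2)[of j] by (simp add: min_def mult_ac)
    then have "D powr (- \<kappa> * p * j) * measure \<nu> (cell j x)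
        \<le> D powr (- \<kappa> * p * j) * (min t (A * b * D ^ j) * measure W (cell j x))"
      by (intro mult_left_mono) auto
    also have "\<dots> = \<beta> j powr p * measure W (cell j x)"
      using mn[of j] p by (simp add: \<beta>_def powr_mult powr_powr mult_ac)
    finally show ?thesis using P x \<beta>pos unfolding poincare_def by blast
  qed
  have step: "\<bar>avg g (cell (Suc j) x) - avg g (cell j x)\<bar> \<le> 2 * D * \<beta> j" for j
  proof -
    have "\<bar>avg g (cell (Suc j) x) - avg g (cell j x)\<bar>
       \<le> (LINT y:cell (Suc j) x|M. \<bar>g y - avg g (cell j x)\<bar>) / measure M (cell (Suc j) x)"
      using x cell_sets cell_subset measure_cell_pos by (intro avg_diff_le g) auto
    also have "\<dots> \<le> (LINT y:cell j x|M. \<bar>g y - avg g (cell j x)\<bar>) / measure M (cell (Suc j) x)"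
      using x cell_sets[OF x] cell_subset[OF x] cell_Suc[OF x, of j]
      by (intro divide_right_mono set_integral_nonneg_mono_set set_integrable_subset_diff g) auto
    also have "\<dots> \<le> 2 * \<beta> j * measure M (cell j x) / measure M (cell (Suc j) x)"
      by (intro divide_right_mono osc) auto
    also have "measure M (cell j x) = D * measure M (cell (Suc j) x)"
      unfolding measure_cell[OF x] using D_gt_1 by simp
    also have "2 * \<beta> j * (D * measure M (cell (Suc j) x)) / measure M (cell (Suc j) x) = 2 * D * \<beta> j"
      using measure_cell_pos[OF x, of "Suc j"] by simp
    finally show ?thesis .
  qed
  have \<beta>_le: "\<beta> j \<le> (A * b) powr (1 / p) * D powr (m / ps) * D powr (- \<epsilon> * \<bar>real j - m\<bar>)" for j
  proof -
    have "t = A * b * \<tau>" using A b by (simp add: \<tau>_def)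
    then have "t = A * b * D powr m" unfolding Dm .
    then have "min t (A * b * D ^ j) = A * b * min (D powr m) (D powr j)"
      using Ab D_gt_1 by (simp add: min_mult_distrib_left powr_realpow)
    then have \<beta>1: "\<beta> j = (A * b) powr (1 / p) * (D powr (- \<kappa> * real j) * min (D powr m) (D powr j) powr (1 / p))"
      using Ab by (simp add: \<beta>_def powr_mult)
    have pk: "1 / p = \<kappa> + 1 / ps" using \<kappa>(2) by simp
    have "D powr (- \<kappa> * real j) * min (D powr m) (D powr j) powr (1 / p)
        \<le> D powr (m / ps + - \<epsilon> * \<bar>real j - m\<bar>)"
    proof (cases "m \<le> real j")
      case True
      have "- \<kappa> * real j + m * (1 / p) = m / ps + - \<kappa> * (real j - m)"
        unfolding pk by (simp add: algebra_simps)
      also have "\<dots> \<le> m / ps + - \<epsilon> * \<bar>real j - m\<bar>"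
        using True \<epsilon> by (simp add: mult_right_mono)
      finally show ?thesis using True D_gt_1 by (simp add: min_def powr_powr flip: powr_add)
    next
      case False
      have "- \<kappa> * real j + real j * (1 / p) = m / ps + - (1 / ps) * (m - real j)"
        unfolding pk by (simp add: algebra_simps)
      also have "\<dots> \<le> m / ps + - \<epsilon> * \<bar>real j - m\<bar>"
        using False \<epsilon> mult_right_mono[of \<epsilon> "1 / ps" "m - real j"] by simp
      finally show ?thesis using False D_gt_1 by (simp add: min_def powr_powr flip: powr_add)
    qed
    then show ?thesis
      unfolding \<beta>1 mult.assoc powr_add[symmetric] by (intro mult_left_mono) auto
  qed
  have const: "(A * b) powr (1 / p) * D powr (m / ps) = A powr \<kappa> * t powr (1 / ps) * b powr \<kappa>"
  proof -
    have "D powr (m / ps) = \<tau> powr (1 / ps)" using D_gt_1 by (simp add: Dm powr_powr)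
    also have "\<dots> = t powr (1 / ps) / (A * b) powr (1 / ps)"
      using t Ab by (simp add: \<tau>_def powr_divide)
    finally have "(A * b) powr (1 / p) * D powr (m / ps) = (A * b) powr \<kappa> * t powr (1 / ps)"
      using \<kappa>(2) Ab by (simp add: powr_diff)
    then show ?thesis using A b by (simp add: powr_mult mult_ac)
  qed
  have bd: "\<bar>avg g (cell N x) - avg g \<Omega>\<bar> \<le> hedberg_const * t powr (1 / ps) * b powr \<kappa>" for N
  proof -
    have "avg g (cell N x) - avg g (cell 0 x) = (\<Sum>j<N. avg g (cell (Suc j) x) - avg g (cell j x))"
      by (rule sum_lessThan_telescope[symmetric])
    then have "\<bar>avg g (cell N x) - avg g \<Omega>\<bar> \<le> (\<Sum>j<N. \<bar>avg g (cell (Suc j) x) - avg g (cell j x)\<bar>)"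
      using cell_0[OF x] by (metis sum_abs)
    also have "\<dots> \<le> (\<Sum>j<N. 2 * D * ((A * b) powr (1 / p) * D powr (m / ps)) * D powr (- \<epsilon> * \<bar>real j - m\<bar>))"
    proof (intro sum_mono)
      fix j
      have "2 * D * \<beta> j \<le> 2 * D * ((A * b) powr (1 / p) * D powr (m / ps) * D powr (- \<epsilon> * \<bar>real j - m\<bar>))"
        using D_gt_1 by (intro mult_left_mono \<beta>_le) auto
      then show "\<bar>avg g (cell (Suc j) x) - avg g (cell j x)\<bar>
        \<le> 2 * D * ((A * b) powr (1 / p) * D powr (m / ps)) * D powr (- \<epsilon> * \<bar>real j - m\<bar>)"
        using step[of j] by (simp add: mult_ac)
    qed
    also have "\<dots> = 2 * D * ((A * b) powr (1 / p) * D powr (m / ps)) * (\<Sum>j<N. D powr (- \<epsilon> * \<bar>real j - m\<bar>))"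
      by (simp add: sum_distrib_left)
    also have "\<dots> \<le> 2 * D * ((A * b) powr (1 / p) * D powr (m / ps)) * two_sided_const D \<epsilon>"
      using D_gt_1 \<epsilon> by (intro mult_left_mono sum_two_sided_geometric_le) auto
    also have "\<dots> = hedberg_const * t powr (1 / ps) * b powr \<kappa>"
      unfolding const hedberg_const_def \<epsilon>_def by simp
    finally show ?thesis .
  qed
  have "(\<lambda>N. \<bar>avg g (cell N x) - avg g \<Omega>\<bar>) \<longlonglongrightarrow> \<bar>g x - avg g \<Omega>\<bar>"
    by (intro tendsto_intros lim)
  then show ?thesis by (rule LIMSEQ_le_const2) (use bd in auto)
qed

text \<open>The threshold \<open>t\<close> is such that \<open>hedberg\<close> gives the deviation
  \<open>l / 2\<close> wherever all ratios \<nu>(Q)/W(Q) along the cells through the point are at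
  most \<open>t\<close>. So the level set lies, up to a null set, in the bad set of the maximal
  function. The bound \<open>b\<close> is kept apart from \<open>measure \<nu> \<Omega>\<close>:
  later \<open>b\<close> is common to all layers, while the energies are summed.\<close>

lemma weak_type:
  assumes g: "set_integrable M \<Omega> g" and gm [measurable]: "g \<in> borel_measurable M"
    and \<nu>: "finite_measure \<nu>" "sets \<nu> = sets M" and P: "poincare g \<nu>"
    and b: "0 < b" "measure \<nu> \<Omega> \<le> b * measure W \<Omega>" and l: "0 < l"
  shows "measure W {x \<in> \<Omega>. l \<le> \<bar>g x - avg g \<Omega>\<bar>}
    \<le> (2 * hedberg_const) powr ps * l powr - ps * b powr (\<kappa> * ps) * measure \<nu> \<Omega>"
proof -
  define H where "H = hedberg_const"
  have H: "0 < H" unfolding H_def by (rule hedberg_const_pos)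
  define t where "t = (l / (2 * H * b powr \<kappa>)) powr ps"
  have t: "0 < t" using l H b by (simp add: t_def)
  define B where "B = {x \<in> \<Omega>. \<exists>j. t * measure W (cell j x) < measure \<nu> (cell j x)}"
  have B: "B \<in> sets M" "t * measure W B \<le> measure \<nu> \<Omega>"
    unfolding B_def using maximal_weak_type[OF W.finite_measure_axioms sets_W \<nu>, of t] t by auto
  have "AE x in W. x \<in> \<Omega> \<longrightarrow> (\<lambda>j. avg g (cell j x)) \<longlonglongrightarrow> g x"
    using absolutely_continuous_AE[OF sets_W ac AE_avg_tendsto[OF g gm \<nu> P]] .
  then have "AE x in W. x \<in> {x \<in> \<Omega>. l \<le> \<bar>g x - avg g \<Omega>\<bar>} \<longrightarrow> x \<in> B"
  proof (eventually_elim, intro impI)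
    fix x assume lim: "x \<in> \<Omega> \<longrightarrow> (\<lambda>j. avg g (cell j x)) \<longlonglongrightarrow> g x"
      and "x \<in> {x \<in> \<Omega>. l \<le> \<bar>g x - avg g \<Omega>\<bar>}"
    then have x: "x \<in> \<Omega>" and gx: "l \<le> \<bar>g x - avg g \<Omega>\<bar>" by auto
    show "x \<in> B"
    proof (rule ccontr)
      assume "x \<notin> B"
      then have "measure \<nu> (cell j x) \<le> t * measure W (cell j x)" for j
        using x by (auto simp: B_def not_less)
      then have "\<bar>g x - avg g \<Omega>\<bar> \<le> H * t powr (1 / ps) * b powr \<kappa>"
        unfolding H_def using x lim t b by (intro hedberg[OF g P _ _ \<nu>]) auto
      also have "t powr (1 / ps) = l / (2 * H * b powr \<kappa>)"
        using l H b ps by (simp add: t_def powr_powr)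
      also have "H * (l / (2 * H * b powr \<kappa>)) * b powr \<kappa> = l / 2" using H b by simp
      finally show False using gx l by simp
    qed
  qed
  then have "measure W {x \<in> \<Omega>. l \<le> \<bar>g x - avg g \<Omega>\<bar>} \<le> measure W B"
    using B(1) by (intro W.finite_measure_mono_AE) auto
  also have "\<dots> \<le> measure \<nu> \<Omega> / t" using B(2) t by (simp add: field_simps)
  also have "1 / t = (2 * H) powr ps * l powr - ps * b powr (\<kappa> * ps)"
    using l H b by (simp add: t_def powr_divide powr_mult powr_powr powr_minus field_simps)
  then have "measure \<nu> \<Omega> / t = (2 * H) powr ps * l powr - ps * b powr (\<kappa> * ps) * measure \<nu> \<Omega>"
    by (metis mult.commute times_divide_eq_right mult.right_neutral)
  finally show ?thesis unfolding H_def .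
qed

end

section \<open>Truncation\<close>

lemma powr_superadd:
  fixes x y p :: real
  assumes "0 \<le> x" "0 \<le> y" "1 \<le> p"
  shows "x powr p + y powr p \<le> (x + y) powr p"
proof (cases "x + y = 0")
  case False
  then have s: "0 < x + y" using assms by simp
  have le: "(z / (x + y)) powr p \<le> z / (x + y)" if "0 \<le> z" "z \<le> x + y" for z
    using that s assms powr_le_one_le[of "z / (x + y)" p] by (cases "z = 0") auto
  have "(x / (x + y)) powr p + (y / (x + y)) powr p \<le> x / (x + y) + y / (x + y)"
    using assms by (intro add_mono le) auto
  also have "\<dots> = 1" using s by (simp flip: add_divide_distrib)
  finally have "(x powr p + y powr p) / (x + y) powr p \<le> 1"
    using assms s by (simp add: powr_divide add_divide_distrib)
  then show ?thesis using s by (simp add: divide_le_eq)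
next
  case True
  then have "x = 0" "y = 0" using assms by auto
  then show ?thesis by simp
qed

lemma sum_powr_le_powr_sum:
  fixes a :: "'i \<Rightarrow> real"
  assumes "1 \<le> p" "\<And>k. k \<in> S \<Longrightarrow> 0 \<le> a k"
  shows "(\<Sum>k\<in>S. a k powr p) \<le> (\<Sum>k\<in>S. a k) powr p"
  using assms(2)
proof (induction S rule: infinite_finite_induct)
  case (insert k S)
  have "a k powr p + (\<Sum>k\<in>S. a k) powr p \<le> (a k + (\<Sum>k\<in>S. a k)) powr p"
    using insert.prems assms(1) by (intro powr_superadd sum_nonneg) auto
  then show ?case using insert by force
qed auto

text \<open>The layer of \<open>s\<close> between the heights \<open>c\<close> and
  \<open>2 * c\<close>, shifted down to start at 0.\<close>

definition trunc :: "real \<Rightarrow> real \<Rightarrow> real" where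
  "trunc c s = min (max (s - c) 0) c"

lemma borel_measurable_trunc [measurable]: "trunc c \<in> borel_measurable borel"
  unfolding trunc_def by measurable

lemma trunc_mono: "r \<le> s \<Longrightarrow> trunc c r \<le> trunc c s"
  unfolding trunc_def by auto

text \<open>The truncations at the levels \<open>2 ^ k * c\<close> cut \<open>s\<close> into consecutive layers, because
  \<open>c + 2 * c + \<dots> + 2 ^ (N - 1) * c = (2 ^ N - 1) * c\<close>.\<close>

lemma sum_trunc:
  assumes "0 \<le> c"
  shows "(\<Sum>k<N. trunc (2 ^ k * c) s) = min (max (s - c) 0) ((2 ^ N - 1) * c)"
proof (induction N)
  case (Suc N)
  have "c \<le> 2 ^ N * c" using assms mult_right_mono[of 1 "2 ^ N" c] by simp
  moreover define y where "y = 2 ^ N * c"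
  ultimately have "c \<le> y" by simp
  have "(2 ^ N - 1) * c = y - c" "(2 ^ Suc N - 1) * c = 2 * y - c"
    by (simp_all add: y_def algebra_simps)
  then show ?case
    unfolding sum.lessThan_Suc Suc unfolding trunc_def y_def[symmetric] using \<open>c \<le> y\<close> assms
    by (simp only: min_def max_def split: if_splits) linarith
qed simp

text \<open>Truncations are monotone, so the differences over all layers have one sign and add up to
  at most |s - r|; for \<open>p \<ge> 1\<close> a sum of \<open>p\<close>-th powers is at most the
  \<open>p\<close>-th power of the sum. No constant is lost, whatever the number of layers.\<close>

lemma sum_trunc_diff_powr_le:
  assumes c: "0 \<le> c" and p: "1 \<le> p"
  shows "(\<Sum>k<N. \<bar>trunc (2 ^ k * c) s - trunc (2 ^ k * c) r\<bar> powr p) \<le> \<bar>s - r\<bar> powr p"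
proof -
  have *: "(\<Sum>k<N. \<bar>trunc (2 ^ k * c) s - trunc (2 ^ k * c) r\<bar>) \<le> s - r" if "r \<le> s" for r s
  proof -
    have "(\<Sum>k<N. \<bar>trunc (2 ^ k * c) s - trunc (2 ^ k * c) r\<bar>)
        = (\<Sum>k<N. trunc (2 ^ k * c) s) - (\<Sum>k<N. trunc (2 ^ k * c) r)"
      using trunc_mono[OF that] by (simp flip: sum_subtractf)
    also have "\<dots> \<le> s - r" unfolding sum_trunc[OF c] using that by linarith
    finally show ?thesis .
  qed
  have "(\<Sum>k<N. \<bar>trunc (2 ^ k * c) s - trunc (2 ^ k * c) r\<bar> powr p)
      \<le> (\<Sum>k<N. \<bar>trunc (2 ^ k * c) s - trunc (2 ^ k * c) r\<bar>) powr p"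
    by (intro sum_powr_le_powr_sum p) auto
  also have "\<dots> \<le> \<bar>s - r\<bar> powr p"
  proof (intro powr_mono2)
    show "(\<Sum>k<N. \<bar>trunc (2 ^ k * c) s - trunc (2 ^ k * c) r\<bar>) \<le> \<bar>s - r\<bar>"
      using *[of r s] *[of s r] by (cases "r \<le> s") (auto simp: abs_minus_commute)
    show "0 \<le> (\<Sum>k<N. \<bar>trunc (2 ^ k * c) s - trunc (2 ^ k * c) r\<bar>)" by (rule sum_nonneg) simp
  qed (use p in simp)
  finally show ?thesis .
qed

lemma dyadic_level:
  fixes u a :: real
  assumes "0 < a" "a < u"
  obtains k where "2 ^ k * a \<le> u" "u \<le> 2 ^ Suc k * a"
proof -
  obtain n where "u / a < 2 ^ n" using real_arch_pow[of 2 "u / a"] by auto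
  then have ex: "\<exists>n. u \<le> 2 ^ n * a" using assms by (auto simp: field_simps intro: less_imp_le)
  define n where "n = (LEAST n. u \<le> 2 ^ n * a)"
  have n: "u \<le> 2 ^ n * a" unfolding n_def using ex by (rule LeastI_ex)
  then have "n \<noteq> 0" using assms by (auto intro: Nat.gr0I)
  then obtain k where k: "n = Suc k" by (cases n) auto
  then have "\<not> u \<le> 2 ^ k * a" using not_less_Least[of k "\<lambda>n. u \<le> 2 ^ n * a"] by (simp add: n_def)
  then show ?thesis using n k by (intro that[of k]) auto
qed

section \<open>From weak to strong type by summing layers\<close>

context weighted_nested_partition
begin

text \<open>The first summand accounts for deviations up to \<open>8 * B\<close>. In the second, 16
  H is \<open>4 * c * (2 * H) / (c / 2)\<close>: a deviation between \<open>2 * c\<close> and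
  \<open>4 * c\<close> is charged to the weak estimate at level \<open>c / 2\<close>.\<close>

definition strong_const :: real where
  "strong_const = 8 powr ps + (16 * hedberg_const) powr ps"

text \<open>A truncation is dominated by the deviation of \<open>f\<close>, whose mean over \<Omega>
  is at most \<open>2 * B\<close> by \<open>poincare\<close> in generation 0 with \<beta> =
  \<open>B\<close>. Subtracting the average of a truncation of height \<open>c \<ge> 4 * B\<close>
  therefore costs at most half of that height.\<close>

lemma avg_trunc_le:
  assumes f: "set_integrable M \<Omega> f" and fm [measurable]: "f \<in> borel_measurable M"
    and P: "poincare f \<nu>" and B: "0 < B" "measure \<nu> \<Omega> \<le> B powr p * measure W \<Omega>" and c: "0 \<le> c"
  defines "g \<equiv> \<lambda>x. trunc c \<bar>f x - avg f \<Omega>\<bar>"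
  shows "set_integrable M \<Omega> g" "0 \<le> avg g \<Omega>" "avg g \<Omega> \<le> 2 * B"
proof -
  obtain x where x: "x \<in> \<Omega>" using \<Omega>_nonempty by auto
  have [simp]: "cell 0 x = \<Omega>" using cell_0[OF x] .
  have osc: "(LINT y:\<Omega>|M. \<bar>f y - avg f \<Omega>\<bar>) \<le> 2 * B * measure M \<Omega>"
    using P B x unfolding poincare_def
    by (elim ballE[of _ _ x] allE[of _ "0::nat"] allE[of _ B]) (auto split: if_splits)
  have ui: "set_integrable M \<Omega> (\<lambda>y. \<bar>f y - avg f \<Omega>\<bar>)"
    by (intro set_integrable_subset_diff f) auto
  have g: "0 \<le> g y" "g y \<le> \<bar>f y - avg f \<Omega>\<bar>" for y
    using c by (auto simp: g_def trunc_def)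
  show gi: "set_integrable M \<Omega> g"
    using ui by (rule set_integrable_bound) (use g in \<open>auto simp: set_borel_measurable_def g_def\<close>)
  have "0 \<le> (LINT y:\<Omega>|M. g y)"
    unfolding set_lebesgue_integral_def by (intro Bochner_Integration.integral_nonneg) (auto simp: g indicator_def)
  then show "0 \<le> avg g \<Omega>" by (simp add: avg_def)
  have "(LINT y:\<Omega>|M. g y) \<le> (LINT y:\<Omega>|M. \<bar>f y - avg f \<Omega>\<bar>)"
    by (intro set_integral_mono gi ui g)
  then show "avg g \<Omega> \<le> 2 * B" using osc measure_pos by (simp add: avg_def divide_le_eq)
qed

text \<open>The weak type estimate for each truncation, summed over the levels, is a strong type estimate.\<close>

theorem strong_type:
  assumes f: "set_integrable M \<Omega> f" and fm [measurable]: "f \<in> borel_measurable M"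
    and \<nu>: "finite_measure \<nu>" "sets \<nu> = sets M" and P: "poincare f \<nu>"
    and B: "0 < B" "measure \<nu> \<Omega> \<le> B powr p * measure W \<Omega>"
    and \<nu>k: "\<And>k. finite_measure (\<nu>k k)" "\<And>k. sets (\<nu>k k) = sets M"
    and Pk: "\<And>k. poincare (\<lambda>x. trunc (2 ^ k * (4 * B)) \<bar>f x - avg f \<Omega>\<bar>) (\<nu>k k)"
    and sum: "\<And>N. (\<Sum>k<N. measure (\<nu>k k) \<Omega>) \<le> measure \<nu> \<Omega>"
  shows "(\<integral>\<^sup>+x. ennreal (\<bar>f x - avg f \<Omega>\<bar> powr ps) * indicator \<Omega> x \<partial>W)
    \<le> ennreal (strong_const * B powr ps * measure W \<Omega>)"
proof -
  define u where "u x = \<bar>f x - avg f \<Omega>\<bar>" for x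
  have um [measurable]: "u \<in> borel_measurable M" unfolding u_def by measurable
  \<comment> \<open>The lowest level is \<open>4 * B\<close>, so that the average of each
    truncation, at most \<open>2 * B\<close>, leaves \<open>c k / 2\<close> of the height
    \<open>c k\<close> for \<open>weak_type\<close>.\<close>
  define c where "c k = 2 ^ k * (4 * B)" for k :: nat
  have c: "0 < c k" "4 * B \<le> c k" for k
    using B mult_right_mono[of 1 "2 ^ k" "4 * B"] by (auto simp: c_def)
  define S where "S k = {x \<in> \<Omega>. 2 * c k \<le> u x}" for k
  have Sm [measurable]: "S k \<in> sets M" for k unfolding S_def using \<Omega>_sets by measurable
  define b where "b = B powr p"
  have b: "0 < b" using B by (simp add: b_def)
  define H where "H = hedberg_const"
  have H: "0 < H" unfolding H_def by (rule hedberg_const_pos)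
  have lev: "(4 * c k) powr ps * measure W (S k) \<le> (16 * H) powr ps * b powr (\<kappa> * ps) * measure (\<nu>k k) \<Omega>" for k
  proof -
    define g where "g x = trunc (c k) (u x)" for x
    have gm [measurable]: "g \<in> borel_measurable M" unfolding g_def by measurable
    have g: "set_integrable M \<Omega> g" "0 \<le> avg g \<Omega>" "avg g \<Omega> \<le> 2 * B"
      using avg_trunc_le[OF f fm P B, of "c k"] c[of k] unfolding g_def u_def by auto
    have "measure (\<nu>k k) \<Omega> \<le> (\<Sum>i<Suc k. measure (\<nu>k i) \<Omega>)" by (simp add: sum_nonneg)
    also have "\<dots> \<le> b * measure W \<Omega>" using sum[of "Suc k"] B unfolding b_def by linarith
    finally have \<nu>b: "measure (\<nu>k k) \<Omega> \<le> b * measure W \<Omega>" .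
    have "S k \<subseteq> {x \<in> \<Omega>. c k / 2 \<le> \<bar>g x - avg g \<Omega>\<bar>}"
    proof
      fix x assume x: "x \<in> S k"
      then have "g x = c k" using c[of k] by (simp add: S_def g_def trunc_def)
      then show "x \<in> {x \<in> \<Omega>. c k / 2 \<le> \<bar>g x - avg g \<Omega>\<bar>}" using x g c[of k] by (simp add: S_def)
    qed
    then have "measure W (S k) \<le> measure W {x \<in> \<Omega>. c k / 2 \<le> \<bar>g x - avg g \<Omega>\<bar>}"
      using \<Omega>_sets by (intro W.finite_measure_mono) auto
    also have "\<dots> \<le> (2 * H) powr ps * (c k / 2) powr - ps * b powr (\<kappa> * ps) * measure (\<nu>k k) \<Omega>"
      unfolding H_def using Pk[of k] c[of k]
      by (intro weak_type g(1) gm \<nu>k b \<nu>b) (auto simp: g_def[abs_def] u_def c_def)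
    finally have "(4 * c k) powr ps * measure W (S k) \<le>
       (4 * c k) powr ps * ((2 * H) powr ps * (c k / 2) powr - ps * b powr (\<kappa> * ps) * measure (\<nu>k k) \<Omega>)"
      by (intro mult_left_mono) auto
    also have "\<dots> = ((4 * c k) powr ps * (2 * H) powr ps * (c k / 2) powr - ps) * b powr (\<kappa> * ps) * measure (\<nu>k k) \<Omega>"
      by simp
    also have "(4 * c k) powr ps * (2 * H) powr ps * (c k / 2) powr - ps = (4 * c k * (2 * H) / (c k / 2)) powr ps"
    proof -
      have "(4 * c k * (2 * H) / (c k / 2)) powr ps = (4 * c k * (2 * H)) powr ps / (c k / 2) powr ps"
        by (rule powr_divide)
      moreover have "(4 * c k * (2 * H)) powr ps = (4 * c k) powr ps * (2 * H) powr ps"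
        by (rule powr_mult)
      ultimately show ?thesis by (simp only: powr_minus divide_inverse)
    qed
    also have "4 * c k * (2 * H) / (c k / 2) = 16 * H" using c[of k] by simp
    finally show ?thesis .
  qed
  \<comment> \<open>A deviation above \<open>8 * B\<close> lies in some band from
    \<open>2 * c k\<close> to \<open>4 * c k\<close>. There the \<open>k\<close>-th truncation has
    reached its full height, and this single term of the series already dominates.\<close>
  have pt: "ennreal (u x powr ps) * indicator \<Omega> x
      \<le> ennreal ((8 * B) powr ps) * indicator \<Omega> x + (\<Sum>k. ennreal ((4 * c k) powr ps) * indicator (S k) x)" for x
  proof (cases "x \<in> \<Omega>")
    case True
    have u0: "0 \<le> u x" by (simp add: u_def)
    show ?thesis
    proof (cases "u x \<le> 8 * B")
      case True
      then have "ennreal (u x powr ps) \<le> ennreal ((8 * B) powr ps)"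
        using u0 ps by (intro ennreal_leI powr_mono2) auto
      then show ?thesis using \<open>x \<in> \<Omega>\<close> by (simp add: add_increasing2)
    next
      case False
      then obtain k where k: "2 ^ k * (8 * B) \<le> u x" "u x \<le> 2 ^ Suc k * (8 * B)"
        using dyadic_level[of "8 * B" "u x"] B by auto
      then have "x \<in> S k" using \<open>x \<in> \<Omega>\<close> by (simp add: S_def c_def)
      define F where "F k = ennreal ((4 * c k) powr ps) * indicator (S k) x" for k
      have "ennreal (u x powr ps) * indicator \<Omega> x \<le> ennreal ((4 * c k) powr ps) * 1"
        using k u0 ps \<open>x \<in> \<Omega>\<close> by (simp, intro powr_mono2) (auto simp: c_def)
      also have "\<dots> = F k" using \<open>x \<in> S k\<close> by (simp add: F_def)
      also have "\<dots> \<le> (\<Sum>k. F k)" using sum_le_suminf[of F "{k}"] by simp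
      finally show ?thesis unfolding F_def by (rule add_increasing[rotated]) simp
    qed
  qed simp
  have mW: "sets W = sets M" by simp
  have meas: "(\<lambda>x. ennreal ((4 * c k) powr ps) * indicator (S k) x) \<in> borel_measurable W" for k
    unfolding measurable_cong_sets[OF mW refl] by measurable
  have meas1: "(\<lambda>x. ennreal ((8 * B) powr ps) * indicator \<Omega> x) \<in> borel_measurable W"
    unfolding measurable_cong_sets[OF mW refl] by measurable
  have "(\<integral>\<^sup>+x. ennreal (u x powr ps) * indicator \<Omega> x \<partial>W)
    \<le> (\<integral>\<^sup>+x. ennreal ((8 * B) powr ps) * indicator \<Omega> x + (\<Sum>k. ennreal ((4 * c k) powr ps) * indicator (S k) x) \<partial>W)"
    by (intro nn_integral_mono pt)
  also have "\<dots> = (\<integral>\<^sup>+x. ennreal ((8 * B) powr ps) * indicator \<Omega> x \<partial>W)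
      + (\<integral>\<^sup>+x. (\<Sum>k. ennreal ((4 * c k) powr ps) * indicator (S k) x) \<partial>W)"
    by (rule nn_integral_add[OF meas1 borel_measurable_suminf_order[OF meas]])
  also have "(\<integral>\<^sup>+x. ennreal ((8 * B) powr ps) * indicator \<Omega> x \<partial>W) = ennreal ((8 * B) powr ps * measure W \<Omega>)"
    by (simp add: nn_integral_cmult_indicator W.emeasure_eq_measure ennreal_mult)
  also have "(\<integral>\<^sup>+x. (\<Sum>k. ennreal ((4 * c k) powr ps) * indicator (S k) x) \<partial>W)
      = (\<Sum>k. \<integral>\<^sup>+x. ennreal ((4 * c k) powr ps) * indicator (S k) x \<partial>W)"
    by (intro nn_integral_suminf meas)
  also have "\<dots> = (\<Sum>k. ennreal ((4 * c k) powr ps * measure W (S k)))"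
    by (simp add: nn_integral_cmult_indicator W.emeasure_eq_measure ennreal_mult)
  also have "\<dots> \<le> ennreal ((16 * H) powr ps * b powr (\<kappa> * ps) * measure \<nu> \<Omega>)"
  proof (intro suminf_le_const)
    fix N
    have "(\<Sum>k<N. ennreal ((4 * c k) powr ps * measure W (S k)))
       = ennreal (\<Sum>k<N. (4 * c k) powr ps * measure W (S k))"
      by (intro sum_ennreal) auto
    also have "\<dots> \<le> ennreal (\<Sum>k<N. (16 * H) powr ps * b powr (\<kappa> * ps) * measure (\<nu>k k) \<Omega>)"
      by (intro ennreal_leI sum_mono lev)
    also have "\<dots> \<le> ennreal ((16 * H) powr ps * b powr (\<kappa> * ps) * measure \<nu> \<Omega>)"
      using sum[of N] by (intro ennreal_leI) (simp add: mult_left_mono flip: sum_distrib_left)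
    finally show "(\<Sum>k<N. ennreal ((4 * c k) powr ps * measure W (S k)))
      \<le> ennreal ((16 * H) powr ps * b powr (\<kappa> * ps) * measure \<nu> \<Omega>)" .
  qed simp
  also have "\<dots> \<le> ennreal ((16 * H) powr ps * B powr ps * measure W \<Omega>)"
  proof (intro ennreal_leI)
    have "b powr (\<kappa> * ps) * measure \<nu> \<Omega> \<le> b powr (\<kappa> * ps) * (B powr p * measure W \<Omega>)"
      by (intro mult_left_mono B) auto
    also have "b powr (\<kappa> * ps) * (B powr p * measure W \<Omega>) = B powr (p * (\<kappa> * ps) + p) * measure W \<Omega>"
      using B by (simp add: b_def powr_powr powr_add)
    \<comment> \<open>The relation \<open>\<kappa> = 1 / p - 1 / ps\<close> multiplied by
      \<open>p * ps\<close>; it makes the powers of \<open>B\<close> combine to exactly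
      \<open>ps\<close>.\<close>
    also have "p * (\<kappa> * ps) + p = ps" using \<kappa>(2) p ps by (simp add: field_simps)
    finally show "(16 * H) powr ps * b powr (\<kappa> * ps) * measure \<nu> \<Omega> \<le> (16 * H) powr ps * B powr ps * measure W \<Omega>"
      by (simp add: mult_left_mono mult.assoc)
  qed
  also have "ennreal ((8 * B) powr ps * measure W \<Omega>) + ennreal ((16 * H) powr ps * B powr ps * measure W \<Omega>)
     = ennreal (strong_const * B powr ps * measure W \<Omega>)"
    using B by (simp add: strong_const_def H_def powr_mult algebra_simps flip: ennreal_plus)
  finally show ?thesis unfolding u_def by (simp add: add_left_mono)
qed

end

section \<open>Dyadic rectangles and the weight condition\<close>

text \<open>Half-open, so that the dyadic subcubes are disjoint; the difference to the closed cube
  is a null set.\<close>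

definition hbox :: "real ^ 'n \<Rightarrow> real \<Rightarrow> (real ^ 'n) set" where
  "hbox a l = {y. \<forall>i. a $ i \<le> y $ i \<and> y $ i < a $ i + l}"

text \<open>The dyadic subcube of generation \<open>j\<close> through \<open>x\<close>, written as
  an equivalence class: the points with the same integer coordinates after rescaling. Membership of
  one point in the cell of another is then an equality of floors.\<close>

definition hcell :: "real ^ 'n \<Rightarrow> real \<Rightarrow> nat \<Rightarrow> real ^ 'n \<Rightarrow> (real ^ 'n) set" where
  "hcell a l j x = {y. \<forall>i. \<lfloor>(y $ i - a $ i) * 2 ^ j / l\<rfloor> = \<lfloor>(x $ i - a $ i) * 2 ^ j / l\<rfloor>}"

lemma hbox_sets [measurable]: "hbox a l \<in> sets borel"
proof -
  have "hbox a l = (\<Inter>i. {y. y $ i \<ge> a $ i} \<inter> {y. y $ i < a $ i + l})"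
    by (auto simp: hbox_def)
  also have "\<dots> \<in> sets borel"
    by (intro sets.countable_INT'' sets.Int borel_closed borel_open
        closed_halfspace_component_ge_cart open_halfspace_component_lt_cart) auto
  finally show ?thesis .
qed

lemma hbox_subset_cbox: "hbox a l \<subseteq> cbox a (a + (\<chi> i. l))"
  by (auto simp: hbox_def mem_box_cart less_imp_le)

lemma emeasure_cbox_cube:
  fixes a :: "real ^ 'n"
  assumes "0 \<le> l"
  shows "emeasure lborel (cbox a (a + (\<chi> i. l))) = ennreal (l ^ CARD('n))"
    "emeasure lborel (box a (a + (\<chi> i. l))) = ennreal (l ^ CARD('n))"
proof -
  have b: "(\<chi> i. l) \<bullet> b = l" if b: "b \<in> (Basis :: (real ^ 'n) set)" for b
  proof -
    obtain i where "b = axis i 1" using b by (auto simp: Basis_vec_def)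
    then show ?thesis by (simp add: inner_axis)
  qed
  have "(\<Prod>b\<in>Basis. (\<chi> i. l) \<bullet> (b :: real ^ 'n)) = (\<Prod>b\<in>(Basis :: (real ^ 'n) set). l)"
    using b by (intro prod.cong) auto
  then have P: "(\<Prod>b\<in>Basis. (\<chi> i. l) \<bullet> (b :: real ^ 'n)) = l ^ CARD('n)" by simp
  show "emeasure lborel (cbox a (a + (\<chi> i. l))) = ennreal (l ^ CARD('n))"
    "emeasure lborel (box a (a + (\<chi> i. l))) = ennreal (l ^ CARD('n))"
    using b assms P by (simp_all add: emeasure_lborel_cbox emeasure_lborel_box inner_add_left)
qed

lemma emeasure_hbox:
  fixes a :: "real ^ 'n"
  assumes "0 \<le> l"
  shows "emeasure lborel (hbox a l) = ennreal (l ^ CARD('n))"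
proof (rule antisym)
  show "emeasure lborel (hbox a l) \<le> ennreal (l ^ CARD('n))"
    using emeasure_mono[OF hbox_subset_cbox[of a l], of lborel] emeasure_cbox_cube(1)[OF assms, of a] by simp
  have "box a (a + (\<chi> i. l)) \<subseteq> hbox a l" by (auto simp: hbox_def mem_box_cart less_imp_le)
  then show "ennreal (l ^ CARD('n)) \<le> emeasure lborel (hbox a l)"
    using emeasure_mono[of "box a (a + (\<chi> i. l))" "hbox a l" lborel] emeasure_cbox_cube(2)[OF assms, of a]
    by simp
qed

lemma convex_hbox: "convex (hbox a l)"
proof -
  have "hbox a l = (\<Inter>i. {y. a $ i \<le> y $ i} \<inter> {y. y $ i < a $ i + l})"
    by (auto simp: hbox_def)
  moreover have "convex ({y. a $ i \<le> y $ i} \<inter> {y. y $ i < a $ i + l})" for i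
  proof (intro convex_Int)
    show "convex {y. a $ i \<le> y $ i}"
      using convex_halfspace_ge[of "a $ i" "axis i 1"] by (simp add: cart_eq_inner_axis inner_commute)
    show "convex {y. y $ i < a $ i + l}"
      using convex_halfspace_lt[of "axis i 1" "a $ i + l"] by (simp add: cart_eq_inner_axis inner_commute)
  qed
  ultimately show ?thesis by (auto intro: convex_INT)
qed

lemma norm_diff_hbox_le:
  fixes a :: "real ^ 'n"
  assumes "x \<in> hbox a l" "y \<in> hbox a l"
  shows "norm (x - y) \<le> real CARD('n) * l"
proof -
  have "norm (x - y) \<le> (\<Sum>i\<in>UNIV. \<bar>(x - y) $ i\<bar>)" by (rule norm_le_l1_cart)
  also have "\<dots> \<le> (\<Sum>i\<in>(UNIV :: 'n set). l)"
  proof (intro sum_mono)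
    fix i
    show "\<bar>(x - y) $ i\<bar> \<le> l"
      using assms[unfolded hbox_def, simplified, rule_format, of i] by (simp add: abs_le_iff)
  qed
  finally show ?thesis by simp
qed

lemma hcell_eq_hbox:
  assumes l: "0 < l"
  shows "hcell a l j x = hbox (\<chi> i. a $ i + \<lfloor>(x $ i - a $ i) * 2 ^ j / l\<rfloor> * (l / 2 ^ j)) (l / 2 ^ j)"
proof -
  have "\<lfloor>(y - a) * 2 ^ j / l\<rfloor> = k \<longleftrightarrow> a + k * (l / 2 ^ j) \<le> y \<and> y < a + k * (l / 2 ^ j) + l / 2 ^ j"
    for y a :: real and k
    using l by (subst floor_eq_iff) (auto simp: field_simps)
  then show ?thesis unfolding hcell_def hbox_def by (simp add: algebra_simps)
qed

lemma hcell_0: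
  assumes "0 < l" "x \<in> hbox a l"
  shows "hcell a l 0 x = hbox a l"
proof -
  have fl: "\<lfloor>(y $ i - a $ i) / l\<rfloor> = 0 \<longleftrightarrow> a $ i \<le> y $ i \<and> y $ i < a $ i + l" for y i
    using assms by (subst floor_eq_iff) (auto simp: field_simps)
  have "\<lfloor>(x $ i - a $ i) / l\<rfloor> = 0" for i
    using assms(2) unfolding fl by (simp add: hbox_def)
  then have "hcell a l 0 x = {y. \<forall>i. \<lfloor>(y $ i - a $ i) / l\<rfloor> = 0}"
    by (simp add: hcell_def)
  also have "\<dots> = hbox a l" unfolding hbox_def fl ..
  finally show ?thesis .
qed

text \<open>The finer dyadic coordinate determines the coarser one, which is the nesting of the
  cells.\<close>

lemma floor_eq_of_floor_double_eq:
  fixes s t :: real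
  assumes "\<lfloor>2 * s\<rfloor> = \<lfloor>2 * t\<rfloor>"
  shows "\<lfloor>s\<rfloor> = \<lfloor>t\<rfloor>"
proof -
  have "z \<le> \<lfloor>r\<rfloor> \<longleftrightarrow> 2 * z \<le> \<lfloor>2 * r\<rfloor>" for z and r :: real
    by (simp add: le_floor_iff)
  then show ?thesis using assms by (metis order_antisym order_refl)
qed

lemma hcell_Suc: "hcell a l (Suc j) x \<subseteq> hcell a l j x"
proof -
  have "\<lfloor>s * 2 ^ j / l\<rfloor> = \<lfloor>t * 2 ^ j / l\<rfloor>" if "\<lfloor>s * 2 ^ Suc j / l\<rfloor> = \<lfloor>t * 2 ^ Suc j / l\<rfloor>" for s t :: real
  proof (rule floor_eq_of_floor_double_eq)
    have "r * 2 ^ Suc j / l = 2 * (r * 2 ^ j / l)" for r :: real by simp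
    then show "\<lfloor>2 * (s * 2 ^ j / l)\<rfloor> = \<lfloor>2 * (t * 2 ^ j / l)\<rfloor>" using that by metis
  qed
  then show ?thesis unfolding hcell_def by blast
qed

lemma finite_hcells:
  assumes l: "0 < l"
  shows "finite (hcell a l j ` hbox a l)"
proof -
  have "hcell a l j x \<in> (\<lambda>v. {y. \<forall>i. \<lfloor>(y $ i - a $ i) * 2 ^ j / l\<rfloor> = v i}) ` (\<Pi>\<^sub>E i\<in>UNIV. {0..2 ^ j})"
    if x: "x \<in> hbox a l" for x
  proof (rule image_eqI)
    show "hcell a l j x = {y. \<forall>i. \<lfloor>(y $ i - a $ i) * 2 ^ j / l\<rfloor> = \<lfloor>(x $ i - a $ i) * 2 ^ j / l\<rfloor>}"
      by (simp add: hcell_def)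
    have "0 \<le> \<lfloor>(x $ i - a $ i) * 2 ^ j / l\<rfloor>" "\<lfloor>(x $ i - a $ i) * 2 ^ j / l\<rfloor> \<le> 2 ^ j" for i
    proof -
      have xi: "0 \<le> x $ i - a $ i" "x $ i - a $ i \<le> l"
        using x[unfolded hbox_def, simplified, rule_format, of i] by auto
      then have "(x $ i - a $ i) * 2 ^ j / l \<le> real_of_int (2 ^ j)"
        using l mult_right_mono[OF xi(2), of "2 ^ j"] by (simp add: field_simps)
      then show "\<lfloor>(x $ i - a $ i) * 2 ^ j / l\<rfloor> \<le> 2 ^ j"
        by (metis floor_mono floor_of_int)
      show "0 \<le> \<lfloor>(x $ i - a $ i) * 2 ^ j / l\<rfloor>" using xi l by simp
    qed
    then show "(\<lambda>i. \<lfloor>(x $ i - a $ i) * 2 ^ j / l\<rfloor>) \<in> (\<Pi>\<^sub>E i\<in>UNIV. {0..2 ^ j})" by auto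
  qed
  then have "hcell a l j ` hbox a l
      \<subseteq> (\<lambda>v. {y. \<forall>i. \<lfloor>(y $ i - a $ i) * 2 ^ j / l\<rfloor> = v i}) ` (\<Pi>\<^sub>E i\<in>UNIV. {0..2 ^ j})"
    by blast
  then show ?thesis
    by (rule finite_subset) (intro finite_imageI finite_PiE, simp_all)
qed

section \<open>A rectangle with its dyadic cells as a weighted nested partition\<close>

lemma emeasure_lborel_Times:
  fixes S :: "'a::euclidean_space set" and T :: "'b::euclidean_space set"
  assumes "S \<in> sets borel" "T \<in> sets borel"
  shows "emeasure lborel (S \<times> T) = emeasure lborel S * emeasure lborel T"
proof -
  have "emeasure (lborel \<Otimes>\<^sub>M lborel) (S \<times> T) = emeasure lborel S * emeasure lborel T"
    using assms by (intro lborel.emeasure_pair_measure_Times) auto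
  then show ?thesis by (simp add: lborel_prod)
qed

lemma Times_borel: "S \<in> sets borel \<Longrightarrow> T \<in> sets borel \<Longrightarrow> S \<times> T \<in> sets borel"
  for S :: "'a::euclidean_space set" and T :: "'b::euclidean_space set"
  by (metis borel_prod pair_measureI)

text \<open>The weight condition is demanded for the dyadic cells alone and pointwise, as w(Q) \<le>
  A |Q| w(y) for almost every y in Q, so that it can be inserted under integrals. The last condition
  on \<delta> compares the decay \<open>2 powr (- \<delta> * j)\<close> along cells with
  \<open>D powr (- \<kappa> * j)\<close>.\<close>

locale A1_rectangle =
  fixes b1 :: "real ^ 'n1" and b2 :: "real ^ 'n2" and l1 l2 :: real
    and w :: "(real ^ 'n1) \<times> (real ^ 'n2) \<Rightarrow> real" and A p ps \<kappa> \<delta> :: real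
    and \<Omega> :: "((real ^ 'n1) \<times> (real ^ 'n2)) set"
    and cell :: "nat \<Rightarrow> (real ^ 'n1) \<times> (real ^ 'n2) \<Rightarrow> ((real ^ 'n1) \<times> (real ^ 'n2)) set"
  assumes \<Omega>_def: "\<Omega> = hbox b1 l1 \<times> hbox b2 l2"
    and cell_def: "cell = (\<lambda>j x. hcell b1 l1 j (fst x) \<times> hcell b2 l2 j (snd x))"
    and l: "0 < l1" "0 < l2"
    and w [measurable]: "w \<in> borel_measurable borel" and w_nonneg: "\<And>x. 0 \<le> w x"
    and w_finite: "(\<integral>\<^sup>+x. ennreal (w x) * indicator \<Omega> x \<partial>lborel) < \<infinity>"
    and w_pos: "0 < (\<integral>\<^sup>+x. ennreal (w x) * indicator \<Omega> x \<partial>lborel)"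
    and A: "1 \<le> A"
    and A1: "\<And>x j. x \<in> \<Omega> \<Longrightarrow> AE y in lborel. y \<in> cell j x \<longrightarrow>
      (\<integral>\<^sup>+z. ennreal (w z) * indicator (cell j x) z \<partial>lborel) \<le> ennreal A * emeasure lborel (cell j x) * ennreal (w y)"
    and p: "1 \<le> p" and ps: "0 < ps" and \<kappa>: "0 < \<kappa>" "\<kappa> = 1 / p - 1 / ps"
    and \<delta>: "0 < \<delta>" "\<delta> < 1" "\<kappa> * (real CARD('n1) + real CARD('n2)) \<le> \<delta>"
begin

definition M :: "((real ^ 'n1) \<times> (real ^ 'n2)) measure" where
  "M = density lborel (\<lambda>x. ennreal (indicator \<Omega> x))"

definition W :: "((real ^ 'n1) \<times> (real ^ 'n2)) measure" where
  "W = density lborel (\<lambda>x. ennreal (w x) * indicator \<Omega> x)"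

definition D :: real where "D = 2 ^ (CARD('n1) + CARD('n2))"

lemma sets_M [simp]: "sets M = sets borel" by (simp add: M_def)

lemma hcell_sets [measurable]: "hcell b1 l1 j x1 \<in> sets borel" "hcell b2 l2 j x2 \<in> sets borel"
  using l by (simp_all add: hcell_eq_hbox)

lemma cell_borel [measurable]: "cell j x \<in> sets borel"
  unfolding cell_def by (intro Times_borel hcell_sets)

lemma \<Omega>_borel [measurable]: "\<Omega> \<in> sets borel"
  unfolding \<Omega>_def by (intro Times_borel hbox_sets)

lemma emeasure_hcell:
  "emeasure lborel (hcell b1 l1 j x1) = ennreal ((l1 / 2 ^ j) ^ CARD('n1))"
  "emeasure lborel (hcell b2 l2 j x2) = ennreal ((l2 / 2 ^ j) ^ CARD('n2))"
  using l by (simp_all add: hcell_eq_hbox emeasure_hbox)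

lemma emeasure_cell:
  "emeasure lborel (cell j x) = ennreal (l1 ^ CARD('n1) * l2 ^ CARD('n2) / D ^ j)"
proof -
  have "emeasure lborel (cell j x) = ennreal ((l1 / 2 ^ j) ^ CARD('n1) * (l2 / 2 ^ j) ^ CARD('n2))"
    unfolding cell_def using l by (subst emeasure_lborel_Times) (auto simp: emeasure_hcell ennreal_mult)
  also have "(l1 / 2 ^ j) ^ CARD('n1) * (l2 / 2 ^ j) ^ CARD('n2) = l1 ^ CARD('n1) * l2 ^ CARD('n2) / D ^ j"
  proof -
    have "(2 ^ j) ^ CARD('n1) * (2 ^ j) ^ CARD('n2) = D ^ j"
      by (simp add: D_def power_add power_mult_distrib mult.commute flip: power_mult)
    then show ?thesis by (simp add: power_divide)
  qed
  finally show ?thesis .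
qed

lemma cell_zero: "x \<in> \<Omega> \<Longrightarrow> cell 0 x = \<Omega>"
  using l by (auto simp: cell_def \<Omega>_def hcell_0)

lemma cell_dec: "cell (Suc j) x \<subseteq> cell j x"
  unfolding cell_def by (intro Sigma_mono hcell_Suc)

lemma cell_sub: "x \<in> \<Omega> \<Longrightarrow> cell j x \<subseteq> \<Omega>"
proof (induction j)
  case (Suc j)
  then show ?case using cell_dec[of j x] by blast
qed (simp add: cell_zero)

lemma \<Omega>_nonempty': "\<Omega> \<noteq> {}"
  using w_pos by auto

lemma emeasure_\<Omega>: "emeasure lborel \<Omega> = ennreal (l1 ^ CARD('n1) * l2 ^ CARD('n2))"
proof -
  obtain x where "x \<in> \<Omega>" using \<Omega>_nonempty' by auto
  then show ?thesis using emeasure_cell[of 0 x] cell_zero by simp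
qed

lemma emeasure_M: "Q \<in> sets borel \<Longrightarrow> Q \<subseteq> \<Omega> \<Longrightarrow> emeasure M Q = emeasure lborel Q"
  unfolding M_def by (simp add: emeasure_density ennreal_indicator Int_absorb1 flip: indicator_inter_arith)

lemma emeasure_W: "Q \<in> sets borel \<Longrightarrow> Q \<subseteq> \<Omega> \<Longrightarrow> emeasure W Q = (\<integral>\<^sup>+x. ennreal (w x) * indicator Q x \<partial>lborel)"
  unfolding W_def by (subst emeasure_density) (auto intro!: nn_integral_cong simp: indicator_def)

lemma emeasure_M_cell: "x \<in> \<Omega> \<Longrightarrow> emeasure M (cell j x) = ennreal (l1 ^ CARD('n1) * l2 ^ CARD('n2) / D ^ j)"
  using cell_sub by (simp add: emeasure_M emeasure_cell)

lemma finite_measure_M: "finite_measure M"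
proof
  have "emeasure M (space M) = emeasure lborel \<Omega>"
    unfolding M_def by (simp add: emeasure_density ennreal_indicator)
  then show "emeasure M (space M) \<noteq> \<infinity>" by (simp add: emeasure_\<Omega>)
qed

lemma finite_measure_W: "finite_measure W"
proof
  have "emeasure W (space W) = (\<integral>\<^sup>+x. ennreal (w x) * indicator \<Omega> x \<partial>lborel)"
    unfolding W_def by (simp add: emeasure_density)
  then show "emeasure W (space W) \<noteq> \<infinity>" using w_finite by simp
qed

lemma nested: "nested_partition M \<Omega> cell D"
proof -
  interpret finite_measure M by (rule finite_measure_M)
  have D: "1 < D" unfolding D_def by (intro one_less_power) auto
  obtain x0 where x0: "x0 \<in> \<Omega>" using \<Omega>_nonempty' by auto
  have m: "measure M (cell j x) = l1 ^ CARD('n1) * l2 ^ CARD('n2) / D ^ j" if "x \<in> \<Omega>" for j x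
    using emeasure_M_cell[OF that, of j] l D by (simp add: measure_def)
  have m0: "measure M \<Omega> = l1 ^ CARD('n1) * l2 ^ CARD('n2)"
    using m[OF x0, of 0] cell_zero[OF x0] by simp
  show ?thesis
  proof (unfold_locales)
    show "0 < measure M \<Omega>" using l by (simp add: m0)
    show "x \<in> cell j x" for j x by (cases x) (simp add: cell_def hcell_def)
    show "cell j y = cell j x" if "y \<in> cell j x" for x y j
      using that by (auto simp: cell_def hcell_def)
    show "finite (cell j ` \<Omega>)" for j
    proof -
      have "cell j ` \<Omega> \<subseteq> (\<lambda>(S, T). S \<times> T) ` (hcell b1 l1 j ` hbox b1 l1 \<times> hcell b2 l2 j ` hbox b2 l2)"
        by (force simp: cell_def \<Omega>_def)
      then show ?thesis
        by (rule finite_subset) (intro finite_imageI finite_cartesian_product finite_hcells l)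
    qed
    show "measure M (cell j x) = measure M \<Omega> / D ^ j" if "x \<in> \<Omega>" for x j
      using m[OF that] m0 by simp
    show "cell j x \<in> sets M" for j x by simp
    show "cell 0 x = \<Omega>" if "x \<in> \<Omega>" for x by (rule cell_zero[OF that])
    show "cell (Suc j) x \<subseteq> cell j x" for j x by (rule cell_dec)
  qed (rule D)
qed

text \<open>The A1 condition on \<Omega> itself bounds w(\<Omega>) by A |\<Omega>| w(y) for almost
  every y; this is integrated over the y in the small cell.\<close>

lemma W_cell_lower:
  assumes x: "x \<in> \<Omega>"
  shows "measure W \<Omega> \<le> A * D ^ j * measure W (cell j x)"
proof -
  interpret W: finite_measure W by (rule finite_measure_W)
  have D: "0 < D" by (simp add: D_def)
  define m where "m = l1 ^ CARD('n1) * l2 ^ CARD('n2)"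
  have m: "0 < m" using l by (simp add: m_def)
  have "emeasure W \<Omega> * emeasure lborel (cell j x) = (\<integral>\<^sup>+y. emeasure W \<Omega> * indicator (cell j x) y \<partial>lborel)"
    by (simp add: nn_integral_cmult_indicator)
  also have "\<dots> \<le> (\<integral>\<^sup>+y. ennreal A * emeasure lborel \<Omega> * (ennreal (w y) * indicator (cell j x) y) \<partial>lborel)"
  proof (intro nn_integral_mono_AE)
    show "AE y in lborel. emeasure W \<Omega> * indicator (cell j x) y
        \<le> ennreal A * emeasure lborel \<Omega> * (ennreal (w y) * indicator (cell j x) y)"
      using A1[OF x, of 0] unfolding cell_zero[OF x]
      by eventually_elim (use cell_sub[OF x, of j] in \<open>auto simp: emeasure_W indicator_def\<close>)
  qed
  also have "\<dots> = ennreal A * emeasure lborel \<Omega> * emeasure W (cell j x)"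
    using cell_sub[OF x] by (simp add: emeasure_W nn_integral_cmult)
  finally have "ennreal (measure W \<Omega>) * ennreal (m / D ^ j) \<le> ennreal A * ennreal m * ennreal (measure W (cell j x))"
    by (simp only: W.emeasure_eq_measure emeasure_cell emeasure_\<Omega> m_def)
  moreover have "ennreal (measure W \<Omega> * (m / D ^ j)) = ennreal (measure W \<Omega>) * ennreal (m / D ^ j)"
    by (rule ennreal_mult) (use m D in auto)
  moreover have "ennreal (A * m * measure W (cell j x)) = ennreal A * ennreal m * ennreal (measure W (cell j x))"
    using A m by (simp add: ennreal_mult)
  ultimately have "ennreal (measure W \<Omega> * (m / D ^ j)) \<le> ennreal (A * m * measure W (cell j x))"
    by simp
  then have "measure W \<Omega> * (m / D ^ j) \<le> A * m * measure W (cell j x)"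
    using A m by (subst (asm) ennreal_le_iff) auto
  then show ?thesis using m D by (simp add: field_simps)
qed

lemma weighted: "weighted_nested_partition M \<Omega> cell D W A p ps \<kappa>"
proof -
  interpret N: nested_partition M \<Omega> cell D by (rule nested)
  interpret W: finite_measure W by (rule finite_measure_W)
  show ?thesis
  proof (unfold_locales)
    show "sets W = sets M" by (simp add: W_def)
    show "absolutely_continuous M W"
      unfolding absolutely_continuous_def
    proof
      fix Z assume "Z \<in> null_sets M"
      then have "Z \<in> sets borel" "AE x in lborel. x \<in> Z \<longrightarrow> x \<notin> \<Omega>"
        unfolding M_def by (auto simp: null_sets_density_iff indicator_def split: if_splits)
      then show "Z \<in> null_sets W"
        unfolding W_def by (subst null_sets_density_iff) (auto simp: indicator_def elim: eventually_mono)
    qed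
    show "0 < measure W \<Omega>"
      using w_pos emeasure_W[of \<Omega>] W.emeasure_eq_measure[of \<Omega>] by (auto simp: zero_less_measure_iff)
    show "measure W \<Omega> \<le> A * D ^ j * measure W (cell j x)" if "x \<in> \<Omega>" for x j
      by (rule W_cell_lower[OF that])
  qed (fact A p ps \<kappa>)+
qed

sublocale weighted_nested_partition M \<Omega> cell D W A p ps \<kappa>
  by (rule weighted)

text \<open>\<open>2 powr p * p * (1 - \<delta>)\<close> is the constant of
  \<open>fractional_poincare_product\<close>. The power of the dimension pays for bounding the
  diameter of a cube by dimension times side length, and \<open>A\<close> for passing from Lebesgue
  measure to the weight.\<close>

definition poincare_const :: real where
  "poincare_const = 2 powr p * p * (1 - \<delta>) * (real CARD('n1) + real CARD('n2)) powr (real CARD('n1) + real CARD('n2) + p) * A"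

text \<open>Side lengths and inner integrals are those of the whole rectangle, not of a cell. Thus
  \<open>F g\<close> times the weight is one fixed density, and a small cell shows only in the
  additional factor \<open>2 powr (- j * p * \<delta>)\<close>.\<close>

definition F :: "((real ^ 'n1) \<times> (real ^ 'n2) \<Rightarrow> real) \<Rightarrow> (real ^ 'n1) \<times> (real ^ 'n2) \<Rightarrow> ennreal" where
  "F g x = ennreal (l1 powr (p * \<delta>)) * gagliardo1 p \<delta> (hbox b1 l1) g x
    + ennreal (l2 powr (p * \<delta>)) * gagliardo2 p \<delta> (hbox b2 l2) g x"

text \<open>The constant is part of the measure, so that \<open>poincare g (\<nu> g)\<close> holds
  in its normalised form.\<close>

definition \<nu> :: "((real ^ 'n1) \<times> (real ^ 'n2) \<Rightarrow> real) \<Rightarrow> ((real ^ 'n1) \<times> (real ^ 'n2)) measure" where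
  "\<nu> g = density lborel (\<lambda>x. ennreal poincare_const * (F g x * ennreal (w x)) * indicator \<Omega> x)"

lemma sets_\<nu> [simp]: "sets (\<nu> g) = sets M" by (simp add: \<nu>_def)

lemma F_measurable [measurable]:
  assumes [measurable]: "g \<in> borel_measurable borel"
  shows "F g \<in> borel_measurable borel"
  unfolding F_def by measurable

lemma emeasure_\<nu>:
  assumes [measurable]: "g \<in> borel_measurable borel" and Q: "Q \<in> sets borel" "Q \<subseteq> \<Omega>"
  shows "emeasure (\<nu> g) Q = ennreal poincare_const * (\<integral>\<^sup>+x. F g x * ennreal (w x) * indicator Q x \<partial>lborel)"
proof -
  have "emeasure (\<nu> g) Q = (\<integral>\<^sup>+x. ennreal poincare_const * (F g x * ennreal (w x) * indicator Q x) \<partial>lborel)"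
    unfolding \<nu>_def using Q by (subst emeasure_density) (auto intro!: nn_integral_cong simp: indicator_def)
  then show ?thesis using Q by (simp add: nn_integral_cmult)
qed

lemma set_integral_M:
  assumes "h \<in> borel_measurable borel" "Q \<in> sets borel" "Q \<subseteq> \<Omega>"
  shows "(LINT x:Q|M. (h x :: real)) = (LINT x:Q|lborel. h x)"
    "set_integrable M Q h \<longleftrightarrow> set_integrable lborel Q h"
proof -
  have [measurable]: "h \<in> borel_measurable borel" "Q \<in> sets borel" by fact+
  have *: "indicat_real \<Omega> x * indicat_real Q x = indicat_real Q x" for x
    using assms(3) by (auto simp: indicator_def)
  show "(LINT x:Q|M. h x) = (LINT x:Q|lborel. h x)"
    unfolding set_lebesgue_integral_def M_def by (subst integral_density) (simp_all add: * del: real_scaleR_def)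
  show "set_integrable M Q h \<longleftrightarrow> set_integrable lborel Q h"
    unfolding set_integrable_def M_def by (subst integrable_density) (simp_all add: * del: real_scaleR_def)
qed

end

text \<open>For \<open>t > \<beta>\<close> write \<open>t = t powr (1 - p) * t powr p\<close> and
  use that the first exponent is not positive. It takes the place of Hoelder's inequality and has
  the free parameter \<beta> that \<open>poincare\<close> asks for.\<close>

lemma young_linear:
  fixes t \<beta> p :: real
  assumes "0 \<le> t" "0 < \<beta>" "1 \<le> p"
  shows "t \<le> \<beta> + \<beta> powr (1 - p) * t powr p"
proof (cases "t \<le> \<beta>")
  case True
  then show ?thesis by (simp add: add_increasing2)
next
  case False
  then have "t powr (1 - p) \<le> \<beta> powr (1 - p)"
    using assms by (intro powr_mono2') auto
  then have "t powr (1 - p) * t powr p \<le> \<beta> powr (1 - p) * t powr p"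
    by (intro mult_right_mono) auto
  moreover have "t powr (1 - p) * t powr p = t"
    using False assms by (simp flip: powr_add)
  ultimately show ?thesis using assms by linarith
qed

lemma gagliardo1_mono: "J \<subseteq> J' \<Longrightarrow> gagliardo1 p \<delta> J g x \<le> gagliardo1 p \<delta> J' g x"
  unfolding gagliardo1_def by (intro nn_integral_mono mult_left_mono) (auto simp: indicator_def)

lemma gagliardo2_mono: "J \<subseteq> J' \<Longrightarrow> gagliardo2 p \<delta> J g x \<le> gagliardo2 p \<delta> J' g x"
  unfolding gagliardo2_def by (intro nn_integral_mono mult_left_mono) (auto simp: indicator_def)

section \<open>The Poincare inequality on dyadic cells and the energy of truncations\<close>

context A1_rectangle
begin

lemma set_integral_eq_nn_integral:
  assumes [measurable]: "h \<in> borel_measurable borel" "Q \<in> sets borel" and "Q \<subseteq> \<Omega>"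
    and "set_integrable M Q h" "\<And>x. 0 \<le> h x"
  shows "ennreal (LINT x:Q|M. h x) = (\<integral>\<^sup>+x. ennreal (h x) * indicator Q x \<partial>lborel)"
proof -
  have "integrable lborel (\<lambda>x. indicat_real Q x * h x)"
    using assms set_integral_M(2)[of h Q] by (simp add: set_integrable_def)
  then have "ennreal (LINT x|lborel. indicat_real Q x * h x) = (\<integral>\<^sup>+x. ennreal (indicat_real Q x * h x) \<partial>lborel)"
    using assms(5) by (intro nn_integral_eq_integral[symmetric]) auto
  also have "\<dots> = (\<integral>\<^sup>+x. ennreal (h x) * indicator Q x \<partial>lborel)"
    by (intro nn_integral_cong) (auto simp: indicator_def)
  finally show ?thesis
    using assms set_integral_M(1)[of h Q] by (simp add: set_lebesgue_integral_def)
qed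

text \<open>The mean deviation from the average is at most the double mean of
  \<open>\<bar>g x - g y\<bar>\<close>, to which \<open>young_linear\<close> is applied. The
  constant term and the \<open>p\<close>-th power term each contribute \<beta> times the measure of
  \<open>Q\<close>; this is the 2 in \<open>poincare\<close>.\<close>

lemma oscillation_le:
  assumes gm [measurable]: "g \<in> borel_measurable borel" and g: "set_integrable M \<Omega> g"
    and Q [measurable]: "Q \<in> sets borel" and Q': "Q \<subseteq> \<Omega>" "0 < measure M Q" and \<beta>: "0 < \<beta>"
    and I: "(\<integral>\<^sup>+x. \<integral>\<^sup>+y. ennreal (\<bar>g x - g y\<bar> powr p) * indicator (Q \<times> Q) (x, y) \<partial>lborel \<partial>lborel)
      \<le> ennreal ((measure M Q)\<^sup>2 * \<beta> powr p)" (is "?I \<le> _")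
  shows "(LINT y:Q|M. \<bar>g y - avg g Q\<bar>) \<le> 2 * \<beta> * measure M Q"
proof -
  define q where "q = measure M Q"
  have q: "0 < q" using Q' by (simp add: q_def)
  have qe: "emeasure lborel Q = ennreal q"
    using emeasure_M[OF Q Q'(1)] by (simp add: q_def M.emeasure_eq_measure)
  have si: "set_integrable M Q (\<lambda>y. \<bar>g y - c\<bar>)" for c
    using Q' by (intro set_integrable_subset_diff g) auto
  have "ennreal (LINT y:Q|M. \<bar>g y - avg g Q\<bar>) = (\<integral>\<^sup>+x. ennreal \<bar>g x - avg g Q\<bar> * indicator Q x \<partial>lborel)"
    using Q' si by (intro set_integral_eq_nn_integral) auto
  also have "\<dots> \<le> (\<integral>\<^sup>+x. ennreal (1 / q) * (\<integral>\<^sup>+y. ennreal \<bar>g y - g x\<bar> * indicator (Q \<times> Q) (x, y) \<partial>lborel) \<partial>lborel)"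
  proof (intro nn_integral_mono)
    fix x
    show "ennreal \<bar>g x - avg g Q\<bar> * indicator Q x
      \<le> ennreal (1 / q) * (\<integral>\<^sup>+y. ennreal \<bar>g y - g x\<bar> * indicator (Q \<times> Q) (x, y) \<partial>lborel)"
    proof (cases "x \<in> Q")
      case True
      have "\<bar>g x - avg g Q\<bar> \<le> (LINT y:Q|M. \<bar>g y - g x\<bar>) / q"
        using avg_diff_le[OF g _ Q', of "g x"] by (simp add: q_def abs_minus_commute)
      then have "ennreal \<bar>g x - avg g Q\<bar> \<le> ennreal (1 / q) * ennreal (LINT y:Q|M. \<bar>g y - g x\<bar>)"
        using q by (simp add: ennreal_leI flip: ennreal_mult')
      also have "ennreal (LINT y:Q|M. \<bar>g y - g x\<bar>) = (\<integral>\<^sup>+y. ennreal \<bar>g y - g x\<bar> * indicator Q y \<partial>lborel)"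
        using Q' si by (intro set_integral_eq_nn_integral) auto
      also have "\<dots> = (\<integral>\<^sup>+y. ennreal \<bar>g y - g x\<bar> * indicator (Q \<times> Q) (x, y) \<partial>lborel)"
        using True by (intro nn_integral_cong) (auto simp: indicator_def)
      finally show ?thesis using True by simp
    qed simp
  qed
  also have "\<dots> \<le> (\<integral>\<^sup>+x. ennreal (1 / q) * (\<integral>\<^sup>+y. ennreal \<beta> * indicator (Q \<times> Q) (x, y)
      + ennreal (\<beta> powr (1 - p)) * (ennreal (\<bar>g x - g y\<bar> powr p) * indicator (Q \<times> Q) (x, y)) \<partial>lborel) \<partial>lborel)"
  proof (intro nn_integral_mono mult_left_mono)
    fix x y
    have "\<bar>g y - g x\<bar> \<le> \<beta> + \<beta> powr (1 - p) * \<bar>g x - g y\<bar> powr p"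
      using young_linear[of "\<bar>g y - g x\<bar>" \<beta> p] \<beta> p by (simp add: abs_minus_commute)
    then have "ennreal \<bar>g y - g x\<bar> \<le> ennreal \<beta> + ennreal (\<beta> powr (1 - p)) * ennreal (\<bar>g x - g y\<bar> powr p)"
      using \<beta> by (simp add: ennreal_leI flip: ennreal_plus ennreal_mult)
    then show "ennreal \<bar>g y - g x\<bar> * indicator (Q \<times> Q) (x, y) \<le> ennreal \<beta> * indicator (Q \<times> Q) (x, y)
      + ennreal (\<beta> powr (1 - p)) * (ennreal (\<bar>g x - g y\<bar> powr p) * indicator (Q \<times> Q) (x, y))"
      by (cases "(x, y) \<in> Q \<times> Q") auto
  qed simp
  also have "\<dots> = ennreal (1 / q) * ((\<integral>\<^sup>+x. \<integral>\<^sup>+y. ennreal \<beta> * indicator (Q \<times> Q) (x, y) \<partial>lborel \<partial>lborel)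
      + ennreal (\<beta> powr (1 - p)) * ?I)"
    by (simp add: nn_integral_cmult nn_integral_add)
  also have "(\<integral>\<^sup>+x. \<integral>\<^sup>+y. ennreal \<beta> * indicator (Q \<times> Q) (x, y) \<partial>lborel \<partial>lborel)
      = (\<integral>\<^sup>+x. \<integral>\<^sup>+y. ennreal \<beta> * indicator Q x * indicator Q y \<partial>lborel \<partial>lborel)"
    by (intro nn_integral_cong) (auto simp: indicator_def)
  also have "\<dots> = ennreal (\<beta> * q\<^sup>2)"
    using \<beta> q by (simp add: nn_integral_cmult_indicator nn_integral_cmult nn_integral_multc qe power2_eq_square mult.assoc
        flip: ennreal_mult)
  also have "ennreal (1 / q) * (ennreal (\<beta> * q\<^sup>2) + ennreal (\<beta> powr (1 - p)) * ?I)
      \<le> ennreal (1 / q) * (ennreal (\<beta> * q\<^sup>2) + ennreal (\<beta> powr (1 - p)) * ennreal (q\<^sup>2 * \<beta> powr p))"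
    using I unfolding q_def by (intro mult_left_mono add_left_mono) auto
  also have "\<dots> = ennreal (1 / q * (\<beta> * q\<^sup>2 + \<beta> powr (1 - p) * (q\<^sup>2 * \<beta> powr p)))"
    using \<beta> q by (simp flip: ennreal_plus ennreal_mult)
  also have "\<beta> powr (1 - p) * (q\<^sup>2 * \<beta> powr p) = \<beta> * q\<^sup>2"
    using \<beta> powr_add[of \<beta> "1 - p" p] by simp
  also have "1 / q * (\<beta> * q\<^sup>2 + \<beta> * q\<^sup>2) = 2 * \<beta> * q"
    using q by (simp add: power2_eq_square)
  finally show ?thesis using \<beta> q by (simp add: ennreal_le_iff q_def)
qed

text \<open>The factor w(Q) stands on the left, so that the A1 condition can be applied inside the
  integral of the energy density and no quotient of extended reals occurs. The decay in
  \<open>j\<close> comes from the sides of the cell, which are \<open>2 ^ j\<close> times shorter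
  than those in \<open>F\<close>.\<close>

lemma double_integral_cell_le:
  fixes j :: nat
  assumes gm [measurable]: "g \<in> borel_measurable borel" and x: "x \<in> \<Omega>"
  defines "Q \<equiv> cell j x"
  shows "(\<integral>\<^sup>+x. \<integral>\<^sup>+y. ennreal (\<bar>g x - g y\<bar> powr p) * indicator (Q \<times> Q) (x, y) \<partial>lborel \<partial>lborel) * emeasure W Q
    \<le> ennreal ((measure M Q)\<^sup>2 * D powr (- \<kappa> * p * j)) * emeasure (\<nu> g) Q" (is "?I * _ \<le> _")
proof -
  define N where "N = 1 / (2::real) ^ j"
  have N: "0 < N" by (simp add: N_def)
  let ?n1 = "real CARD('n1)" and ?n2 = "real CARD('n2)"
  define n where "n = ?n1 + ?n2"
  have n1: "1 \<le> ?n1" "1 \<le> ?n2" by (simp_all add: Suc_leI)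
  define cn where "cn = n powr (n + p)"
  define q where "q = (l1 * N) ^ CARD('n1) * (l2 * N) ^ CARD('n2)"
  have q: "0 < q" using l N by (simp add: q_def)
  have Qb: "Q \<in> sets borel" "Q \<subseteq> \<Omega>" using cell_sub[OF x] by (auto simp: Q_def)
  define Q1 where "Q1 = hcell b1 l1 j (fst x)"
  define Q2 where "Q2 = hcell b2 l2 j (snd x)"
  have Q12: "Q = Q1 \<times> Q2" by (simp add: Q_def cell_def Q1_def Q2_def)
  have Qm [measurable]: "Q1 \<in> sets borel" "Q2 \<in> sets borel" by (simp_all add: Q1_def Q2_def)
  have em: "emeasure lborel Q1 = ennreal ((l1 * N) ^ CARD('n1))" "emeasure lborel Q2 = ennreal ((l2 * N) ^ CARD('n2))"
    by (simp_all add: Q1_def Q2_def emeasure_hcell N_def)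
  have emQ: "emeasure lborel Q = ennreal q"
    using l N unfolding Q12 q_def by (simp add: emeasure_lborel_Times em ennreal_mult)
  have qM: "measure M Q = q"
    using emeasure_M[OF Qb] emQ q by (simp add: measure_def)
  have sub: "Q1 \<subseteq> hbox b1 l1" "Q2 \<subseteq> hbox b2 l2"
  proof -
    have "x \<in> Q" using cell_refl[OF x] by (simp add: Q_def)
    then have "Q1 \<times> Q2 \<subseteq> hbox b1 l1 \<times> hbox b2 l2" "Q1 \<noteq> {}" "Q2 \<noteq> {}"
      using Qb(2) unfolding Q12 \<Omega>_def by auto
    then show "Q1 \<subseteq> hbox b1 l1" "Q2 \<subseteq> hbox b2 l2" by (auto simp: times_subset_iff)
  qed
  define D1 where "D1 = ?n1 * (l1 * N)"
  define D2 where "D2 = ?n2 * (l2 * N)"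
  have cvx: "convex Q1" "convex Q2"
    using l by (simp_all add: Q1_def Q2_def hcell_eq_hbox convex_hbox)
  have dia: "norm (x - y) \<le> D1" if "x \<in> Q1" "y \<in> Q1" for x y
    using norm_diff_hbox_le[OF that[unfolded Q1_def hcell_eq_hbox[OF l(1)]]] by (simp add: D1_def N_def)
  have dia2: "norm (x - y) \<le> D2" if "x \<in> Q2" "y \<in> Q2" for x y
    using norm_diff_hbox_le[OF that[unfolded Q2_def hcell_eq_hbox[OF l(2)]]] by (simp add: D2_def N_def)
  have Dpos: "0 < D1" "0 < D2" using l N n1 by (simp_all add: D1_def D2_def)
  define F1 where "F1 = (\<integral>\<^sup>+x. gagliardo1 p \<delta> (hbox b1 l1) g x * indicator Q x \<partial>lborel)"
  define F2 where "F2 = (\<integral>\<^sup>+x. gagliardo2 p \<delta> (hbox b2 l2) g x * indicator Q x \<partial>lborel)"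
  have FF: "(\<integral>\<^sup>+x. F g x * indicator Q x \<partial>lborel) = ennreal (l1 powr (p * \<delta>)) * F1 + ennreal (l2 powr (p * \<delta>)) * F2"
    unfolding F_def F1_def F2_def using Qb by (simp add: distrib_right mult.assoc nn_integral_add nn_integral_cmult)
  \<comment> \<open>The power of the diameter bound splits into a power of the dimension, the
    measure of the cubic factor, the full side to the power \<open>p * \<delta>\<close> and the
    decay \<open>N powr (p * \<delta>)\<close>. Because \<open>p * \<delta> \<le> p\<close>,
    \<open>cn\<close> bounds the first of these uniformly in \<delta>. The sides are generic so that
    both variables are served.\<close>
  have real_bound: "b ^ m2 * (real m1 * a) powr (real m1 + p * \<delta>)
      \<le> cn * (a ^ m1 * b ^ m2) * N powr (p * \<delta>) * l' powr (p * \<delta>)"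
    if a: "0 < a" "a = l' * N" "0 < l'" and b: "0 < b" and m: "1 \<le> real m1" "real m1 \<le> n" for a b l' m1 m2
  proof -
    have pd: "0 \<le> p * \<delta>" "p * \<delta> \<le> p" using p \<delta> by (auto simp: mult_le_cancel_left1)
    have "real m1 powr (real m1 + p * \<delta>) \<le> n powr (real m1 + p * \<delta>)"
      using m pd by (intro powr_mono2) auto
    also have "\<dots> \<le> cn" unfolding cn_def using m pd by (intro powr_mono) auto
    finally have c: "real m1 powr (real m1 + p * \<delta>) \<le> cn" .
    have "b ^ m2 * (real m1 * a) powr (real m1 + p * \<delta>)
        = real m1 powr (real m1 + p * \<delta>) * (a ^ m1 * b ^ m2 * (N powr (p * \<delta>) * l' powr (p * \<delta>)))"
      using a b N by (simp add: powr_mult powr_add powr_realpow power_mult_distrib)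
    also have "\<dots> \<le> cn * (a ^ m1 * b ^ m2 * (N powr (p * \<delta>) * l' powr (p * \<delta>)))"
      using a b by (intro mult_right_mono c) auto
    finally show ?thesis by (simp add: mult.assoc)
  qed
  have b1: "emeasure lborel Q2 * (ennreal (D1 powr (?n1 + p * \<delta>)) * (\<integral>\<^sup>+x. gagliardo1 p \<delta> Q1 g x * indicator Q x \<partial>lborel))
     \<le> ennreal (cn * q * N powr (p * \<delta>)) * (ennreal (l1 powr (p * \<delta>)) * F1)"
  proof -
    have "(\<integral>\<^sup>+x. gagliardo1 p \<delta> Q1 g x * indicator Q x \<partial>lborel) \<le> F1"
      unfolding F1_def using sub by (intro nn_integral_mono mult_right_mono gagliardo1_mono) auto
    then have "emeasure lborel Q2 * (ennreal (D1 powr (?n1 + p * \<delta>)) * (\<integral>\<^sup>+x. gagliardo1 p \<delta> Q1 g x * indicator Q x \<partial>lborel))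
      \<le> ennreal ((l2 * N) ^ CARD('n2) * D1 powr (?n1 + p * \<delta>)) * F1"
      using l N by (simp add: em ennreal_mult mult.assoc mult_left_mono)
    also have "\<dots> \<le> ennreal (cn * q * N powr (p * \<delta>) * l1 powr (p * \<delta>)) * F1"
      using real_bound[of "l1 * N" l1 "l2 * N" "CARD('n1)" "CARD('n2)"] l N n1
      by (intro mult_right_mono ennreal_leI) (auto simp: D1_def q_def n_def)
    finally show ?thesis using q by (simp add: ennreal_mult cn_def mult.assoc)
  qed
  have b2: "emeasure lborel Q1 * (ennreal (D2 powr (?n2 + p * \<delta>)) * (\<integral>\<^sup>+x. gagliardo2 p \<delta> Q2 g x * indicator Q x \<partial>lborel))
     \<le> ennreal (cn * q * N powr (p * \<delta>)) * (ennreal (l2 powr (p * \<delta>)) * F2)"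
  proof -
    have "(\<integral>\<^sup>+x. gagliardo2 p \<delta> Q2 g x * indicator Q x \<partial>lborel) \<le> F2"
      unfolding F2_def using sub by (intro nn_integral_mono mult_right_mono gagliardo2_mono) auto
    then have "emeasure lborel Q1 * (ennreal (D2 powr (?n2 + p * \<delta>)) * (\<integral>\<^sup>+x. gagliardo2 p \<delta> Q2 g x * indicator Q x \<partial>lborel))
      \<le> ennreal ((l1 * N) ^ CARD('n1) * D2 powr (?n2 + p * \<delta>)) * F2"
      using l N by (simp add: em ennreal_mult mult.assoc mult_left_mono)
    also have "\<dots> \<le> ennreal (cn * q * N powr (p * \<delta>) * l2 powr (p * \<delta>)) * F2"
      using real_bound[of "l2 * N" l2 "l1 * N" "CARD('n2)" "CARD('n1)"] l N n1
      by (intro mult_right_mono ennreal_leI) (auto simp: D2_def q_def n_def mult.commute)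
    finally show ?thesis using q by (simp add: ennreal_mult cn_def mult.assoc)
  qed
  define K0 where "K0 = 2 powr (p - 1) * (2 * p * (1 - \<delta>))"
  have K0: "0 \<le> K0" using p \<delta> by (simp add: K0_def)
  have cn0: "0 \<le> cn" by (simp add: cn_def)
  have K: "poincare_const = K0 * cn * A"
    by (simp add: poincare_const_def K0_def cn_def n_def powr_diff)
  have "?I \<le> ennreal K0 * (emeasure lborel Q2 * (ennreal (D1 powr (?n1 + p * \<delta>)) * (\<integral>\<^sup>+x. gagliardo1 p \<delta> Q1 g x * indicator Q x \<partial>lborel))
       + emeasure lborel Q1 * (ennreal (D2 powr (?n2 + p * \<delta>)) * (\<integral>\<^sup>+x. gagliardo2 p \<delta> Q2 g x * indicator Q x \<partial>lborel)))"
    using fractional_poincare_product[OF gm Qm cvx p \<delta>(1,2) Dpos(1) dia Dpos(2) dia2]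
    unfolding K0_def Q12 by simp
  also have "\<dots> \<le> ennreal K0 * (ennreal (cn * q * N powr (p * \<delta>)) * (ennreal (l1 powr (p * \<delta>)) * F1)
      + ennreal (cn * q * N powr (p * \<delta>)) * (ennreal (l2 powr (p * \<delta>)) * F2))"
    by (intro mult_left_mono add_mono b1 b2) auto
  also have "\<dots> = ennreal (K0 * (cn * q * N powr (p * \<delta>))) * (\<integral>\<^sup>+x. F g x * indicator Q x \<partial>lborel)"
    unfolding FF using K0 cn0 q by (simp add: ennreal_mult distrib_left mult.assoc)
  finally have I1: "?I \<le> ennreal (K0 * (cn * q * N powr (p * \<delta>))) * (\<integral>\<^sup>+x. F g x * indicator Q x \<partial>lborel)" .
  \<comment> \<open>The second use of the A1 condition, now on the cell: w(Q) under the integral is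
    replaced by A |Q| w(y), which turns Lebesgue measure into the weighted measure.\<close>
  have I2: "(\<integral>\<^sup>+x. F g x * indicator Q x \<partial>lborel) * emeasure W Q
      \<le> ennreal (A * q) * (\<integral>\<^sup>+x. F g x * ennreal (w x) * indicator Q x \<partial>lborel)"
  proof -
    have "(\<integral>\<^sup>+x. F g x * indicator Q x \<partial>lborel) * emeasure W Q = (\<integral>\<^sup>+x. F g x * indicator Q x * emeasure W Q \<partial>lborel)"
      using Qb by (simp add: nn_integral_multc)
    also have "\<dots> \<le> (\<integral>\<^sup>+x. ennreal (A * q) * (F g x * ennreal (w x) * indicator Q x) \<partial>lborel)"
    proof (intro nn_integral_mono_AE)
      show "AE y in lborel. F g y * indicator Q y * emeasure W Q \<le> ennreal (A * q) * (F g y * ennreal (w y) * indicator Q y)"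
        using A1[OF x, of j] unfolding Q_def[symmetric]
      proof eventually_elim
        case (elim y)
        show ?case
        proof (cases "y \<in> Q")
          case True
          then have "emeasure W Q \<le> ennreal (A * q) * ennreal (w y)"
            using elim A q Qb by (simp add: emeasure_W emQ ennreal_mult)
          then have "F g y * emeasure W Q \<le> F g y * (ennreal (A * q) * ennreal (w y))"
            by (rule mult_left_mono) simp
          then show ?thesis using True by (simp add: mult_ac)
        qed simp
      qed
    qed
    also have "\<dots> = ennreal (A * q) * (\<integral>\<^sup>+x. F g x * ennreal (w x) * indicator Q x \<partial>lborel)"
      using Qb by (simp add: nn_integral_cmult)
    finally show ?thesis .
  qed
  have "?I * emeasure W Q \<le> ennreal (K0 * (cn * q * N powr (p * \<delta>))) * ((\<integral>\<^sup>+x. F g x * indicator Q x \<partial>lborel) * emeasure W Q)"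
    using mult_right_mono[OF I1, of "emeasure W Q"] by (simp add: mult.assoc)
  also have "\<dots> \<le> ennreal (K0 * (cn * q * N powr (p * \<delta>))) * (ennreal (A * q) * (\<integral>\<^sup>+x. F g x * ennreal (w x) * indicator Q x \<partial>lborel))"
    by (intro mult_left_mono I2) simp
  also have "\<dots> = ennreal (K0 * (cn * q * N powr (p * \<delta>)) * (A * q)) * (\<integral>\<^sup>+x. F g x * ennreal (w x) * indicator Q x \<partial>lborel)"
    using K0 cn0 q A by (simp add: ennreal_mult mult.assoc)
  also have "K0 * (cn * q * N powr (p * \<delta>)) * (A * q) = q\<^sup>2 * N powr (p * \<delta>) * poincare_const"
    by (simp add: K power2_eq_square)
  also have "ennreal (q\<^sup>2 * N powr (p * \<delta>) * poincare_const) * (\<integral>\<^sup>+x. F g x * ennreal (w x) * indicator Q x \<partial>lborel)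
      = ennreal (q\<^sup>2 * N powr (p * \<delta>)) * emeasure (\<nu> g) Q"
    using K K0 cn0 A q by (simp add: emeasure_\<nu>[OF gm Qb] ennreal_mult mult.assoc)
  \<comment> \<open>Here \<open>N = 2 ^ - j\<close> and \<open>D = 2 ^ n\<close>, so the condition
    \<open>\<kappa> * n \<le> \<delta>\<close> weakens the actual decay to the rate in
    \<open>D\<close> for which the exponents \<open>p\<close> and \<open>ps\<close> are
    balanced.\<close>
  also have "\<dots> \<le> ennreal (q\<^sup>2 * D powr (- \<kappa> * p * j)) * emeasure (\<nu> g) Q"
  proof (intro mult_right_mono ennreal_leI mult_left_mono)
    have "N powr (p * \<delta>) = 2 powr (- (real j * (p * \<delta>)))"
      unfolding N_def by (simp add: powr_divide powr_minus_divide powr_powr flip: powr_realpow)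
    also have "\<dots> \<le> 2 powr (- (real j * (p * (\<kappa> * n))))"
      using p \<delta>(3) unfolding n_def by (intro powr_mono) (auto intro!: mult_left_mono)
    also have "\<dots> = (2 powr n) powr (- \<kappa> * p * j)"
      by (simp add: powr_powr mult_ac)
    also have "2 powr n = D"
      unfolding D_def n_def by (simp add: powr_add powr_realpow power_add)
    finally show "N powr (p * \<delta>) \<le> D powr (- \<kappa> * p * j)" .
  qed auto
  finally show ?thesis unfolding qM .
qed

lemma poincare_\<nu>:
  assumes gm [measurable]: "g \<in> borel_measurable borel" and g: "set_integrable M \<Omega> g"
    and fin: "finite_measure (\<nu> g)"
  shows "poincare g (\<nu> g)"
  unfolding poincare_def
proof (intro ballI allI impI)
  interpret \<nu>: finite_measure "\<nu> g" by (rule fin)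
  fix x j and \<beta> :: real
  assume x: "x \<in> \<Omega>" and \<beta>: "0 < \<beta>"
    and h: "D powr (- \<kappa> * p * j) * measure (\<nu> g) (cell j x) \<le> \<beta> powr p * measure W (cell j x)"
  define Q where "Q = cell j x"
  define I where "I = (\<integral>\<^sup>+x. \<integral>\<^sup>+y. ennreal (\<bar>g x - g y\<bar> powr p) * indicator (Q \<times> Q) (x, y) \<partial>lborel \<partial>lborel)"
  have WQ: "0 < measure W Q" unfolding Q_def by (rule W_cell_pos[OF x])
  have "I * emeasure W Q \<le> ennreal ((measure M Q)\<^sup>2 * D powr (- \<kappa> * p * j)) * emeasure (\<nu> g) Q"
    unfolding Q_def I_def by (rule double_integral_cell_le[OF gm x])
  also have "\<dots> = ennreal ((measure M Q)\<^sup>2 * (D powr (- \<kappa> * p * j) * measure (\<nu> g) Q))"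
    by (simp add: \<nu>.emeasure_eq_measure ennreal_mult mult.assoc)
  also have "\<dots> \<le> ennreal ((measure M Q)\<^sup>2 * (\<beta> powr p * measure W Q))"
    using h unfolding Q_def by (intro ennreal_leI mult_left_mono) auto
  also have "\<dots> = ennreal ((measure M Q)\<^sup>2 * \<beta> powr p) * emeasure W Q"
    by (simp add: W.emeasure_eq_measure ennreal_mult mult.assoc)
  finally have "emeasure W Q * I \<le> emeasure W Q * ennreal ((measure M Q)\<^sup>2 * \<beta> powr p)"
    by (simp add: mult.commute)
  then have "I \<le> ennreal ((measure M Q)\<^sup>2 * \<beta> powr p)"
    using WQ by (subst (asm) ennreal_mult_le_mult_iff) (auto simp: W.emeasure_eq_measure)
  then show "(LINT y:cell j x|M. \<bar>g y - avg g (cell j x)\<bar>) \<le> 2 * \<beta> * measure M (cell j x)"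
    unfolding Q_def[symmetric] I_def
    using cell_sub[OF x, of j] measure_cell_pos[OF x, of j] \<beta>
    by (intro oscillation_le g) (auto simp: Q_def)
qed

lemma finite_measure_\<nu>:
  assumes "g \<in> borel_measurable borel" "emeasure (\<nu> g) \<Omega> < \<infinity>"
  shows "finite_measure (\<nu> g)"
proof
  have [measurable]: "g \<in> borel_measurable borel" by fact
  have "emeasure (\<nu> g) (space (\<nu> g)) = emeasure (\<nu> g) \<Omega>"
    unfolding \<nu>_def by (simp add: emeasure_density mult.assoc indicator_inter_arith[symmetric])
  then show "emeasure (\<nu> g) (space (\<nu> g)) \<noteq> \<infinity>" using assms by simp
qed

text \<open>The superadditivity over layers holds for the integrand of the energy at each pair of
  points, since \<open>\<bar>f - m\<bar>\<close> varies no more than \<open>f\<close>; it therefore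
  passes through the kernel to the density, and later through any weight.\<close>

lemma sum_F_trunc_le:
  fixes m :: real
  assumes fm [measurable]: "f \<in> borel_measurable borel" and c: "0 \<le> c"
  defines "g \<equiv> \<lambda>k x. trunc (2 ^ k * c) \<bar>f x - m\<bar>"
  shows "(\<Sum>k<N. F (g k) x) \<le> F f x"
proof -
  have [measurable]: "g k \<in> borel_measurable borel" for k unfolding g_def by measurable
  have [measurable]: "f \<in> borel_measurable (borel \<Otimes>\<^sub>M borel)" "g k \<in> borel_measurable (borel \<Otimes>\<^sub>M borel)" for k
    by (simp_all add: borel_prod)
  have sum: "(\<Sum>k<N. ennreal (\<bar>g k x - g k y\<bar> powr p / s) * i) \<le> ennreal (\<bar>f x - f y\<bar> powr p / s) * i"
    if s: "0 \<le> s" for x y s and i :: ennreal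
  proof -
    have "(\<Sum>k<N. \<bar>g k x - g k y\<bar> powr p / s) \<le> \<bar>f x - f y\<bar> powr p / s"
    proof -
      have "(\<Sum>k<N. \<bar>g k x - g k y\<bar> powr p) \<le> \<bar>\<bar>f x - m\<bar> - \<bar>f y - m\<bar>\<bar> powr p"
        unfolding g_def by (rule sum_trunc_diff_powr_le[OF c p])
      also have "\<dots> \<le> \<bar>f x - f y\<bar> powr p" using p by (intro powr_mono2) auto
      finally show ?thesis using s by (simp add: divide_right_mono flip: sum_divide_distrib)
    qed
    then have "(\<Sum>k<N. ennreal (\<bar>g k x - g k y\<bar> powr p / s)) \<le> ennreal (\<bar>f x - f y\<bar> powr p / s)"
      using s by (subst sum_ennreal) (auto intro: ennreal_leI)
    then show ?thesis by (simp add: mult_right_mono flip: sum_distrib_right)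
  qed
  have G1: "(\<Sum>k<N. gagliardo1 p \<delta> J (g k) x) \<le> gagliardo1 p \<delta> J f x" if [measurable]: "J \<in> sets borel" for J
    unfolding gagliardo1_def by (subst nn_integral_sum[symmetric], measurable) (rule nn_integral_mono, rule sum, simp)
  have G2: "(\<Sum>k<N. gagliardo2 p \<delta> J (g k) x) \<le> gagliardo2 p \<delta> J f x" if [measurable]: "J \<in> sets borel" for J
    unfolding gagliardo2_def by (subst nn_integral_sum[symmetric], measurable) (rule nn_integral_mono, rule sum, simp)
  have "(\<Sum>k<N. F (g k) x) = ennreal (l1 powr (p * \<delta>)) * (\<Sum>k<N. gagliardo1 p \<delta> (hbox b1 l1) (g k) x)
     + ennreal (l2 powr (p * \<delta>)) * (\<Sum>k<N. gagliardo2 p \<delta> (hbox b2 l2) (g k) x)"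
    by (simp add: F_def sum.distrib sum_distrib_left)
  also have "\<dots> \<le> F f x"
    unfolding F_def by (intro add_mono mult_left_mono G1 G2) auto
  finally show ?thesis .
qed

text \<open>\<open>B\<close> is any upper bound for the normalised energy, kept positive because it
  sets the truncation levels. An energy equal to 0 is reached afterwards by letting \<open>B\<close>
  decrease.\<close>

theorem fractional_poincare_sobolev:
  assumes fm [measurable]: "f \<in> borel_measurable borel" and f: "set_integrable M \<Omega> f" and B: "0 < B"
    and h: "ennreal poincare_const * (\<integral>\<^sup>+x. F f x * ennreal (w x) * indicator \<Omega> x \<partial>lborel)
      \<le> ennreal (B powr p) * (\<integral>\<^sup>+x. ennreal (w x) * indicator \<Omega> x \<partial>lborel)"
  shows "(\<integral>\<^sup>+x. ennreal (\<bar>f x - avg f \<Omega>\<bar> powr ps) * ennreal (w x) * indicator \<Omega> x \<partial>lborel)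
    \<le> ennreal (strong_const * B powr ps) * (\<integral>\<^sup>+x. ennreal (w x) * indicator \<Omega> x \<partial>lborel)"
proof -
  have W\<Omega>: "(\<integral>\<^sup>+x. ennreal (w x) * indicator \<Omega> x \<partial>lborel) = ennreal (measure W \<Omega>)"
    using emeasure_W[of \<Omega>] by (simp add: W.emeasure_eq_measure)
  define g where "g k x = trunc (2 ^ k * (4 * B)) \<bar>f x - avg f \<Omega>\<bar>" for k x
  have gm [measurable]: "g k \<in> borel_measurable borel" for k unfolding g_def by measurable
  have em: "emeasure (\<nu> f) \<Omega> \<le> ennreal (B powr p * measure W \<Omega>)"
    using h by (simp add: emeasure_\<nu> W\<Omega> ennreal_mult)
  then have "emeasure (\<nu> f) \<Omega> < \<infinity>" by (metis ennreal_less_top infinity_ennreal_def le_less_trans)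
  then have fin: "finite_measure (\<nu> f)" by (intro finite_measure_\<nu> fm)
  interpret \<nu>: finite_measure "\<nu> f" by (rule fin)
  have mB: "measure (\<nu> f) \<Omega> \<le> B powr p * measure W \<Omega>"
    using em by (simp add: \<nu>.emeasure_eq_measure)
  have Pf: "poincare f (\<nu> f)" by (rule poincare_\<nu>[OF fm f fin])
  have sum: "(\<Sum>k<N. emeasure (\<nu> (g k)) \<Omega>) \<le> emeasure (\<nu> f) \<Omega>" for N
  proof -
    have "(\<Sum>k<N. emeasure (\<nu> (g k)) \<Omega>)
        = ennreal poincare_const * (\<Sum>k<N. \<integral>\<^sup>+x. F (g k) x * ennreal (w x) * indicator \<Omega> x \<partial>lborel)"
      by (simp add: emeasure_\<nu> sum_distrib_left)
    also have "(\<Sum>k<N. \<integral>\<^sup>+x. F (g k) x * ennreal (w x) * indicator \<Omega> x \<partial>lborel)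
        = (\<integral>\<^sup>+x. (\<Sum>k<N. F (g k) x * ennreal (w x) * indicator \<Omega> x) \<partial>lborel)"
      by (rule nn_integral_sum[symmetric]) measurable
    also have "\<dots> = (\<integral>\<^sup>+x. (\<Sum>k<N. F (g k) x) * ennreal (w x) * indicator \<Omega> x \<partial>lborel)"
      by (simp only: sum_distrib_right)
    also have "ennreal poincare_const * (\<integral>\<^sup>+x. (\<Sum>k<N. F (g k) x) * ennreal (w x) * indicator \<Omega> x \<partial>lborel)
        \<le> ennreal poincare_const * (\<integral>\<^sup>+x. F f x * ennreal (w x) * indicator \<Omega> x \<partial>lborel)"
      unfolding g_def using B by (intro mult_left_mono nn_integral_mono mult_right_mono sum_F_trunc_le fm) auto
    also have "\<dots> = emeasure (\<nu> f) \<Omega>" by (simp add: emeasure_\<nu>)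
    finally show ?thesis .
  qed
  have fin_k: "finite_measure (\<nu> (g k))" for k
  proof (rule finite_measure_\<nu>[OF gm])
    have "emeasure (\<nu> (g k)) \<Omega> \<le> (\<Sum>i<Suc k. emeasure (\<nu> (g i)) \<Omega>)" by (simp add: add_increasing)
    also have "\<dots> \<le> emeasure (\<nu> f) \<Omega>" by (rule sum)
    finally show "emeasure (\<nu> (g k)) \<Omega> < \<infinity>" using \<open>emeasure (\<nu> f) \<Omega> < \<infinity>\<close> by simp
  qed
  have sum': "(\<Sum>k<N. measure (\<nu> (g k)) \<Omega>) \<le> measure (\<nu> f) \<Omega>" for N
  proof -
    have "ennreal (\<Sum>k<N. measure (\<nu> (g k)) \<Omega>) = (\<Sum>k<N. emeasure (\<nu> (g k)) \<Omega>)"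
      using finite_measure.emeasure_eq_measure[OF fin_k] by (subst sum_ennreal[symmetric]) auto
    also have "\<dots> \<le> ennreal (measure (\<nu> f) \<Omega>)" using sum[of N] by (simp add: \<nu>.emeasure_eq_measure)
    finally show ?thesis by simp
  qed
  have fM: "h \<in> borel_measurable M" if "h \<in> borel_measurable borel" for h :: "_ \<Rightarrow> real"
    using that by (simp add: measurable_cong_sets[OF sets_M refl])
  have "poincare (g k) (\<nu> (g k))" for k
  proof (rule poincare_\<nu>[OF gm _ fin_k])
    show "set_integrable M \<Omega> (g k)"
      unfolding g_def using B mB by (intro avg_trunc_le[OF f fM[OF fm] Pf]) auto
  qed
  then have "(\<integral>\<^sup>+x. ennreal (\<bar>f x - avg f \<Omega>\<bar> powr ps) * indicator \<Omega> x \<partial>W) \<le> ennreal (strong_const * B powr ps * measure W \<Omega>)"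
    unfolding g_def[abs_def]
    by (intro strong_type[where \<nu> = "\<nu> f" and \<nu>k = "\<lambda>k. \<nu> (g k)"] f fM fm fin Pf B mB)
       (use fin_k sum' in \<open>auto simp: g_def[abs_def]\<close>)
  also have "\<dots> = ennreal (strong_const * B powr ps) * ennreal (measure W \<Omega>)"
    by (intro ennreal_mult) (auto simp: strong_const_def)
  also have "(\<integral>\<^sup>+x. ennreal (\<bar>f x - avg f \<Omega>\<bar> powr ps) * indicator \<Omega> x \<partial>W)
    = (\<integral>\<^sup>+x. ennreal (\<bar>f x - avg f \<Omega>\<bar> powr ps) * ennreal (w x) * indicator \<Omega> x \<partial>lborel)"
    unfolding W_def by (subst nn_integral_density) (auto intro!: nn_integral_cong simp: indicator_def mult_ac)
  finally show ?thesis unfolding W\<Omega> .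
qed

end

section \<open>Reduction to Borel functions\<close>

text \<open>The exceptional set is enlarged to a Borel null set first; Fubini applies to that set in
  either order, whatever the measurability of \<open>P\<close>.\<close>

lemma AE_lborel_prod:
  fixes P :: "'a::euclidean_space \<times> 'b::euclidean_space \<Rightarrow> bool"
  assumes "AE z in lborel. P z"
  shows "AE x in lborel. AE y in lborel. P (x, y)" "AE y in lborel. AE x in lborel. P (x, y)"
proof -
  obtain N where N: "N \<in> null_sets lborel" "{z. \<not> P z} \<subseteq> N"
    using assms by (auto simp: eventually_ae_filter)
  have Nm [measurable]: "N \<in> sets (borel \<Otimes>\<^sub>M borel)" 
    using null_setsD2[OF N(1)] unfolding borel_prod by simp
  have set: "{z \<in> space (lborel \<Otimes>\<^sub>M lborel). (fst z, snd z) \<notin> N} \<in> sets (lborel \<Otimes>\<^sub>M lborel)"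
    by measurable
  have "AE z in lborel \<Otimes>\<^sub>M lborel. z \<notin> N"
    using N unfolding lborel_prod by (intro AE_not_in)
  then have *: "AE x in lborel. AE y in lborel. (x, y) \<notin> N"
    by (rule lborel_pair.AE_pair)
  then have **: "AE y in lborel. AE x in lborel. (x, y) \<notin> N"
    using lborel_pair.AE_commute[of "\<lambda>x y. (x, y) \<notin> N", OF set] by simp
  have P: "P z" if "z \<notin> N" for z using N(2) that by auto
  show "AE x in lborel. AE y in lborel. P (x, y)"
    using * by (rule eventually_mono) (erule eventually_mono, erule P)
  show "AE y in lborel. AE x in lborel. P (x, y)"
    using ** by (rule eventually_mono) (erule eventually_mono, erule P)
qed

text \<open>An inequality suffices, since \<open>a1\<close> stands on the larger side of the
  theorem. Integrals are exchanged on the Borel side only. The passage to \<open>f\<close> and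
  \<open>w\<close> is monotonicity on almost every slice, which is valid even for inner integrals
  whose measurability in the outer variables is unknown.\<close>

lemma nn_integral_gagliardo1_le:
  fixes f f' w w' :: "(real ^ 'n1) \<times> (real ^ 'n2) \<Rightarrow> real"
  assumes [measurable]: "f' \<in> borel_measurable borel" "w' \<in> borel_measurable borel" "J1 \<in> sets borel" "J2 \<in> sets borel"
    and ae: "AE x in lborel. x \<in> I1 \<times> I2 \<longrightarrow> f x = f' x \<and> w x = w' x" and J: "J1 \<subseteq> I1" "J2 \<subseteq> I2"
  shows "(\<integral>\<^sup>+x. gagliardo1 p \<delta> J1 f' x * ennreal (w' x) * indicator (J1 \<times> J2) x \<partial>lborel)
    \<le> (\<integral>\<^sup>+x2\<in>I2. (\<integral>\<^sup>+x1\<in>I1.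
        (\<integral>\<^sup>+y1\<in>I1. ennreal (\<bar>f (x1, x2) - f (y1, x2)\<bar> powr p
            / norm (x1 - y1) powr (real CARD('n1) + p * \<delta>)) \<partial>lebesgue)
        * ennreal (w (x1, x2)) \<partial>lebesgue) \<partial>lebesgue)" (is "_ \<le> ?T")
proof -
  have [measurable]: "J1 \<times> J2 \<in> sets (borel \<Otimes>\<^sub>M borel)" by simp
  have [measurable]: "gagliardo1 p \<delta> J1 f' \<in> borel_measurable (borel \<Otimes>\<^sub>M borel)" "w' \<in> borel_measurable (borel \<Otimes>\<^sub>M borel)"
    by (simp_all add: borel_prod)
  have "(\<integral>\<^sup>+x. gagliardo1 p \<delta> J1 f' x * ennreal (w' x) * indicator (J1 \<times> J2) x \<partial>lborel)
     = (\<integral>\<^sup>+x1. \<integral>\<^sup>+x2. gagliardo1 p \<delta> J1 f' (x1, x2) * ennreal (w' (x1, x2)) * indicator (J1 \<times> J2) (x1, x2) \<partial>lborel \<partial>lborel)"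
    by (rule nn_integral_lborel_prod) (use Times_borel[of J1 J2] in measurable)
  also have "\<dots> = (\<integral>\<^sup>+x2. \<integral>\<^sup>+x1. gagliardo1 p \<delta> J1 f' (x1, x2) * ennreal (w' (x1, x2)) * indicator (J1 \<times> J2) (x1, x2) \<partial>lborel \<partial>lborel)"
    by (rule lborel_pair.Fubini'[symmetric]) measurable
  also have "\<dots> \<le> ?T"
    unfolding nn_integral_completion
  proof (rule nn_integral_mono_AE)
    show "AE x2 in lborel. (\<integral>\<^sup>+x1. gagliardo1 p \<delta> J1 f' (x1, x2) * ennreal (w' (x1, x2)) * indicator (J1 \<times> J2) (x1, x2) \<partial>lborel)
      \<le> (\<integral>\<^sup>+x1\<in>I1. (\<integral>\<^sup>+y1\<in>I1. ennreal (\<bar>f (x1, x2) - f (y1, x2)\<bar> powr p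
            / norm (x1 - y1) powr (real CARD('n1) + p * \<delta>)) \<partial>lborel) * ennreal (w (x1, x2)) \<partial>lborel) * indicator I2 x2"
      using AE_lborel_prod(2)[OF ae]
    proof eventually_elim
      case (elim x2)
      note good = elim
      show ?case
      proof (cases "x2 \<in> J2")
        case True
        then have x2: "x2 \<in> I2" using J by auto
        have "(\<integral>\<^sup>+x1. gagliardo1 p \<delta> J1 f' (x1, x2) * ennreal (w' (x1, x2)) * indicator (J1 \<times> J2) (x1, x2) \<partial>lborel)
         \<le> (\<integral>\<^sup>+x1\<in>I1. (\<integral>\<^sup>+y1\<in>I1. ennreal (\<bar>f (x1, x2) - f (y1, x2)\<bar> powr p
            / norm (x1 - y1) powr (real CARD('n1) + p * \<delta>)) \<partial>lborel) * ennreal (w (x1, x2)) \<partial>lborel)"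
        proof (rule nn_integral_mono_AE)
          show "AE x1 in lborel. gagliardo1 p \<delta> J1 f' (x1, x2) * ennreal (w' (x1, x2)) * indicator (J1 \<times> J2) (x1, x2)
            \<le> (\<integral>\<^sup>+y1\<in>I1. ennreal (\<bar>f (x1, x2) - f (y1, x2)\<bar> powr p
            / norm (x1 - y1) powr (real CARD('n1) + p * \<delta>)) \<partial>lborel) * ennreal (w (x1, x2)) * indicator I1 x1"
            using good
          proof eventually_elim
            case (elim x1)
            show ?case
            proof (cases "x1 \<in> J1")
              case True
              then have x1: "x1 \<in> I1" using J by auto
              have "gagliardo1 p \<delta> J1 f' (x1, x2) \<le> (\<integral>\<^sup>+y1\<in>I1. ennreal (\<bar>f (x1, x2) - f (y1, x2)\<bar> powr p
                / norm (x1 - y1) powr (real CARD('n1) + p * \<delta>)) \<partial>lborel)"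
                unfolding gagliardo1_def
              proof (rule nn_integral_mono_AE)
                show "AE y in lborel. ennreal (\<bar>f' (x1, x2) - f' (y, snd (x1, x2))\<bar> powr p
                  / norm (fst (x1, x2) - y) powr (real DIM(real ^ 'n1) + p * \<delta>)) * indicator J1 y
                  \<le> ennreal (\<bar>f (x1, x2) - f (y, x2)\<bar> powr p / norm (x1 - y) powr (real CARD('n1) + p * \<delta>)) * indicator I1 y"
                  using good by eventually_elim (use elim x1 x2 J in \<open>auto simp: indicator_def\<close>)
              qed
              then have "gagliardo1 p \<delta> J1 f' (x1, x2) * ennreal (w (x1, x2)) \<le> (\<integral>\<^sup>+y1\<in>I1. ennreal (\<bar>f (x1, x2) - f (y1, x2)\<bar> powr p
                / norm (x1 - y1) powr (real CARD('n1) + p * \<delta>)) \<partial>lborel) * ennreal (w (x1, x2))"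
                by (rule mult_right_mono) simp
              then show ?thesis using True \<open>x2 \<in> J2\<close> x1 x2 elim by simp
            qed simp
          qed
        qed
        then show ?thesis using x2 by simp
      qed simp
    qed
  qed
  finally show ?thesis .
qed

text \<open>The same slicing argument; the outer variable is already the first one, so no integrals
  are exchanged, and the symmetry of the kernel absorbs the opposite order of the arguments in
  \<open>a2\<close>.\<close>

lemma nn_integral_gagliardo2_le:
  fixes f f' w w' :: "(real ^ 'n1) \<times> (real ^ 'n2) \<Rightarrow> real"
  assumes [measurable]: "f' \<in> borel_measurable borel" "w' \<in> borel_measurable borel" "J1 \<in> sets borel" "J2 \<in> sets borel"
    and ae: "AE x in lborel. x \<in> I1 \<times> I2 \<longrightarrow> f x = f' x \<and> w x = w' x" and J: "J1 \<subseteq> I1" "J2 \<subseteq> I2"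
  shows "(\<integral>\<^sup>+x. gagliardo2 p \<delta> J2 f' x * ennreal (w' x) * indicator (J1 \<times> J2) x \<partial>lborel)
    \<le> (\<integral>\<^sup>+y1\<in>I1. (\<integral>\<^sup>+y2\<in>I2.
        (\<integral>\<^sup>+x2\<in>I2. ennreal (\<bar>f (y1, x2) - f (y1, y2)\<bar> powr p
            / norm (x2 - y2) powr (real CARD('n2) + p * \<delta>)) \<partial>lebesgue)
        * ennreal (w (y1, y2)) \<partial>lebesgue) \<partial>lebesgue)" (is "_ \<le> ?T")
proof -
  have "(\<integral>\<^sup>+x. gagliardo2 p \<delta> J2 f' x * ennreal (w' x) * indicator (J1 \<times> J2) x \<partial>lborel)
     = (\<integral>\<^sup>+x1. \<integral>\<^sup>+x2. gagliardo2 p \<delta> J2 f' (x1, x2) * ennreal (w' (x1, x2)) * indicator (J1 \<times> J2) (x1, x2) \<partial>lborel \<partial>lborel)"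
    by (rule nn_integral_lborel_prod) (use Times_borel[of J1 J2] in measurable)
  also have "\<dots> \<le> ?T"
    unfolding nn_integral_completion
  proof (rule nn_integral_mono_AE)
    show "AE y1 in lborel. (\<integral>\<^sup>+y2. gagliardo2 p \<delta> J2 f' (y1, y2) * ennreal (w' (y1, y2)) * indicator (J1 \<times> J2) (y1, y2) \<partial>lborel)
      \<le> (\<integral>\<^sup>+y2\<in>I2. (\<integral>\<^sup>+x2\<in>I2. ennreal (\<bar>f (y1, x2) - f (y1, y2)\<bar> powr p
            / norm (x2 - y2) powr (real CARD('n2) + p * \<delta>)) \<partial>lborel) * ennreal (w (y1, y2)) \<partial>lborel) * indicator I1 y1"
      using AE_lborel_prod(1)[OF ae]
    proof eventually_elim
      case (elim y1)
      note good = elim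
      show ?case
      proof (cases "y1 \<in> J1")
        case True
        then have y1: "y1 \<in> I1" using J by auto
        have "(\<integral>\<^sup>+y2. gagliardo2 p \<delta> J2 f' (y1, y2) * ennreal (w' (y1, y2)) * indicator (J1 \<times> J2) (y1, y2) \<partial>lborel)
         \<le> (\<integral>\<^sup>+y2\<in>I2. (\<integral>\<^sup>+x2\<in>I2. ennreal (\<bar>f (y1, x2) - f (y1, y2)\<bar> powr p
            / norm (x2 - y2) powr (real CARD('n2) + p * \<delta>)) \<partial>lborel) * ennreal (w (y1, y2)) \<partial>lborel)"
        proof (rule nn_integral_mono_AE)
          show "AE y2 in lborel. gagliardo2 p \<delta> J2 f' (y1, y2) * ennreal (w' (y1, y2)) * indicator (J1 \<times> J2) (y1, y2)
            \<le> (\<integral>\<^sup>+x2\<in>I2. ennreal (\<bar>f (y1, x2) - f (y1, y2)\<bar> powr p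
            / norm (x2 - y2) powr (real CARD('n2) + p * \<delta>)) \<partial>lborel) * ennreal (w (y1, y2)) * indicator I2 y2"
            using good
          proof eventually_elim
            case (elim y2)
            show ?case
            proof (cases "y2 \<in> J2")
              case True
              then have y2: "y2 \<in> I2" using J by auto
              have "gagliardo2 p \<delta> J2 f' (y1, y2) \<le> (\<integral>\<^sup>+x2\<in>I2. ennreal (\<bar>f (y1, x2) - f (y1, y2)\<bar> powr p
                / norm (x2 - y2) powr (real CARD('n2) + p * \<delta>)) \<partial>lborel)"
                unfolding gagliardo2_def
              proof (rule nn_integral_mono_AE)
                show "AE y in lborel. ennreal (\<bar>f' (y1, y2) - f' (fst (y1, y2), y)\<bar> powr p
                  / norm (snd (y1, y2) - y) powr (real DIM(real ^ 'n2) + p * \<delta>)) * indicator J2 y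
                  \<le> ennreal (\<bar>f (y1, y) - f (y1, y2)\<bar> powr p / norm (y - y2) powr (real CARD('n2) + p * \<delta>)) * indicator I2 y"
                  using good
                  by eventually_elim (use elim y1 y2 J in \<open>auto simp: indicator_def abs_minus_commute norm_minus_commute\<close>)
              qed
              then have "gagliardo2 p \<delta> J2 f' (y1, y2) * ennreal (w (y1, y2)) \<le> (\<integral>\<^sup>+x2\<in>I2. ennreal (\<bar>f (y1, x2) - f (y1, y2)\<bar> powr p
                / norm (x2 - y2) powr (real CARD('n2) + p * \<delta>)) \<partial>lborel) * ennreal (w (y1, y2))"
                by (rule mult_right_mono) simp
              then show ?thesis using True \<open>y1 \<in> J1\<close> y1 y2 elim by simp
            qed simp
          qed
        qed
        then show ?thesis using y1 by simp
      qed simp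
    qed
  qed
  finally show ?thesis .
qed

section \<open>The weight condition on closed rectangles and its constant\<close>

lemma emeasure_cube: "0 \<le> l \<Longrightarrow> emeasure lborel (cube (a :: real ^ 'n) l) = ennreal (l ^ CARD('n))"
  by (simp add: cube_def emeasure_cbox_cube)

lemma cube_borel [measurable]: "cube a l \<in> sets borel"
  by (simp add: cube_def)

lemma compact_rectangle: "compact (cube b1 l1 \<times> cube b2 l2)"
  unfolding cube_def by (intro compact_Times compact_cbox)

lemma wmeas_eq_integral:
  assumes w: "weight w" and R: "compact R"
  shows "wmeas w R = ennreal (LINT x:R|lebesgue. w x)" "wmeas w R < \<infinity>"
proof -
  have i: "integrable lebesgue (\<lambda>x. indicat_real R x * w x)"
    using w R by (auto simp: weight_def locally_integrable_def set_integrable_def)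
  have "ennreal (LINT x:R|lebesgue. w x) = (\<integral>\<^sup>+x. ennreal (indicat_real R x * w x) \<partial>lebesgue)"
    unfolding set_lebesgue_integral_def real_scaleR_def
    using i w by (intro nn_integral_eq_integral[symmetric]) (auto simp: weight_def)
  also have "\<dots> = wmeas w R"
    unfolding wmeas_def by (intro nn_integral_cong) (auto simp: indicator_def)
  finally show "wmeas w R = ennreal (LINT x:R|lebesgue. w x)" by simp
  then show "wmeas w R < \<infinity>" by simp
qed

text \<open>The essential infimum becomes a bound at almost every point and the average is
  multiplied out; in this form the condition can be integrated.\<close>

lemma A1_bound_AE:
  fixes w :: "(real ^ 'n1) \<times> (real ^ 'n2) \<Rightarrow> real" and b1 :: "real ^ 'n1" and b2 :: "real ^ 'n2"
  assumes w: "weight w" and c: "0 \<le> c" "A1_bound w c" and l: "0 < l1" "0 < l2"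
  defines "R \<equiv> cube b1 l1 \<times> cube b2 l2"
  shows "AE y in lborel. y \<in> R \<longrightarrow> wmeas w R \<le> ennreal c * emeasure lborel R * ennreal (w y)"
proof -
  have Rr: "R \<in> rectangles" using l unfolding R_def rectangles_def cubes_def by blast
  have Rb: "R \<in> sets borel" unfolding R_def by (intro Times_borel cube_borel)
  have "emeasure lborel R = ennreal (l1 ^ CARD('n1)) * ennreal (l2 ^ CARD('n2))"
    using l unfolding R_def by (simp add: emeasure_lborel_Times emeasure_cube)
  then have em: "emeasure lborel R = ennreal (l1 ^ CARD('n1) * l2 ^ CARD('n2))"
    using l by (simp add: ennreal_mult)
  define m where "m = l1 ^ CARD('n1) * l2 ^ CARD('n2)"
  have m: "0 < m" using l by (simp add: m_def)
  have mm: "measure lebesgue R = m" using em Rb m by (simp add: measure_def m_def)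
  have "AE x in restrict_space lebesgue R. - ereal (w x) \<le> esssup (restrict_space lebesgue R) (\<lambda>x. - ereal (w x))"
    by (rule esssup_AE)
  then have "AE x in lebesgue. x \<in> R \<longrightarrow> - ereal (w x) \<le> esssup (restrict_space lebesgue R) (\<lambda>x. - ereal (w x))"
    using Rb by (subst (asm) AE_restrict_space_iff) auto
  then have "AE x in lborel. x \<in> R \<longrightarrow> essinf_on R w \<le> ereal (w x)"
    unfolding AE_completion_iff essinf_on_def
    by eventually_elim (auto simp: ereal_uminus_le_reorder)
  then show ?thesis
  proof eventually_elim
    case (elim y)
    show ?case
    proof
      assume "y \<in> R"
      have "ereal (average w R) \<le> ereal c * essinf_on R w"
        using c Rr by (auto simp: A1_bound_def)
      also have "\<dots> \<le> ereal c * ereal (w y)"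
        using elim \<open>y \<in> R\<close> c by (intro ereal_mult_left_mono) auto
      finally have "average w R \<le> c * w y" by simp
      then have "(LINT x:R|lebesgue. w x) \<le> c * m * w y"
        using m by (simp add: average_def mm divide_le_eq mult_ac)
      then show "wmeas w R \<le> ennreal c * emeasure lborel R * ennreal (w y)"
      proof -
        have "0 \<le> w y" using w unfolding weight_def by blast
        then have "ennreal c * emeasure lborel R * ennreal (w y) = ennreal (c * m * w y)"
          using c m unfolding em m_def[symmetric] by (simp add: ennreal_mult)
        then show ?thesis
          using \<open>_ \<le> c * m * w y\<close> wmeas_eq_integral(1)[OF w compact_rectangle[of b1 l1 b2 l2]]
          by (simp add: R_def ennreal_leI)
      qed
    qed
  qed
qed

text \<open>Integrating the pointwise condition over the rectangle gives w(R) |R| \<le> c |R| w(R),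
  and the mass is positive and finite. It ensures \<open>ln (A1_const w) \<ge> 0\<close>, on which
  the use of the relation for \<open>pstar\<close> rests.\<close>

lemma A1_bound_ge_1:
  fixes w :: "(real ^ 'n1) \<times> (real ^ 'n2) \<Rightarrow> real" and b1 :: "real ^ 'n1" and b2 :: "real ^ 'n2"
  assumes w: "weight w" and c: "0 \<le> c" "A1_bound w c" and l: "0 < l1" "0 < l2"
    and pos: "0 < wmeas w (cube b1 l1 \<times> cube b2 l2)"
  shows "1 \<le> c"
proof -
  define R where "R = cube b1 l1 \<times> cube b2 l2"
  have Rb [measurable]: "R \<in> sets borel" unfolding R_def by (intro Times_borel cube_borel)
  have "emeasure lborel R = ennreal (l1 ^ CARD('n1)) * ennreal (l2 ^ CARD('n2))"
    using l unfolding R_def by (simp add: emeasure_lborel_Times emeasure_cube)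
  also have "\<dots> = ennreal (l1 ^ CARD('n1) * l2 ^ CARD('n2))"
    using l by (simp add: ennreal_mult)
  finally obtain m where m: "0 < m" "emeasure lborel R = ennreal m"
    using l by (metis mult_pos_pos zero_less_power)
  obtain v where v: "wmeas w R = ennreal v" "0 < v"
    using wmeas_eq_integral(2)[OF w compact_rectangle[of b1 l1 b2 l2]] pos unfolding R_def[symmetric]
    by (cases "wmeas w R" rule: ennreal_cases) auto
  have "wmeas w R * emeasure lborel R = (\<integral>\<^sup>+y. wmeas w R * indicator R y \<partial>lborel)"
    by (simp add: nn_integral_cmult_indicator)
  also have "\<dots> \<le> (\<integral>\<^sup>+y. ennreal c * emeasure lborel R * (ennreal (w y) * indicator R y) \<partial>lborel)"
  proof (rule nn_integral_mono_AE)
    show "AE y in lborel. wmeas w R * indicator R y \<le> ennreal c * emeasure lborel R * (ennreal (w y) * indicator R y)"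
      using A1_bound_AE[OF w c l, of b1 b2] unfolding R_def[symmetric]
      by eventually_elim (auto simp: indicator_def)
  qed
  also have "\<dots> = (\<integral>\<^sup>+y. ennreal c * emeasure lborel R * (ennreal (w y) * indicator R y) \<partial>lebesgue)"
    by (simp add: nn_integral_completion)
  also have "\<dots> = ennreal c * emeasure lborel R * wmeas w R"
  proof -
    have "(\<lambda>y. ennreal (indicat_real R y * w y)) \<in> borel_measurable lebesgue"
      using w compact_rectangle[of b1 l1 b2 l2] unfolding R_def[symmetric]
      by (auto simp: weight_def locally_integrable_def set_integrable_def)
    also have "(\<lambda>y. ennreal (indicat_real R y * w y)) = (\<lambda>y. ennreal (w y) * indicator R y)"
      by (auto simp: indicator_def)
    finally show ?thesis unfolding wmeas_def by (rule nn_integral_cmult)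
  qed
  finally have "ennreal (v * m) \<le> ennreal (c * m * v)"
    using m v c by (simp add: ennreal_mult)
  then have "v * m \<le> c * m * v" using m v c by (simp add: ennreal_le_iff)
  then show ?thesis using m v by (simp add: mult.commute[of v])
qed

text \<open>The infimum is approached within 1 instead of being attained; this margin is the summand
  1 in the constant \<open>A\<close> of \<open>theorem2p20\<close>.\<close>

lemma A1_const_approx:
  fixes w :: "(real ^ 'n1) \<times> (real ^ 'n2) \<Rightarrow> real" and b1 :: "real ^ 'n1" and b2 :: "real ^ 'n2"
  assumes w: "A1_weight w" and l: "0 < l1" "0 < l2"
    and pos: "0 < wmeas w (cube b1 l1 \<times> cube b2 l2)"
  obtains c where "1 \<le> c" "A1_bound w c" "c < A1_const w + 1" "1 \<le> A1_const w"
proof -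
  define S where "S = {c. 0 \<le> c \<and> A1_bound w c}"
  have w': "weight w" and ne: "S \<noteq> {}" using w by (auto simp: A1_weight_def S_def)
  have ge: "1 \<le> c" if "c \<in> S" for c
    using that A1_bound_ge_1[OF w' _ _ l pos] by (auto simp: S_def)
  have "Inf S < A1_const w + 1" by (simp add: A1_const_def S_def)
  then obtain c where "c \<in> S" "c < A1_const w + 1"
    using cInf_lessD[OF ne] by blast
  moreover have "1 \<le> A1_const w"
    unfolding A1_const_def S_def[symmetric] by (intro cInf_greatest ne ge)
  ultimately show ?thesis using ge by (intro that[of c]) (auto simp: S_def)
qed

lemma ex_borel_AE_eq_on:
  fixes f :: "'a::euclidean_space \<Rightarrow> real"
  assumes "locally_integrable f" "compact R"
  obtains f' where "f' \<in> borel_measurable borel" "AE x in lborel. x \<in> R \<longrightarrow> f x = f' x"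
proof -
  have "(\<lambda>x. indicat_real R x * f x) \<in> borel_measurable lebesgue"
    using assms by (auto simp: locally_integrable_def set_integrable_def)
  then obtain f' where f': "f' \<in> borel_measurable lborel" "AE x in lborel. indicat_real R x * f x = f' x"
    using completion_ex_borel_measurable_real by blast
  from f'(2) have "AE x in lborel. x \<in> R \<longrightarrow> f x = f' x"
    by eventually_elim auto
  with f'(1) show ?thesis by (intro that[of f']) auto
qed

section \<open>The estimate on a single rectangle\<close>

lemma epowr_mono: "x \<le> y \<Longrightarrow> 0 \<le> a \<Longrightarrow> epowr x a \<le> epowr y a"
  unfolding epowr_def by (auto intro!: ennreal_leI powr_mono2 enn2real_mono simp: top.extremum_uniqueI less_top[symmetric])

lemma epowr_ennreal: "0 \<le> r \<Longrightarrow> epowr (ennreal r) a = ennreal (r powr a)"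
  by (simp add: epowr_def)

lemma epowr_finiteD:
  assumes "epowr x (1 / p) \<noteq> \<infinity>" "0 < p"
  shows "x = ennreal (enn2real (epowr x (1 / p)) powr p)"
  using assms by (cases x rule: ennreal_cases) (auto simp: epowr_def powr_powr)

lemma hcell_subset:
  assumes "0 < l" "x \<in> hbox a l"
  shows "hcell a l j x \<subseteq> hbox a l"
proof (induction j)
  case (Suc j)
  then show ?case using hcell_Suc[of a l j x] by blast
qed (simp add: hcell_0[OF assms])

lemma hbox_subset_cube: "hbox a l \<subseteq> cube a l"
  unfolding cube_def by (rule hbox_subset_cbox)

lemma AE_rectangle_hbox:
  fixes b1 :: "real ^ 'n1" and b2 :: "real ^ 'n2"
  assumes l: "0 < l1" "0 < l2"
  shows "AE x in lborel. x \<in> cube b1 l1 \<times> cube b2 l2 \<longrightarrow> x \<in> hbox b1 l1 \<times> hbox b2 l2"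
proof -
  let ?R = "cube b1 l1 \<times> cube b2 l2" and ?H = "hbox b1 l1 \<times> hbox b2 l2"
  have m: "?R \<in> sets borel" "?H \<in> sets borel" by (auto intro!: Times_borel)
  have em: "emeasure lborel ?R = emeasure lborel ?H"
    using l by (simp add: emeasure_lborel_Times emeasure_cube emeasure_hbox)
  have fin: "emeasure lborel ?H \<noteq> \<infinity>"
    using l by (simp add: emeasure_lborel_Times emeasure_hbox flip: ennreal_mult)
  have "emeasure lborel (?R - ?H) = emeasure lborel ?R - emeasure lborel ?H"
    using m fin hbox_subset_cube[of b1 l1] hbox_subset_cube[of b2 l2] by (intro emeasure_Diff) auto
  then have "?R - ?H \<in> null_sets lborel"
    using m fin em by (auto simp: null_sets_def)
  then have "AE x in lborel. x \<notin> ?R - ?H" by (rule AE_not_in)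
  then show ?thesis by eventually_elim blast
qed

text \<open>Lets a strictly positive bound \<open>b\<close> decrease to an energy that may be
  0.\<close>

lemma ennreal_le_of_forall_gt:
  fixes x :: ennreal
  assumes "\<And>b. 0 < b \<Longrightarrow> c \<le> b \<Longrightarrow> x \<le> ennreal (k * b)" and "0 \<le> c" "0 < k"
  shows "x \<le> ennreal (k * c)"
proof (rule ennreal_le_epsilon)
  fix e :: real assume e: "0 < e"
  have "x \<le> ennreal (k * (c + e / k))" using assms e by (intro assms) (auto intro: add_nonneg_pos)
  also have "k * (c + e / k) = k * c + e" using assms by (simp add: distrib_left)
  also have "ennreal (k * c + e) = ennreal (k * c) + ennreal e" using assms e by (intro ennreal_plus) auto
  finally show "x \<le> ennreal (k * c) + ennreal e" .
qed

text \<open>Carries the inequality from Borel functions on a half-open box back to Lebesgue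
  measurable \<open>f\<close> and \<open>w\<close> on closed cubes. On the left all quantities agree
  exactly, on the right a one-sided comparison is enough. \<open>C\<close> is free of \<delta>,
  which enters through \<open>K\<close> alone.\<close>

lemma rectangle_estimate:
  fixes f w :: "(real ^ 'n1) \<times> (real ^ 'n2) \<Rightarrow> real" and b1 :: "real ^ 'n1" and b2 :: "real ^ 'n2"
  assumes p: "1 \<le> p" and ps: "0 < ps" and \<kappa>: "0 < \<kappa>" "\<kappa> = 1 / p - 1 / ps"
    and \<delta>: "0 < \<delta>" "\<delta> < 1" "\<kappa> * (real CARD('n1) + real CARD('n2)) \<le> \<delta>"
    and w: "weight w" and f: "locally_integrable f"
    and c: "0 \<le> c" "A1_bound w c" and A: "1 \<le> A" "c \<le> A"
    and l: "0 < l1" "0 < l2" and pos: "0 < wmeas w (cube b1 l1 \<times> cube b2 l2)"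
  defines "I1 \<equiv> cube b1 l1" and "I2 \<equiv> cube b2 l2"
    and "C \<equiv> weighted_nested_partition.strong_const (2 ^ (CARD('n1) + CARD('n2))) A ps \<kappa>"
    and "K \<equiv> 2 powr p * p * (1 - \<delta>) * (real CARD('n1) + real CARD('n2)) powr (real CARD('n1) + real CARD('n2) + p) * A"
  shows "epowr ((1 / wmeas w (I1 \<times> I2)) *
        (\<integral>\<^sup>+x\<in>I1 \<times> I2. ennreal (\<bar>f x - average f (I1 \<times> I2)\<bar> powr ps * w x) \<partial>lebesgue)) (1 / ps)
    \<le> ennreal (C powr (1 / ps) * K powr (1 / p)) * (a1 p \<delta> w f I1 I2 + a2 p \<delta> w f I1 I2)"
proof -
  define R where "R = I1 \<times> I2"
  have cR: "compact R" unfolding R_def I1_def I2_def by (rule compact_rectangle)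
  have Rb: "R \<in> sets borel" unfolding R_def I1_def I2_def by (intro Times_borel cube_borel)
  define H where "H = hbox b1 l1 \<times> hbox b2 l2"
  have Hb [measurable]: "H \<in> sets borel" unfolding H_def by (intro Times_borel hbox_sets)
  have HR: "H \<subseteq> R" unfolding H_def R_def I1_def I2_def by (intro Sigma_mono hbox_subset_cube)
  have aeH: "AE x in lborel. x \<in> R \<longrightarrow> x \<in> H"
    unfolding H_def R_def I1_def I2_def by (rule AE_rectangle_hbox[OF l])
  obtain f' where f' [measurable]: "f' \<in> borel_measurable borel" and aef: "AE x in lborel. x \<in> R \<longrightarrow> f x = f' x"
    using ex_borel_AE_eq_on[OF f cR] .
  have w0: "0 \<le> w x" for x using w unfolding weight_def by blast
  obtain w'' where w'' [measurable]: "w'' \<in> borel_measurable borel" and aew'': "AE x in lborel. x \<in> R \<longrightarrow> w x = w'' x"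
    using ex_borel_AE_eq_on[of w R] w cR unfolding weight_def by blast
  \<comment> \<open>A Borel representative is nonnegative on the rectangle only almost everywhere;
    the maximum makes it nonnegative at every point, as the locale demands.\<close>
  define w' where "w' x = max 0 (w'' x)" for x
  have w' [measurable]: "w' \<in> borel_measurable borel" unfolding w'_def by measurable
  have aew: "AE x in lborel. x \<in> R \<longrightarrow> w x = w' x"
    using aew''
  proof eventually_elim
    case (elim x)
    then show ?case using w0[of x] by (auto simp: w'_def simp del: split_paired_All)
  qed
  have wm: "wmeas w R = (\<integral>\<^sup>+x. ennreal (w' x) * indicator H x \<partial>lborel)"
    unfolding wmeas_def nn_integral_completion
    by (rule nn_integral_cong_AE, use aeH aew in eventually_elim) (use HR in \<open>auto simp: indicator_def\<close>)
  have wfin: "wmeas w R < \<infinity>" by (rule wmeas_eq_integral(2)[OF w cR])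
  \<comment> \<open>Halving both sides together keeps each factor of a cell a cube, so the closed
    version \<open>R'\<close> of a cell is again an admissible rectangle, of the same measure. The
    condition for \<open>R'\<close> thus gives the one for the cell.\<close>
  have A1_cell: "AE y in lborel. y \<in> hcell b1 l1 j (fst x) \<times> hcell b2 l2 j (snd x) \<longrightarrow>
      (\<integral>\<^sup>+z. ennreal (w' z) * indicator (hcell b1 l1 j (fst x) \<times> hcell b2 l2 j (snd x)) z \<partial>lborel)
      \<le> ennreal A * emeasure lborel (hcell b1 l1 j (fst x) \<times> hcell b2 l2 j (snd x)) * ennreal (w' y)"
    if x: "x \<in> H" for x j
  proof -
    define Q where "Q = hcell b1 l1 j (fst x) \<times> hcell b2 l2 j (snd x)"
    define k where "k = (2::real) ^ j"
    have lk: "0 < l1 / k" "0 < l2 / k" using l by (auto simp: k_def)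
    obtain d1 where d1: "hcell b1 l1 j (fst x) = hbox d1 (l1 / k)"
      by (rule that[OF hcell_eq_hbox[OF l(1), of b1 j "fst x", folded k_def]])
    obtain d2 where d2: "hcell b2 l2 j (snd x) = hbox d2 (l2 / k)"
      by (rule that[OF hcell_eq_hbox[OF l(2), of b2 j "snd x", folded k_def]])
    define R' where "R' = cube d1 (l1 / k) \<times> cube d2 (l2 / k)"
    have QR': "Q \<subseteq> R'" unfolding Q_def R'_def d1 d2 by (intro Sigma_mono hbox_subset_cube)
    have "fst x \<in> hbox b1 l1" "snd x \<in> hbox b2 l2" using x by (auto simp: H_def)
    then have QH: "Q \<subseteq> H" unfolding Q_def H_def by (intro Sigma_mono hcell_subset l)
    have emQ: "emeasure lborel R' = emeasure lborel Q"
      using lk unfolding R'_def Q_def d1 d2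
      by (simp add: emeasure_lborel_Times emeasure_cube emeasure_hbox less_imp_le del: zero_less_divide_iff)
    have Qw: "(\<integral>\<^sup>+z. ennreal (w' z) * indicator Q z \<partial>lborel) \<le> wmeas w R'"
      unfolding wmeas_def nn_integral_completion
      by (rule nn_integral_mono_AE, use aew in eventually_elim) (use QR' QH HR in \<open>auto simp: indicator_def\<close>)
    show ?thesis
      unfolding Q_def[symmetric]
      using A1_bound_AE[OF w c lk, of d1 d2] aew unfolding R'_def[symmetric]
    proof eventually_elim
      case (elim y)
      show ?case
      proof
        assume y: "y \<in> Q"
        then have "wmeas w R' \<le> ennreal c * emeasure lborel Q * ennreal (w' y)"
          using elim QR' QH HR emQ by auto
        also have "\<dots> \<le> ennreal A * emeasure lborel Q * ennreal (w' y)"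
          using A by (intro mult_right_mono ennreal_leI) auto
        finally show "(\<integral>\<^sup>+z. ennreal (w' z) * indicator Q z \<partial>lborel)
          \<le> ennreal A * emeasure lborel Q * ennreal (w' y)" using Qw by order
      qed
    qed
  qed
  interpret A1_rectangle b1 b2 l1 l2 w' A p ps \<kappa> \<delta> H "\<lambda>j x. hcell b1 l1 j (fst x) \<times> hcell b2 l2 j (snd x)"
  proof (unfold_locales)
    show "(\<integral>\<^sup>+x. ennreal (w' x) * indicator H x \<partial>lborel) < \<infinity>" using wfin wm by simp
    show "0 < (\<integral>\<^sup>+x. ennreal (w' x) * indicator H x \<partial>lborel)"
      using pos wm unfolding R_def I1_def I2_def by simp
    show "0 \<le> w' x" for x by (simp add: w'_def)
  qed (use l A p ps \<kappa> \<delta> A1_cell H_def in auto)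
  have C: "C = strong_const" unfolding C_def D_def ..
  have K: "K = poincare_const" unfolding K_def poincare_const_def ..
  have Cpos: "0 < C" unfolding C strong_const_def by (intro add_pos_nonneg) auto
  have "0 < real CARD('n1) + real CARD('n2)" by (simp add: add_pos_pos)
  then have Kpos: "0 < K" unfolding K_def using p \<delta> A by simp
  obtain v where v: "0 < v" "wmeas w R = ennreal v"
    using wfin pos unfolding R_def I1_def I2_def
    by (cases "wmeas w (cube b1 l1 \<times> cube b2 l2)" rule: ennreal_cases) auto
  have int: "integrable lebesgue (\<lambda>x. indicat_real R x * f x)"
    using f cR by (auto simp: locally_integrable_def set_integrable_def)
  have aeint: "AE x in lebesgue. indicat_real R x * f x = indicat_real H x * f' x"
    unfolding AE_completion_iff using aeH aef by eventually_elim (use HR in \<open>auto simp: indicator_def\<close>)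
  have f'm: "(\<lambda>x. indicat_real H x * f' x) \<in> borel_measurable lborel" by measurable
  have intH: "integrable lborel (\<lambda>x. indicat_real H x * f' x)"
  proof -
    have "integrable lebesgue (\<lambda>x. indicat_real H x * f' x)"
      using int aeint measurable_completion[OF f'm] by (subst integrable_cong_AE[symmetric]) auto
    then show ?thesis using f'm by (simp add: integrable_completion)
  qed
  have siH: "set_integrable M H f'"
    using intH set_integral_M(2)[of f' H] by (simp add: set_integrable_def)
  have avg: "average f R = avg f' H"
  proof -
    have "(LINT x:R|lebesgue. f x) = (LINT x|lebesgue. indicat_real H x * f' x)"
      unfolding set_lebesgue_integral_def real_scaleR_def
      using int aeint measurable_completion[OF f'm] by (intro integral_cong_AE) auto
    also have "\<dots> = (LINT x:H|M. f' x)"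
      using f'm set_integral_M(1)[of f' H] by (simp add: integral_completion set_lebesgue_integral_def)
    finally have 1: "(LINT x:R|lebesgue. f x) = (LINT x:H|M. f' x)" .
    have "emeasure lborel R = emeasure lborel H"
      unfolding R_def H_def I1_def I2_def using l by (simp add: emeasure_lborel_Times emeasure_cube emeasure_hbox)
    then have "measure lebesgue R = measure M H"
      using Rb emeasure_M[of H] by (simp add: measure_def)
    then show ?thesis unfolding average_def avg_def 1 by simp
  qed
  have lhs: "(\<integral>\<^sup>+x\<in>R. ennreal (\<bar>f x - average f R\<bar> powr ps * w x) \<partial>lebesgue)
    = (\<integral>\<^sup>+x. ennreal (\<bar>f' x - avg f' H\<bar> powr ps) * ennreal (w' x) * indicator H x \<partial>lborel)"
    unfolding nn_integral_completion avg
    by (rule nn_integral_cong_AE, use aeH aef aew in eventually_elim)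
       (use HR w0 in \<open>auto simp: indicator_def ennreal_mult\<close>)
  have ae: "AE x in lborel. x \<in> I1 \<times> I2 \<longrightarrow> f x = f' x \<and> w x = w' x"
    using aef aew unfolding R_def by eventually_elim auto
  have sub: "hbox b1 l1 \<subseteq> I1" "hbox b2 l2 \<subseteq> I2"
    unfolding I1_def I2_def by (rule hbox_subset_cube)+
  have side: "side I1 = l1" "side I2 = l2" unfolding I1_def I2_def using l by (simp_all add: side_cube)
  show ?thesis
  proof (cases "a1 p \<delta> w f I1 I2 = \<infinity> \<or> a2 p \<delta> w f I1 I2 = \<infinity>")
    case True
    then show ?thesis using Cpos Kpos by (auto simp: ennreal_mult_top)
  next
    case False
    define \<alpha>1 where "\<alpha>1 = enn2real (a1 p \<delta> w f I1 I2)"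
    define \<alpha>2 where "\<alpha>2 = enn2real (a2 p \<delta> w f I1 I2)"
    have \<alpha>: "0 \<le> \<alpha>1" "0 \<le> \<alpha>2" by (simp_all add: \<alpha>1_def \<alpha>2_def)
    have a\<alpha>: "a1 p \<delta> w f I1 I2 = ennreal \<alpha>1" "a2 p \<delta> w f I1 I2 = ennreal \<alpha>2"
      using False by (auto simp: \<alpha>1_def \<alpha>2_def less_top)
    define F1 where "F1 = (\<integral>\<^sup>+x. gagliardo1 p \<delta> (hbox b1 l1) f' x * ennreal (w' x) * indicator H x \<partial>lborel)"
    define F2 where "F2 = (\<integral>\<^sup>+x. gagliardo2 p \<delta> (hbox b2 l2) f' x * ennreal (w' x) * indicator H x \<partial>lborel)"
    have vv: "ennreal v * (e / ennreal v * T) = e * T" for e T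
    proof -
      have "ennreal v * inverse (ennreal v) = 1"
        using v by (simp add: inverse_ennreal flip: ennreal_mult)
      moreover have "ennreal v * (e / ennreal v * T) = (ennreal v * inverse (ennreal v)) * (e * T)"
        by (simp only: divide_ennreal_def mult_ac)
      ultimately show ?thesis by simp
    qed
    have X1: "ennreal (l1 powr (p * \<delta>)) * F1 \<le> ennreal (v * \<alpha>1 powr p)"
    proof -
      define T where "T = (\<integral>\<^sup>+x2\<in>I2. (\<integral>\<^sup>+x1\<in>I1.
        (\<integral>\<^sup>+y1\<in>I1. ennreal (\<bar>f (x1, x2) - f (y1, x2)\<bar> powr p
            / norm (x1 - y1) powr (real CARD('n1) + p * \<delta>)) \<partial>lebesgue)
        * ennreal (w (x1, x2)) \<partial>lebesgue) \<partial>lebesgue)"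
      have eq: "a1 p \<delta> w f I1 I2 = epowr (ennreal (l1 powr (p * \<delta>)) / ennreal v * T) (1 / p)"
        unfolding a1_def T_def side v(2)[unfolded R_def] ..
      then have "ennreal (l1 powr (p * \<delta>)) / ennreal v * T = ennreal (\<alpha>1 powr p)"
        unfolding \<alpha>1_def using p False by (metis epowr_finiteD less_le_trans zero_less_one)
      then have "ennreal (l1 powr (p * \<delta>)) * T = ennreal v * ennreal (\<alpha>1 powr p)"
        by (metis vv)
      moreover have "F1 \<le> T"
        unfolding F1_def T_def H_def by (rule nn_integral_gagliardo1_le[OF f' w' hbox_sets hbox_sets ae sub])
      ultimately show ?thesis using v by (metis ennreal_mult' less_imp_le mult_left_mono zero_le)
    qed
    have X2: "ennreal (l2 powr (p * \<delta>)) * F2 \<le> ennreal (v * \<alpha>2 powr p)"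
    proof -
      define T where "T = (\<integral>\<^sup>+y1\<in>I1. (\<integral>\<^sup>+y2\<in>I2.
        (\<integral>\<^sup>+x2\<in>I2. ennreal (\<bar>f (y1, x2) - f (y1, y2)\<bar> powr p
            / norm (x2 - y2) powr (real CARD('n2) + p * \<delta>)) \<partial>lebesgue)
        * ennreal (w (y1, y2)) \<partial>lebesgue) \<partial>lebesgue)"
      have eq: "a2 p \<delta> w f I1 I2 = epowr (ennreal (l2 powr (p * \<delta>)) / ennreal v * T) (1 / p)"
        unfolding a2_def T_def side v(2)[unfolded R_def] ..
      then have "ennreal (l2 powr (p * \<delta>)) / ennreal v * T = ennreal (\<alpha>2 powr p)"
        unfolding \<alpha>2_def using p False by (metis epowr_finiteD less_le_trans zero_less_one)
      then have "ennreal (l2 powr (p * \<delta>)) * T = ennreal v * ennreal (\<alpha>2 powr p)"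
        by (metis vv)
      moreover have "F2 \<le> T"
        unfolding F2_def T_def H_def by (rule nn_integral_gagliardo2_le[OF f' w' hbox_sets hbox_sets ae sub])
      ultimately show ?thesis using v by (metis ennreal_mult' less_imp_le mult_left_mono zero_le)
    qed
    have Fint: "(\<integral>\<^sup>+x. F f' x * ennreal (w' x) * indicator H x \<partial>lborel) \<le> ennreal (v * (\<alpha>1 + \<alpha>2) powr p)"
    proof -
      have "(\<integral>\<^sup>+x. F f' x * ennreal (w' x) * indicator H x \<partial>lborel)
          = ennreal (l1 powr (p * \<delta>)) * F1 + ennreal (l2 powr (p * \<delta>)) * F2"
        unfolding F_def F1_def F2_def by (simp add: distrib_right mult.assoc nn_integral_add nn_integral_cmult)
      also have "\<dots> \<le> ennreal (v * \<alpha>1 powr p) + ennreal (v * \<alpha>2 powr p)" by (intro add_mono X1 X2)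
      also have "\<dots> = ennreal (v * (\<alpha>1 powr p + \<alpha>2 powr p))" using v by (simp add: distrib_left flip: ennreal_plus)
      \<comment> \<open>Superadditivity of the \<open>p\<close>-th power merges the two energies
        into the sum \<open>a1 + a2\<close> without a constant.\<close>
      also have "\<dots> \<le> ennreal (v * (\<alpha>1 + \<alpha>2) powr p)"
        using v \<alpha> p by (intro ennreal_leI mult_left_mono powr_superadd) auto
      finally show ?thesis .
    qed
    have "epowr ((1 / wmeas w R) * (\<integral>\<^sup>+x\<in>R. ennreal (\<bar>f x - average f R\<bar> powr ps * w x) \<partial>lebesgue)) (1 / ps)
      \<le> ennreal (C powr (1 / ps) * (K powr (1 / p) * (\<alpha>1 + \<alpha>2)))"
    proof (rule ennreal_le_of_forall_gt)
      fix B assume B: "0 < B" "K powr (1 / p) * (\<alpha>1 + \<alpha>2) \<le> B"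
      have "K * (\<alpha>1 + \<alpha>2) powr p = (K powr (1 / p) * (\<alpha>1 + \<alpha>2)) powr p"
        using Kpos p by (simp add: powr_mult powr_powr)
      also have "\<dots> \<le> B powr p" using B \<alpha> p by (intro powr_mono2) auto
      finally have KB: "K * (\<alpha>1 + \<alpha>2) powr p \<le> B powr p" .
      have "ennreal K * (\<integral>\<^sup>+x. F f' x * ennreal (w' x) * indicator H x \<partial>lborel)
          \<le> ennreal K * ennreal (v * (\<alpha>1 + \<alpha>2) powr p)"
        by (intro mult_left_mono Fint) simp
      also have "\<dots> = ennreal (v * (K * (\<alpha>1 + \<alpha>2) powr p))"
        using Kpos by (simp add: mult_ac flip: ennreal_mult')
      also have "\<dots> \<le> ennreal (v * B powr p)" using v KB by (intro ennreal_leI mult_left_mono) auto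
      also have "\<dots> = ennreal (B powr p) * (\<integral>\<^sup>+x. ennreal (w' x) * indicator H x \<partial>lborel)"
        using v wm by (simp add: ennreal_mult mult.commute)
      finally have "(\<integral>\<^sup>+x. ennreal (\<bar>f' x - avg f' H\<bar> powr ps) * ennreal (w' x) * indicator H x \<partial>lborel)
        \<le> ennreal (C * B powr ps) * (\<integral>\<^sup>+x. ennreal (w' x) * indicator H x \<partial>lborel)"
        unfolding K C by (intro fractional_poincare_sobolev f' siH B)
      then have "(\<integral>\<^sup>+x\<in>R. ennreal (\<bar>f x - average f R\<bar> powr ps * w x) \<partial>lebesgue) \<le> ennreal (C * B powr ps) * ennreal v"
        unfolding lhs wm[symmetric] v(2) .
      then have "(1 / wmeas w R) * (\<integral>\<^sup>+x\<in>R. ennreal (\<bar>f x - average f R\<bar> powr ps * w x) \<partial>lebesgue)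
          \<le> (1 / ennreal v) * (ennreal (C * B powr ps) * ennreal v)"
        unfolding v(2) by (rule mult_left_mono) simp
      also have "\<dots> = ennreal (C * B powr ps)"
      proof -
        have "1 / ennreal v = ennreal (1 / v)" using v by (simp add: divide_ennreal flip: ennreal_1)
        then show ?thesis using v Cpos by (simp flip: ennreal_mult)
      qed
      finally have "epowr ((1 / wmeas w R) * (\<integral>\<^sup>+x\<in>R. ennreal (\<bar>f x - average f R\<bar> powr ps * w x) \<partial>lebesgue)) (1 / ps)
          \<le> epowr (ennreal (C * B powr ps)) (1 / ps)"
        using ps by (intro epowr_mono) auto
      also have "\<dots> = ennreal (C powr (1 / ps) * B)"
        using Cpos B ps by (simp add: epowr_ennreal powr_mult powr_powr)
      finally show "epowr ((1 / wmeas w R) * (\<integral>\<^sup>+x\<in>R. ennreal (\<bar>f x - average f R\<bar> powr ps * w x) \<partial>lebesgue)) (1 / ps)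
          \<le> ennreal (C powr (1 / ps) * B)" .
    qed (use Cpos \<alpha> in auto)
    also have "\<dots> = ennreal (C powr (1 / ps) * K powr (1 / p)) * (ennreal \<alpha>1 + ennreal \<alpha>2)"
      using \<alpha> by (simp add: mult.assoc flip: ennreal_plus ennreal_mult)
    finally show ?thesis unfolding R_def a\<alpha> .
  qed
qed

theorem theorem2p20:
  fixes p pstar :: real
  assumes "1 \<le> p" and "0 < pstar"
  shows "\<exists>c::real. \<forall>(\<delta>::real) (w :: (real ^ 'n1) \<times> (real ^ 'n2) \<Rightarrow> real).
    0 < \<delta> \<longrightarrow> \<delta> < 1 \<longrightarrow> A1_weight w \<longrightarrow>
    1 / p - 1 / pstar
      = \<delta> / (real CARD('n1) + real CARD('n2)) * (1 / (1 + ln (A1_const w))) \<longrightarrow>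
    (\<forall>f. locally_integrable f \<longrightarrow>
      (\<forall>I1\<in>cubes. \<forall>I2\<in>cubes.
        epowr ((1 / wmeas w (I1 \<times> I2)) *
            (\<integral>\<^sup>+x\<in>I1 \<times> I2. ennreal (\<bar>f x - average f (I1 \<times> I2)\<bar> powr pstar * w x) \<partial>lebesgue))
          (1 / pstar)
        \<le> ennreal (c * A1_const w powr (1 / p) * (1 - \<delta>) powr (1 / p))
            * (a1 p \<delta> w f I1 I2 + a2 p \<delta> w f I1 I2)))"
proof -
  define n where "n = real CARD('n1) + real CARD('n2)"
  have n: "0 < n" by (simp add: n_def add_pos_pos)
  define \<kappa> where "\<kappa> = 1 / p - 1 / pstar"
  \<comment> \<open>Determined by \<open>p\<close>, \<open>pstar\<close> and the dimension, hence
    fixed before \<delta> and \<open>w\<close>; the summand 1 is the margin of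
    \<open>A1_const_approx\<close>.\<close>
  define A where "A = exp (1 / (\<kappa> * n)) + 1"
  define C where "C = weighted_nested_partition.strong_const (2 ^ (CARD('n1) + CARD('n2))) A pstar \<kappa>"
  define k where "k = 2 powr p * p * n powr (n + p) * A"
  have A1: "1 \<le> A" by (simp add: A_def)
  have k: "0 < k" using assms A1 n by (simp add: k_def)
  define c where "c = C powr (1 / pstar) * k powr (1 / p)"
  have c: "0 \<le> c" by (simp add: c_def)
  show ?thesis
  proof (intro exI[of _ c] allI impI ballI)
    fix \<delta> :: real and w f :: "(real ^ 'n1) \<times> (real ^ 'n2) \<Rightarrow> real"
      and I1 :: "(real ^ 'n1) set" and I2 :: "(real ^ 'n2) set"
    assume \<delta>: "0 < \<delta>" "\<delta> < 1" and w: "A1_weight w"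
      and eq: "1 / p - 1 / pstar
        = \<delta> / (real CARD('n1) + real CARD('n2)) * (1 / (1 + ln (A1_const w)))"
      and f: "locally_integrable f" and "I1 \<in> cubes" "I2 \<in> cubes"
    then obtain b1 l1 b2 l2 where I: "I1 = cube b1 l1" "I2 = cube b2 l2" and l: "0 < l1" "0 < l2"
      by (auto simp: cubes_def)
    have w': "weight w" using w by (simp add: A1_weight_def)
    let ?L = "\<integral>\<^sup>+x\<in>I1 \<times> I2. ennreal (\<bar>f x - average f (I1 \<times> I2)\<bar> powr pstar * w x) \<partial>lebesgue"
    show "epowr ((1 / wmeas w (I1 \<times> I2)) * ?L) (1 / pstar)
        \<le> ennreal (c * A1_const w powr (1 / p) * (1 - \<delta>) powr (1 / p))
            * (a1 p \<delta> w f I1 I2 + a2 p \<delta> w f I1 I2)"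
    proof (cases "wmeas w (I1 \<times> I2) = 0")
      \<comment> \<open>Without mass on this rectangle the bound \<open>1 \<le> A1_const w\<close>
        is not at hand. The left side is then \<open>\<infinity> * 0 = 0\<close>, because the
        integrand vanishes almost everywhere together with the weight.\<close>
      case True
      have "(\<lambda>x. indicat_real (I1 \<times> I2) x * w x) \<in> borel_measurable lebesgue"
        using w' compact_rectangle[of b1 l1 b2 l2] unfolding I
        by (auto simp: weight_def locally_integrable_def set_integrable_def)
      then have "(\<lambda>x. ennreal (indicat_real (I1 \<times> I2) x * w x)) \<in> borel_measurable lebesgue" by measurable
      also have "(\<lambda>x. ennreal (indicat_real (I1 \<times> I2) x * w x)) = (\<lambda>x. ennreal (w x) * indicator (I1 \<times> I2) x)"
        by (auto simp: indicator_def)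
      finally have "AE x in lebesgue. ennreal (w x) * indicator (I1 \<times> I2) x = 0"
        using True unfolding wmeas_def by (subst (asm) nn_integral_0_iff_AE) auto
      then have "AE x in lebesgue. ennreal (\<bar>f x - average f (I1 \<times> I2)\<bar> powr pstar * w x) * indicator (I1 \<times> I2) x = 0"
        by eventually_elim (auto simp: indicator_def ennreal_mult' split: if_splits)
      then have "?L = (\<integral>\<^sup>+x. 0 \<partial>(lebesgue :: ((real ^ 'n1) \<times> (real ^ 'n2)) measure))" by (rule nn_integral_cong_AE)
      then show ?thesis by (simp add: epowr_def)
    next
      case False
      then have pos: "0 < wmeas w (cube b1 l1 \<times> cube b2 l2)" by (simp add: I zero_less_iff_neq_zero)
      obtain a where a: "1 \<le> a" "A1_bound w a" "a < A1_const w + 1" and K1: "1 \<le> A1_const w"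
        using A1_const_approx[OF w l pos] .
      define s where "s = 1 + ln (A1_const w)"
      have s: "1 \<le> s" using K1 by (simp add: s_def)
      have \<kappa>eq: "\<kappa> = \<delta> / n * (1 / s)" using eq by (simp add: \<kappa>_def n_def s_def)
      then have \<kappa>: "0 < \<kappa>" using \<delta> n s by simp
      have \<kappa>s: "\<kappa> * n * s = \<delta>" using \<kappa>eq n s by simp
      have \<kappa>\<delta>: "\<kappa> * n \<le> \<delta>" using \<kappa>s mult_left_mono[OF s, of "\<kappa> * n"] \<kappa> n by simp
      have "s \<le> 1 / (\<kappa> * n)" using \<kappa>s \<delta> \<kappa> n by (simp add: field_simps)
      then have "ln (A1_const w) \<le> 1 / (\<kappa> * n)" by (simp add: s_def)
      then have "exp (ln (A1_const w)) \<le> exp (1 / (\<kappa> * n))" by simp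
      then have "A1_const w \<le> exp (1 / (\<kappa> * n))" using K1 by simp
      then have aA: "a \<le> A" using a by (simp add: A_def)
      have "epowr ((1 / wmeas w (I1 \<times> I2)) * ?L) (1 / pstar)
        \<le> ennreal (C powr (1 / pstar) * (k * (1 - \<delta>)) powr (1 / p)) * (a1 p \<delta> w f I1 I2 + a2 p \<delta> w f I1 I2)"
        using rectangle_estimate[OF assms \<kappa> \<kappa>_def \<delta> \<kappa>\<delta>[unfolded n_def] w' f _ a(2) A1 aA l pos] a
        unfolding I C_def k_def n_def by (simp add: mult_ac)
      also have "\<dots> \<le> ennreal (c * A1_const w powr (1 / p) * (1 - \<delta>) powr (1 / p))
            * (a1 p \<delta> w f I1 I2 + a2 p \<delta> w f I1 I2)"
      proof (intro mult_right_mono ennreal_leI)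
        \<comment> \<open>The dependence on the weight is already absorbed into \<open>A\<close>,
          hence into \<open>c\<close>; the power of \<open>A1_const w\<close> is at least 1 and may
          be inserted.\<close>
        have "c * (1 - \<delta>) powr (1 / p) * 1 \<le> c * (1 - \<delta>) powr (1 / p) * A1_const w powr (1 / p)"
          using c K1 assms by (intro mult_left_mono ge_one_powr_ge_zero) auto
        then show "C powr (1 / pstar) * (k * (1 - \<delta>)) powr (1 / p) \<le> c * A1_const w powr (1 / p) * (1 - \<delta>) powr (1 / p)"
          by (simp add: c_def powr_mult mult_ac)
      qed simp
      finally show ?thesis .
    qed
  qed
qed

end
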